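(* Let $A$ be a finite-dimensional unital algebra over a field $F$ of characteristic $0$, and let $V\subseteq \mathrm{LN_{alt}}(A)$ be a subsystem (a subspace closed under the triple product of $\mathrm{LN_{alt}}(A)$) such that $ab=ba$ for all $a,b\in V$. Assume that $A$ is generated by $V$ as a unital algebra. Then the Lie triple system $V$ is nilpotent, and $A$ decomposes, as a vector space, as $A=Q\oplus R$, where $R$ is a nilpotent ideal of $A$ and $Q$ is a subalgebra contained in the centre ${\rm Z}(A)$ which has no nonzero nilpotent elements.
   Context: Algebras are not necessarily associative. For an algebra $A$, $(x,y,z)=(xy)z-x(yz)$ is the associator. The left generalised alternative nucleus is $\mathrm{LN_{alt}}(A)=\{a\in A : (a,x,y)=-(x,a,y)\ \forall x,y\in A\}$; it is a Lie triple system under $[a,b,c]=a(bc)-b(ac)-c(ab)+c(ba)$. A Lie triple system (L.t.s.) is a vector space $V$ with trilinear product $[\cdot,\cdot,\cdot]$ satisfying $[a,a,b]=0$, $[a,b,c]+[b,c,a]+[c,a,b]=0$ and $[x,y,[a,b,c]]=[[x,y,a],b,c]+[a,[x,y,b],c]+[a,b,[x,y,c]]$. Lower central series: $V^0=V$, $V^1=[V,V,V]$, $V^{n+1}=[V^n,V,V]+[V,V,V^n]$; $V$ is nilpotent if $V^n=0$ for some $n$. An algebra (or ideal) $R$ is nilpotent if there is $N$ such that every product of $N$ elements of $R$, with any arrangement of parentheses, is zero. The centre ${\rm Z}(A)$ is the set of elements that commute with all elements of $A$ and lie in the left, middle and right associative nuclei (i.e. all associators involving them vanish). *)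

theory Defs
  imports Complex_Main
begin

text \<open>A (not necessarily associative) algebra over the field 'f is modelled by a
  vector space structure scale on the type 'v together with a bilinear product mult.
  The whole type 'v is the carrier of the algebra A.\<close>

definition nalg :: "('f::field \<Rightarrow> 'v::ab_group_add \<Rightarrow> 'v) \<Rightarrow> ('v \<Rightarrow> 'v \<Rightarrow> 'v) \<Rightarrow> bool" where
  "nalg scale mult \<longleftrightarrow> vector_space scale \<and>
     (\<forall>x. Vector_Spaces.linear scale scale (mult x)) \<and>
     (\<forall>y. Vector_Spaces.linear scale scale (\<lambda>x. mult x y))"

definition fin_dim :: "('f::field \<Rightarrow> 'v::ab_group_add \<Rightarrow> 'v) \<Rightarrow> bool" where
  "fin_dim scale \<longleftrightarrow> (\<exists>B. finite_dimensional_vector_space scale B)"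

definition is_unit_elem :: "('v \<Rightarrow> 'v \<Rightarrow> 'v) \<Rightarrow> 'v \<Rightarrow> bool" where
  "is_unit_elem mult e \<longleftrightarrow> (\<forall>x. mult e x = x \<and> mult x e = x)"

definition associator :: "('v::ab_group_add \<Rightarrow> 'v \<Rightarrow> 'v) \<Rightarrow> 'v \<Rightarrow> 'v \<Rightarrow> 'v \<Rightarrow> 'v" where
  "associator mult x y z = mult (mult x y) z - mult x (mult y z)"

definition LN_alt :: "('v::ab_group_add \<Rightarrow> 'v \<Rightarrow> 'v) \<Rightarrow> 'v set" where
  "LN_alt mult = {a. \<forall>x y. associator mult a x y = - associator mult x a y}"

definition triple :: "('v::ab_group_add \<Rightarrow> 'v \<Rightarrow> 'v) \<Rightarrow> 'v \<Rightarrow> 'v \<Rightarrow> 'v \<Rightarrow> 'v" where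
  "triple mult a b c = mult a (mult b c) - mult b (mult a c) - mult c (mult a b) + mult c (mult b a)"

definition lts_subsystem :: "('f::field \<Rightarrow> 'v::ab_group_add \<Rightarrow> 'v) \<Rightarrow> ('v \<Rightarrow> 'v \<Rightarrow> 'v) \<Rightarrow> 'v set \<Rightarrow> bool" where
  "lts_subsystem scale mult V \<longleftrightarrow> module.subspace scale V \<and> V \<subseteq> LN_alt mult \<and>
     (\<forall>a\<in>V. \<forall>b\<in>V. \<forall>c\<in>V. triple mult a b c \<in> V)"

definition subalgebra :: "('f::field \<Rightarrow> 'v::ab_group_add \<Rightarrow> 'v) \<Rightarrow> ('v \<Rightarrow> 'v \<Rightarrow> 'v) \<Rightarrow> 'v set \<Rightarrow> bool" where
  "subalgebra scale mult S \<longleftrightarrow> module.subspace scale S \<and> (\<forall>x\<in>S. \<forall>y\<in>S. mult x y \<in> S)"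

definition generates_unital :: "('f::field \<Rightarrow> 'v::ab_group_add \<Rightarrow> 'v) \<Rightarrow> ('v \<Rightarrow> 'v \<Rightarrow> 'v) \<Rightarrow> 'v \<Rightarrow> 'v set \<Rightarrow> bool" where
  "generates_unital scale mult e V \<longleftrightarrow>
     (\<forall>S. subalgebra scale mult S \<and> e \<in> S \<and> V \<subseteq> S \<longrightarrow> S = UNIV)"

fun lts_lcs :: "('f::field \<Rightarrow> 'v::ab_group_add \<Rightarrow> 'v) \<Rightarrow> ('v \<Rightarrow> 'v \<Rightarrow> 'v) \<Rightarrow> 'v set \<Rightarrow> nat \<Rightarrow> 'v set" where
  "lts_lcs scale mult V 0 = V"
| "lts_lcs scale mult V (Suc n) = module.span scale
     ({triple mult a b c | a b c. a \<in> lts_lcs scale mult V n \<and> b \<in> V \<and> c \<in> V} \<union>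
      {triple mult a b c | a b c. a \<in> V \<and> b \<in> V \<and> c \<in> lts_lcs scale mult V n})"

definition lts_nilpotent :: "('f::field \<Rightarrow> 'v::ab_group_add \<Rightarrow> 'v) \<Rightarrow> ('v \<Rightarrow> 'v \<Rightarrow> 'v) \<Rightarrow> 'v set \<Rightarrow> bool" where
  "lts_nilpotent scale mult V \<longleftrightarrow> (\<exists>n. lts_lcs scale mult V n = {0})"

inductive is_prod :: "('v \<Rightarrow> 'v \<Rightarrow> 'v) \<Rightarrow> 'v set \<Rightarrow> nat \<Rightarrow> 'v \<Rightarrow> bool"
  for mult :: "'v \<Rightarrow> 'v \<Rightarrow> 'v" and R :: "'v set" where
  base: "x \<in> R \<Longrightarrow> is_prod mult R 1 x"
| prod: "is_prod mult R m x \<Longrightarrow> is_prod mult R k y \<Longrightarrow> is_prod mult R (m + k) (mult x y)"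

definition nilpotent_set :: "('v::zero \<Rightarrow> 'v \<Rightarrow> 'v) \<Rightarrow> 'v set \<Rightarrow> bool" where
  "nilpotent_set mult R \<longleftrightarrow> (\<exists>N>0. \<forall>x. is_prod mult R N x \<longrightarrow> x = 0)"

definition is_ideal :: "('f::field \<Rightarrow> 'v::ab_group_add \<Rightarrow> 'v) \<Rightarrow> ('v \<Rightarrow> 'v \<Rightarrow> 'v) \<Rightarrow> 'v set \<Rightarrow> bool" where
  "is_ideal scale mult R \<longleftrightarrow> module.subspace scale R \<and>
     (\<forall>x. \<forall>r\<in>R. mult x r \<in> R \<and> mult r x \<in> R)"

definition centre :: "('v::ab_group_add \<Rightarrow> 'v \<Rightarrow> 'v) \<Rightarrow> 'v set" where
  "centre mult = {z. \<forall>x y. mult z x = mult x z \<and>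
      associator mult z x y = 0 \<and> associator mult x z y = 0 \<and> associator mult x y z = 0}"

text \<open>Right powers: rpow x n = x^(n+1).\<close>
fun rpow :: "('v \<Rightarrow> 'v \<Rightarrow> 'v) \<Rightarrow> 'v \<Rightarrow> nat \<Rightarrow> 'v" where
  "rpow mult x 0 = x"
| "rpow mult x (Suc n) = mult (rpow mult x n) x"

definition nilpotent_elem :: "('v::zero \<Rightarrow> 'v \<Rightarrow> 'v) \<Rightarrow> 'v \<Rightarrow> bool" where
  "nilpotent_elem mult x \<longleftrightarrow> (\<exists>n. rpow mult x n = 0)"

end

theory Submission
  imports "HOL-Algebra.Algebraic_Closure_Type" "HOL-Library.Function_Algebras" Defs
begin

text \<open>Write L x for left multiplication by x. For a in V the generalised alternative law reads
  L (a x + x a) = L a L x + L x L a. Hence L embeds V into End A as a Lie triple system, the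
  commutators [L a, L b] are derivations of A that kill the unit e, and A is spanned by the values at e
  of the words in L V.

  The square of ad (L a) acts nilpotently on V. Otherwise it is invertible on a nonzero subspace V1 of V.
  Let l and r be the multiplications of End A by L a from the left and from the right, let s = l + r and
  d = l - r, and let P and N be the spans of the s^i (L b) and of the l^i (L b) with b in V1. Then
  P + d P = N + d N, evaluation at e is injective on P because P consists of operators L x, and it
  vanishes on d N. Counting dimensions, both sums are direct, so that s d^(2j+1) and l d^(2j+1) have
  trace 0. As s = 2 l - d, all even powers of d have trace 0, which is absurd as d is invertible.

  Consequently the semisimple part of L a, being a polynomial in L a, commutes with L V and is of the form
  L u with u central. After enlarging V by the centre of A, the elements of V with nilpotent left
  multiplication form a subsystem V', and the trace form of A vanishes on L V'. Cartan's argument shows that the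
  derivations in [L V', L V'] are nilpotent, and Engel's theorem in Jacobson's form makes the associative
  algebra generated by L V' nilpotent. Now R is the ideal V' A, and Q consists of the central elements
  whose multiplication is diagonalisable over the algebraic closure.\<close>

section \<open>Traces on finite-dimensional subspaces\<close>

text \<open>Two obstacles shape the proof. The field need not contain the eigenvalues of its
  operators. They are therefore studied on the functionals from \<open>A\<close> to the algebraic
  closure that are linear over the base field, on which operators act by composition. Results come
  back through coordinates, and through a functional from the closure to the base field applied to
  the coefficients of a polynomial; Cartan's argument for derivations needs the latter, since its
  auxiliary polynomial has coefficients in the closure.

  The other obstacle is non-associativity. That long products of operators from \<open>L V'\<close>
  vanish does not yet make the ideal of \<open>V'\<close> nilpotent, because a product of two of its
  elements \<open>x\<close> and \<open>y\<close> involves \<open>L x\<close>. One needs that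
  \<open>L x\<close> is a combination of words no lighter than those whose values at
  \<open>e\<close> give \<open>x\<close>. Rewriting does not preserve the number of letters, as
  commutators of letters create the new letters [a,b,c]. Hence letters carry weights that add up
  under the triple product, and the values of words form a multiplicative filtration of
  \<open>A\<close>.\<close>

locale lin_space = vector_space scale
  for scale :: "'a::field \<Rightarrow> 'b::ab_group_add \<Rightarrow> 'b" (infixr "*s" 75)
begin

abbreviation lin :: "('b \<Rightarrow> 'b) \<Rightarrow> bool" where
  "lin f \<equiv> Vector_Spaces.linear scale scale f"

lemma linI:
  assumes "\<And>x y. f (x + y) = f x + f y" "\<And>c x. f (c *s x) = c *s f x"
  shows "lin f"
  using assms vector_space_axioms by (simp add: Vector_Spaces.linear_iff)

lemma lin_add: "lin f \<Longrightarrow> f (x + y) = f x + f y"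
  and lin_scale: "lin f \<Longrightarrow> f (c *s x) = c *s f x"
  by (simp_all add: Vector_Spaces.linear_iff)

lemma lin_0: "lin f \<Longrightarrow> f 0 = 0"
  using lin_scale[of f 0 0] by simp

lemma lin_neg: "lin f \<Longrightarrow> f (- x) = - f x"
  using lin_add[of f x "- x"] lin_0[of f] by (simp add: eq_neg_iff_add_eq_0 add.commute)

lemma lin_diff: "lin f \<Longrightarrow> f (x - y) = f x - f y"
  using lin_add[of f x "- y"] lin_neg[of f y] by simp

lemma lin_sum: "lin f \<Longrightarrow> f (\<Sum>i\<in>I. g i) = (\<Sum>i\<in>I. f (g i))"
  by (induction I rule: infinite_finite_induct) (simp_all add: lin_0 lin_add)

lemma lin_id: "lin (\<lambda>x. x)"
  by (rule linI) simp_all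

lemma lin_comp: "lin f \<Longrightarrow> lin g \<Longrightarrow> lin (f \<circ> g)"
  by (rule linI) (simp_all add: lin_add lin_scale)

lemma lin_funpow: "lin f \<Longrightarrow> lin (f ^^ n)"
  by (induction n) (simp_all add: lin_id[folded id_def] lin_comp)

lemma lin_span_image:
  assumes "lin f" "\<And>x. x \<in> S \<Longrightarrow> f x \<in> T" "subspace T" "y \<in> span S"
  shows "f y \<in> T"
  using assms(4)
proof (induction rule: span_induct_alt)
  case base
  show ?case using assms(1,3) by (simp add: lin_0 subspace_0)
next
  case (step c x y)
  then show ?case using assms by (simp add: lin_add lin_scale subspace_add subspace_scale)
qed

lemma funpow_image:
  "(\<And>x. x \<in> M \<Longrightarrow> f x \<in> M) \<Longrightarrow> x \<in> M \<Longrightarrow> (f ^^ n) x \<in> M"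
  by (induction n) auto

section \<open>Traces with respect to a basis\<close>

definition basis_trace :: "'b set \<Rightarrow> ('b \<Rightarrow> 'b) \<Rightarrow> 'a" where
  "basis_trace B f = (\<Sum>b\<in>B. representation B (f b) b)"

lemma representation_sum_scale:
  assumes "independent B" "\<And>i. i \<in> I \<Longrightarrow> x i \<in> span B"
  shows "representation B (\<Sum>i\<in>I. c i *s x i) b = (\<Sum>i\<in>I. c i * representation B (x i) b)"
proof -
  have 1: "c i *s x i \<in> span B" if "i \<in> I" for i
    by (rule span_scale) (rule assms(2)[OF that])
  have 2: "representation B (c i *s x i) b = c i * representation B (x i) b" if "i \<in> I" for i
    using representation_scale[OF assms(1) assms(2)[OF that], of "c i"] by (rule fun_cong)
  have "representation B (\<Sum>i\<in>I. c i *s x i) b = (\<Sum>i\<in>I. representation B (c i *s x i) b)"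
    using representation_sum[OF assms(1) 1] by (rule fun_cong)
  also have "\<dots> = (\<Sum>i\<in>I. c i * representation B (x i) b)"
    by (rule sum.cong[OF refl 2])
  finally show ?thesis .
qed

text \<open>Expanding \<open>f b\<close> in \<open>B'\<close> on one side, and each element of
  \<open>B'\<close> in \<open>B\<close> on the other, turns both traces into the same double
  sum.\<close>

lemma basis_trace_basis_indep:
  assumes B: "finite B" "independent B" and B': "finite B'" "independent B'"
    and sp: "span B = span B'" and f: "lin f" "\<And>x. x \<in> span B \<Longrightarrow> f x \<in> span B"
  shows "basis_trace B f = basis_trace B' f"
proof -
  have mB: "b \<in> B \<Longrightarrow> b \<in> span B" and mB': "b \<in> B' \<Longrightarrow> b \<in> span B" for b
    using span_base sp by blast+
  have 1: "representation B (f b) b = (\<Sum>b'\<in>B'. representation B' (f b) b' * representation B b' b)"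
    if "b \<in> B" for b
  proof -
    have "f b = (\<Sum>b'\<in>B'. representation B' (f b) b' *s b')"
      by (rule sum_representation_eq[OF B'(2) _ B'(1) order_refl, symmetric])
        (use f(2) mB that sp in blast)
    then have "representation B (f b) b = representation B (\<Sum>b'\<in>B'. representation B' (f b) b' *s b') b"
      by simp
    also have "\<dots> = (\<Sum>b'\<in>B'. representation B' (f b) b' * representation B b' b)"
      by (rule representation_sum_scale[OF B(2) mB'])
    finally show ?thesis .
  qed
  have 2: "representation B' (f b') b' = (\<Sum>b\<in>B. representation B b' b * representation B' (f b) b')"
    if "b' \<in> B'" for b'
  proof -
    have "b' = (\<Sum>b\<in>B. representation B b' b *s b)"
      by (rule sum_representation_eq[OF B(2) mB'[OF that] B(1) order_refl, symmetric])
    then have "f b' = f (\<Sum>b\<in>B. representation B b' b *s b)" by simp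
    also have "\<dots> = (\<Sum>b\<in>B. representation B b' b *s f b)"
      by (simp add: lin_sum[OF f(1)] lin_scale[OF f(1)])
    finally have "representation B' (f b') b' = representation B' (\<Sum>b\<in>B. representation B b' b *s f b) b'"
      by simp
    also have "\<dots> = (\<Sum>b\<in>B. representation B b' b * representation B' (f b) b')"
      by (rule representation_sum_scale[OF B'(2)]) (use mB f(2) sp in blast)
    finally show ?thesis .
  qed
  have "basis_trace B f = (\<Sum>b\<in>B. \<Sum>b'\<in>B'. representation B' (f b) b' * representation B b' b)"
    unfolding basis_trace_def using 1 by simp
  also have "\<dots> = (\<Sum>b'\<in>B'. \<Sum>b\<in>B. representation B b' b * representation B' (f b) b')"
    by (subst sum.swap) (simp add: mult.commute)
  also have "\<dots> = basis_trace B' f" unfolding basis_trace_def using 2 by simp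
  finally show ?thesis .
qed

lemma basis_trace_comm:
  assumes B: "finite B" "independent B"
    and f: "lin f" "\<And>x. x \<in> span B \<Longrightarrow> f x \<in> span B"
    and g: "lin g" "\<And>x. x \<in> span B \<Longrightarrow> g x \<in> span B"
  shows "basis_trace B (f \<circ> g) = basis_trace B (g \<circ> f)"
proof -
  have *: "representation B (f (g b)) b = (\<Sum>c\<in>B. representation B (g b) c * representation B (f c) b)"
    if "b \<in> B" "lin f" "\<And>x. x \<in> span B \<Longrightarrow> f x \<in> span B"
      "\<And>x. x \<in> span B \<Longrightarrow> g x \<in> span B" for b f g
  proof -
    have "g b = (\<Sum>c\<in>B. representation B (g b) c *s c)"
      by (rule sum_representation_eq[OF B(2) _ B(1) order_refl, symmetric])
        (use that span_base in blast)
    then have "f (g b) = f (\<Sum>c\<in>B. representation B (g b) c *s c)" by simp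
    also have "\<dots> = (\<Sum>c\<in>B. representation B (g b) c *s f c)"
      by (simp add: lin_sum[OF that(2)] lin_scale[OF that(2)])
    finally have "representation B (f (g b)) b
        = representation B (\<Sum>c\<in>B. representation B (g b) c *s f c) b" by simp
    also have "\<dots> = (\<Sum>c\<in>B. representation B (g b) c * representation B (f c) b)"
      by (rule representation_sum_scale[OF B(2)]) (use that span_base in blast)
    finally show ?thesis .
  qed
  have "basis_trace B (f \<circ> g) = (\<Sum>b\<in>B. \<Sum>c\<in>B. representation B (g b) c * representation B (f c) b)"
    unfolding basis_trace_def comp_def by (rule sum.cong[OF refl], rule *[OF _ f g(2)])
  also have "\<dots> = (\<Sum>c\<in>B. \<Sum>b\<in>B. representation B (f c) b * representation B (g b) c)"
    by (subst sum.swap) (simp add: mult.commute)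
  also have "\<dots> = basis_trace B (g \<circ> f)"
    unfolding basis_trace_def comp_def by (rule sum.cong[OF refl], rule *[OF _ g f(2), symmetric])
  finally show ?thesis .
qed

section \<open>Traces on invariant subspaces of finite dimension\<close>

definition fin_span :: "'b set \<Rightarrow> bool" where
  "fin_span M \<longleftrightarrow> (\<exists>B. finite B \<and> independent B \<and> span B = M)"

definition some_basis :: "'b set \<Rightarrow> 'b set" where
  "some_basis M = (SOME B. finite B \<and> independent B \<and> span B = M)"

text \<open>Operators stay total functions on the ambient type, so that one operator can be traced
  on several subspaces; the value is meaningful for a finite-dimensional \<open>M\<close> that is
  mapped into itself.\<close>

definition trace_on :: "'b set \<Rightarrow> ('b \<Rightarrow> 'b) \<Rightarrow> 'a" where
  "trace_on M f = basis_trace (some_basis M) f"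

lemma some_basis:
  assumes "fin_span M"
  shows "finite (some_basis M)" "independent (some_basis M)" "span (some_basis M) = M"
    "\<And>b. b \<in> some_basis M \<Longrightarrow> b \<in> M"
proof -
  have "finite (some_basis M) \<and> independent (some_basis M) \<and> span (some_basis M) = M"
    unfolding some_basis_def by (rule someI_ex) (use assms in \<open>auto simp: fin_span_def\<close>)
  then show "finite (some_basis M)" "independent (some_basis M)" "span (some_basis M) = M"
    "\<And>b. b \<in> some_basis M \<Longrightarrow> b \<in> M"
    using span_base by blast+
qed

lemma fin_span_subspace: "fin_span M \<Longrightarrow> subspace M"
  by (auto simp: fin_span_def)

lemma trace_on_basis:
  assumes B: "finite B" "independent B" "span B = M"
    and f: "lin f" "\<And>x. x \<in> M \<Longrightarrow> f x \<in> M"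
  shows "trace_on M f = basis_trace B f"
proof -
  have M: "fin_span M" using B by (auto simp: fin_span_def)
  show ?thesis unfolding trace_on_def
    by (rule basis_trace_basis_indep) (use B f some_basis[OF M] in simp_all)
qed

lemma fin_span_sub:
  assumes "subspace M" "M \<subseteq> span T" "finite T"
  shows "fin_span M"
proof -
  obtain B where B: "B \<subseteq> M" "independent B" "M \<subseteq> span B"
    using maximal_independent_subset[of M] by blast
  have "finite B" using independent_span_bound[of T B] B assms by auto
  moreover have "span B = M" using B assms span_subspace by blast
  ultimately show ?thesis using B by (auto simp: fin_span_def)
qed

lemma fin_span_subset:
  assumes "subspace M'" "M' \<subseteq> M" "fin_span M"
  shows "fin_span M'"
  using assms fin_span_sub unfolding fin_span_def by blast

lemma trace_on_cong:
  assumes "fin_span M" "\<And>x. x \<in> M \<Longrightarrow> f x = g x"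
  shows "trace_on M f = trace_on M g"
  unfolding trace_on_def basis_trace_def using assms(2) some_basis(4)[OF assms(1)]
  by (intro sum.cong refl) simp

lemma trace_on_comm:
  assumes "fin_span M" "lin f" "\<And>x. x \<in> M \<Longrightarrow> f x \<in> M" "lin g" "\<And>x. x \<in> M \<Longrightarrow> g x \<in> M"
  shows "trace_on M (f \<circ> g) = trace_on M (g \<circ> f)"
proof -
  obtain B where B: "finite B" "independent B" "span B = M" using assms by (auto simp: fin_span_def)
  have "trace_on M (f \<circ> g) = basis_trace B (f \<circ> g)"
    by (rule trace_on_basis) (use B assms in \<open>auto intro: lin_comp\<close>)
  also have "\<dots> = basis_trace B (g \<circ> f)" by (rule basis_trace_comm) (use B assms in auto)
  also have "\<dots> = trace_on M (g \<circ> f)"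
    by (rule trace_on_basis[symmetric]) (use B assms in \<open>auto intro: lin_comp\<close>)
  finally show ?thesis .
qed

lemma trace_on_lincomb:
  assumes M: "fin_span M" and f: "\<And>i. i \<in> I \<Longrightarrow> lin (f i)"
    "\<And>i x. i \<in> I \<Longrightarrow> x \<in> M \<Longrightarrow> f i x \<in> M" and I: "finite I"
  shows "trace_on M (\<lambda>x. \<Sum>i\<in>I. c i *s f i x) = (\<Sum>i\<in>I. c i * trace_on M (f i))"
proof -
  have "trace_on M (\<lambda>x. \<Sum>i\<in>I. c i *s f i x)
      = (\<Sum>b\<in>some_basis M. \<Sum>i\<in>I. c i * representation (some_basis M) (f i b) b)"
    unfolding trace_on_def basis_trace_def
    by (intro sum.cong refl representation_sum_scale)
      (use some_basis[OF M] f I in \<open>simp_all\<close>)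
  also have "\<dots> = (\<Sum>i\<in>I. c i * trace_on M (f i))"
    by (subst sum.swap) (simp add: trace_on_def basis_trace_def sum_distrib_left)
  finally show ?thesis .
qed

lemma trace_on_add:
  assumes "fin_span M" "lin f" "\<And>x. x \<in> M \<Longrightarrow> f x \<in> M" "lin g" "\<And>x. x \<in> M \<Longrightarrow> g x \<in> M"
  shows "trace_on M (\<lambda>x. f x + g x) = trace_on M f + trace_on M g"
  using trace_on_lincomb[of M "{0,1::nat}" "\<lambda>i. if i = 0 then f else g" "\<lambda>_. 1"] assms by simp

lemma trace_on_diff:
  assumes "fin_span M" "lin f" "\<And>x. x \<in> M \<Longrightarrow> f x \<in> M" "lin g" "\<And>x. x \<in> M \<Longrightarrow> g x \<in> M"
  shows "trace_on M (\<lambda>x. f x - g x) = trace_on M f - trace_on M g"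
  using trace_on_lincomb[of M "{0,1::nat}" "\<lambda>i. if i = 0 then f else g" "\<lambda>i. if i = 0 then 1 else - 1"] assms
  by simp

lemma trace_on_scale:
  assumes "fin_span M" "lin f" "\<And>x. x \<in> M \<Longrightarrow> f x \<in> M"
  shows "trace_on M (\<lambda>x. c *s f x) = c * trace_on M f"
  using trace_on_lincomb[of M "{0::nat}" "\<lambda>i. f" "\<lambda>_. c"] assms by simp

text \<open>In a basis of \<open>M\<close> that extends one of \<open>M'\<close>, the added vectors
  have zero diagonal entry, because all values of \<open>f\<close> lie in \<open>M'\<close>.\<close>

lemma trace_on_sub:
  assumes M: "fin_span M" and M': "subspace M'" "M' \<subseteq> M"
    and f: "lin f" "\<And>x. x \<in> M \<Longrightarrow> f x \<in> M'"
  shows "trace_on M f = trace_on M' f"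
proof -
  obtain B' where B': "finite B'" "independent B'" "span B' = M'"
    using fin_span_subset[OF M' M] by (auto simp: fin_span_def)
  obtain B where B: "B' \<subseteq> B" "B \<subseteq> M" "independent B" "M \<subseteq> span B"
    using maximal_independent_subset_extend[of B' M] B' M' span_superset by (metis subset_trans)
  have sB: "span B = M" using B M span_subspace fin_span_subspace by blast
  have fB: "finite B"
  proof -
    obtain C where "finite C" "span C = M" using M by (auto simp: fin_span_def)
    then show ?thesis using independent_span_bound[of C B] B by auto
  qed
  have rep: "representation B (f b) = representation B' (f b)" if "b \<in> B" for b
  proof (rule representation_extend)
    show "f b \<in> span B'" using f(2)[of b] B that B'(3) by blast
  qed (use B in auto)
  have "trace_on M f = (\<Sum>b\<in>B. representation B' (f b) b)"
    using trace_on_basis[OF fB B(3) sB f(1)] f M' rep by (auto simp: basis_trace_def)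
  also have "\<dots> = (\<Sum>b\<in>B'. representation B' (f b) b)"
    by (rule sum.mono_neutral_right) (use fB B representation_ne_zero in blast)+
  also have "\<dots> = trace_on M' f"
    unfolding basis_trace_def[symmetric] by (rule trace_on_basis[OF B' f(1), symmetric]) (use f M' in auto)
  finally show ?thesis .
qed

lemma trace_on_id:
  assumes "finite B" "independent B" "span B = M"
  shows "trace_on M (\<lambda>x. x) = of_nat (card B)"
  using trace_on_basis[OF assms lin_id] assms by (simp add: basis_trace_def representation_basis)

lemma lin_subspace_image:
  assumes f: "lin f" and M: "subspace M"
  shows "subspace (f ` M)"
proof (rule subspaceI)
  show "0 \<in> f ` M" using lin_0[OF f] subspace_0[OF M] by (metis imageI)
next
  fix x y assume "x \<in> f ` M" "y \<in> f ` M"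
  then obtain u v where "x = f u" "y = f v" "u \<in> M" "v \<in> M" by blast
  then show "x + y \<in> f ` M" using lin_add[OF f, of u v] subspace_add[OF M] by (metis imageI)
next
  fix c x assume "x \<in> f ` M"
  then obtain u where "x = f u" "u \<in> M" by blast
  then show "c *s x \<in> f ` M" using lin_scale[OF f, of c u] subspace_scale[OF M] by (metis imageI)
qed

text \<open>By \<open>trace_on_sub\<close> the trace is the same on all the iterated images of
  \<open>M\<close>, and these shrink to 0.\<close>

lemma trace_on_nilpotent:
  assumes M: "fin_span M" and f: "lin f" "\<And>x. x \<in> M \<Longrightarrow> f x \<in> M"
    and nil: "\<And>x. x \<in> M \<Longrightarrow> (f ^^ n) x = 0"
  shows "trace_on M f = 0"
proof -
  have *: "subspace ((f ^^ k) ` M) \<and> (f ^^ k) ` M \<subseteq> M \<and> trace_on M f = trace_on ((f ^^ k) ` M) f" for k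
  proof (induction k)
    case 0
    then show ?case using fin_span_subspace[OF M] by simp
  next
    case (Suc k)
    have s: "subspace ((f ^^ Suc k) ` M)"
      by (rule lin_subspace_image) (use M f in \<open>auto intro: lin_funpow fin_span_subspace simp del: funpow.simps\<close>)
    have sub: "(f ^^ Suc k) ` M \<subseteq> (f ^^ k) ` M"
      by (auto simp: funpow_Suc_right f simp del: funpow.simps)
    have "trace_on ((f ^^ k) ` M) f = trace_on ((f ^^ Suc k) ` M) f"
      by (rule trace_on_sub[OF fin_span_subset[OF _ _ M] s sub f(1)]) (use Suc in auto)
    then show ?case using Suc s sub by (metis subset_trans)
  qed
  have "(f ^^ n) ` M = {0}" using nil subspace_0[OF fin_span_subspace[OF M]] by force
  then have "trace_on M f = trace_on {0} f" using *[of n] by metis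
  also have "\<dots> = basis_trace {} f" by (rule trace_on_basis[OF _ independent_empty]) (use f in \<open>auto simp: lin_0\<close>)
  finally show ?thesis by (simp add: basis_trace_def)
qed

end

section \<open>Polynomials of operators\<close>

text \<open>An explicit Bezout relation survives composition with a polynomial and the passage to
  the algebraic closure; both are used below.\<close>

definition comaximal :: "'a::comm_ring_1 \<Rightarrow> 'a \<Rightarrow> bool" where
  "comaximal p q \<longleftrightarrow> (\<exists>r s. r * p + s * q = 1)"

lemma comaximal_commute: "comaximal p q \<Longrightarrow> comaximal q p"
  unfolding comaximal_def by (metis add.commute)

lemma comaximal_mult_right:
  assumes "comaximal p q" "comaximal p q'"
  shows "comaximal p (q * q')"
proof -
  obtain r s r' s' where 1: "r * p + s * q = 1" and 2: "r' * p + s' * q' = 1"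
    using assms unfolding comaximal_def by blast
  have "(r * p + s * q) * (r' * p + s' * q')
      = (r * (r' * p + s' * q') + s * q * r') * p + (s * s') * (q * q')"
    by (simp add: algebra_simps)
  then show ?thesis unfolding comaximal_def using 1 2 by (metis mult_1)
qed

lemma comaximal_1_right: "comaximal p 1"
  unfolding comaximal_def by (rule exI[of _ 0], rule exI[of _ 1]) simp

lemma comaximal_power_right: "comaximal p q \<Longrightarrow> comaximal p (q ^ n)"
  by (induction n) (simp_all add: comaximal_1_right comaximal_mult_right)

lemma comaximal_power: "comaximal p q \<Longrightarrow> comaximal (p ^ m) (q ^ n)"
  by (meson comaximal_commute comaximal_power_right)

lemma comaximal_prod_right: "(\<And>i. i \<in> I \<Longrightarrow> comaximal p (q i)) \<Longrightarrow> comaximal p (\<Prod>i\<in>I. q i)"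
  by (induction I rule: infinite_finite_induct) (simp_all add: comaximal_1_right comaximal_mult_right)

lemma comaximal_mult_dvd:
  assumes "comaximal p q" "p dvd f" "q dvd f"
  shows "p * q dvd f"
proof -
  obtain r s where 1: "r * p + s * q = 1" using assms unfolding comaximal_def by blast
  obtain u where "f = p * u" using assms(2) by (elim dvdE)
  moreover obtain v where "f = q * v" using assms(3) by (elim dvdE)
  ultimately have "f = r * p * (q * v) + s * q * (p * u)"
    using 1 by (metis mult_1 distrib_right)
  also have "\<dots> = p * q * (r * v + s * u)" by (simp add: algebra_simps)
  finally show ?thesis by (rule dvdI)
qed

lemma prod_dvd_of_comaximal:
  assumes "finite I" "\<And>i j. i \<in> I \<Longrightarrow> j \<in> I \<Longrightarrow> i \<noteq> j \<Longrightarrow> comaximal (q i) (q j)" "\<And>i. i \<in> I \<Longrightarrow> q i dvd f"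
  shows "(\<Prod>i\<in>I. q i) dvd f"
  using assms
proof (induction I rule: finite_induct)
  case (insert a I)
  have "comaximal (q a) (\<Prod>i\<in>I. q i)" by (rule comaximal_prod_right) (use insert in auto)
  then show ?case using insert by (simp add: comaximal_mult_dvd)
qed simp

lemma comaximal_linear:
  fixes a b :: "'a::field"
  assumes "a \<noteq> b"
  shows "comaximal [:- a, 1:] [:- b, 1:]"
proof -
  have "[:1 / (b - a):] * [:- a, 1:] + [:- 1 / (b - a):] * [:- b, 1:] = 1"
    using assms by (simp add: one_pCons diff_divide_distrib[symmetric])
  then show ?thesis unfolding comaximal_def by blast
qed

text \<open>Evaluated at an operator, such a \<open>g\<close> acts as the scalar \<open>c a\<close>
  on vectors killed by the \<open>n\<close>-th power of the operator minus \<open>a\<close>.\<close>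

lemma poly_crt:
  fixes c :: "'a::field \<Rightarrow> 'a"
  assumes "finite A"
  shows "\<exists>g. \<forall>a\<in>A. [:- a, 1:] ^ n dvd g - [:c a:]"
  using assms
proof (induction A rule: finite_induct)
  case (insert b A)
  then obtain g where g: "\<And>a. a \<in> A \<Longrightarrow> [:- a, 1:] ^ n dvd g - [:c a:]" by blast
  let ?m = "\<Prod>a\<in>A. [:- a, 1:] ^ n"
  have "comaximal ([:- b, 1:] ^ n) ?m"
    by (rule comaximal_prod_right) (use insert in \<open>auto intro!: comaximal_power comaximal_linear\<close>)
  then obtain r s where rs: "r * [:- b, 1:] ^ n + s * ?m = 1" unfolding comaximal_def by blast
  \<comment> \<open>The correction vanishes modulo the old powers, whose product is
    \<open>?m\<close>, while \<open>s * ?m\<close> is 1 modulo the new power.\<close>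
  define g' where "g' = g + s * ?m * ([:c b:] - g)"
  have "g' - [:c b:] = (g - [:c b:]) * (1 - s * ?m)" by (simp add: g'_def algebra_simps)
  also have "1 - s * ?m = r * [:- b, 1:] ^ n" using rs by (simp add: algebra_simps)
  finally have "[:- b, 1:] ^ n dvd g' - [:c b:]" by (metis dvd_triv_right mult.assoc)
  moreover have "[:- a, 1:] ^ n dvd g' - [:c a:]" if "a \<in> A" for a
  proof -
    have "[:- a, 1:] ^ n dvd ?m" using insert(1) that by (rule dvd_prodI)
    then have "[:- a, 1:] ^ n dvd s * ?m * ([:c b:] - g)" by simp
    then have "[:- a, 1:] ^ n dvd (g - [:c a:]) + s * ?m * ([:c b:] - g)"
      using g[OF that] by (rule dvd_add[rotated])
    then show ?thesis by (simp add: g'_def algebra_simps)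
  qed
  ultimately show ?case by blast
qed simp

section \<open>Separability and Newton iteration\<close>

lemma poly_ideal_principal:
  fixes I :: "'a::field poly set"
  assumes "f0 \<in> I" "f0 \<noteq> 0" "\<And>f g. f \<in> I \<Longrightarrow> g \<in> I \<Longrightarrow> f + g \<in> I" "\<And>f g. f \<in> I \<Longrightarrow> g * f \<in> I"
  obtains d where "d \<in> I" "d \<noteq> 0" "\<And>f. f \<in> I \<Longrightarrow> d dvd f"
proof -
  obtain d where d: "d \<in> I" "d \<noteq> 0" and min: "\<And>f. f \<in> I \<Longrightarrow> f \<noteq> 0 \<Longrightarrow> degree d \<le> degree f"
    using ex_has_least_nat[of "\<lambda>d. d \<in> I \<and> d \<noteq> 0" f0 degree] assms(1,2) by blast
  have "d dvd f" if "f \<in> I" for f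
  proof -
    have "f mod d = f + (- (f div d)) * d"
      by (metis add.commute minus_mult_left add_uminus_conv_diff minus_div_mult_eq_mod)
    then have "f mod d \<in> I" using assms(3,4) that d(1) by metis
    then have "f mod d = 0" using min degree_mod_less[OF d(2), of f] by force
    then show ?thesis by (simp add: mod_eq_0_iff_dvd)
  qed
  then show ?thesis using d that by blast
qed

text \<open>Differentiate the previous multiple of \<open>d\<close> and multiply by
  \<open>c\<close>. With as many derivatives as the degree of \<open>d\<close>, the first factor
  becomes a constant and \<open>d\<close> divides a power of \<open>c\<close>.\<close>

lemma dvd_higher_pderiv_mult:
  fixes d c g :: "'a::field poly"
  assumes "d dvd pderiv d * c"
  shows "d dvd (pderiv ^^ j) d * c ^ j"
proof (induction j)
  case (Suc j)
  then obtain h where h: "(pderiv ^^ j) d * c ^ j = d * h" by (auto elim: dvdE)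
  have "pderiv ((pderiv ^^ j) d * c ^ j) * c
      = (pderiv ^^ Suc j) d * c ^ Suc j + (pderiv ^^ j) d * (pderiv (c ^ j) * c)"
    by (simp add: pderiv_mult algebra_simps)
  also have "pderiv (c ^ j) * c = smult (of_nat j) (c ^ j * pderiv c)"
  proof (cases j)
    case (Suc m)
    show ?thesis unfolding Suc pderiv_power_Suc by (simp add: mult_ac)
  qed simp
  finally have "(pderiv ^^ Suc j) d * c ^ Suc j
      = pderiv (d * h) * c - smult (of_nat j) (((pderiv ^^ j) d * c ^ j) * pderiv c)"
    unfolding h[symmetric] by (simp add: algebra_simps)
  also have "\<dots> = d * (pderiv h * c) + (pderiv d * c) * h - d * smult (of_nat j) (h * pderiv c)"
    unfolding h by (simp add: pderiv_mult algebra_simps)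
  finally have eq: "(pderiv ^^ Suc j) d * c ^ Suc j = \<dots>" .
  show ?case unfolding eq
    by (intro dvd_diff dvd_add dvd_triv_left dvd_mult2[OF assms])
qed simp

text \<open>The minimality condition is a form of squarefreeness that can be read off from an
  operator. If \<open>d\<close> generates the ideal of \<open>p\<close> and its derivative and
  \<open>p = d * c\<close>, then \<open>d\<close> divides a power of \<open>c\<close>, so
  \<open>p\<close> divides a power of \<open>c\<close>; minimality then makes \<open>d\<close>
  constant.\<close>

lemma comaximal_pderiv:
  fixes p :: "'a::field_char_0 poly"
  assumes "p \<noteq> 0" and min: "\<And>c n. c \<noteq> 0 \<Longrightarrow> p dvd c ^ n \<Longrightarrow> degree p \<le> degree c"
  shows "comaximal p (pderiv p)"
proof -
  let ?I = "{r * p + s * pderiv p | r s. True}"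
  obtain d where d: "d \<in> ?I" "d \<noteq> 0" "\<And>f. f \<in> ?I \<Longrightarrow> d dvd f"
  proof (rule poly_ideal_principal[of p ?I])
    show "p \<in> ?I" by (intro CollectI exI[of _ 1] exI[of _ 0]) simp
    show "f + g \<in> ?I" if fg: "f \<in> ?I" "g \<in> ?I" for f g
    proof -
      obtain r s r' s' where "f = r * p + s * pderiv p" "g = r' * p + s' * pderiv p" using fg by blast
      then have "f + g = (r + r') * p + (s + s') * pderiv p" by (simp add: algebra_simps)
      then show ?thesis by blast
    qed
    show "g * f \<in> ?I" if f: "f \<in> ?I" for f g
    proof -
      obtain r s where "f = r * p + s * pderiv p" using f by blast
      then have "g * f = (g * r) * p + (g * s) * pderiv p" by (simp add: algebra_simps)
      then show ?thesis by blast
    qed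
  qed (use assms in auto)
  have "d dvd p" by (rule d(3)) (intro CollectI exI[of _ 1] exI[of _ 0], simp)
  then obtain c where c: "p = d * c" by (auto elim: dvdE)
  have "d dvd pderiv p" by (rule d(3)) (intro CollectI exI[of _ 0] exI[of _ 1], simp)
  then have "d dvd pderiv d * c"
    unfolding c pderiv_mult by (metis dvd_add_right_iff dvd_triv_left mult.commute)
  from dvd_higher_pderiv_mult[OF this, of "degree d"]
  have *: "d dvd (pderiv ^^ degree d) d * c ^ degree d" .
  have "degree ((pderiv ^^ degree d) d) = 0" by (simp add: degree_higher_pderiv)
  then obtain k where k: "(pderiv ^^ degree d) d = [:k:]" by (rule degree_eq_zeroE)
  \<comment> \<open>The top derivative of \<open>d\<close> is a factorial times the leading
    coefficient, nonzero in characteristic 0.\<close>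
  have "pochhammer (1::'a) (degree d) \<noteq> 0"
    by (simp add: pochhammer_fact[symmetric])
  then have "coeff ((pderiv ^^ degree d) d) 0 \<noteq> 0"
    using d(2) by (simp add: coeff_higher_pderiv)
  then have k0: "k \<noteq> 0" unfolding k by simp
  have "d dvd c ^ degree d" using * k k0 by (simp add: dvd_smult_iff)
  then have "p dvd c ^ Suc (degree d)" unfolding c by (simp add: mult.commute mult_dvd_mono)
  moreover have "c \<noteq> 0" using assms(1) c by auto
  ultimately have "degree p \<le> degree c" using min by blast
  then have "degree d = 0" using c d(2) \<open>c \<noteq> 0\<close> by (simp add: degree_mult_eq)
  then obtain e where e: "d = [:e:]" "e \<noteq> 0" using d(2) by (metis degree_eq_zeroE pCons_0_0)
  obtain r s where "d = r * p + s * pderiv p" using d(1) by blast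
  then have "smult (1 / e) r * p + smult (1 / e) s * pderiv p = smult (1 / e) d"
    by (simp add: smult_add_right)
  also have "\<dots> = 1" using e by (simp add: one_pCons)
  finally show ?thesis unfolding comaximal_def by blast
qed

lemma pcompose_taylor:
  fixes p q h :: "'a::idom poly"
  shows "\<exists>t. pcompose p (q + h) = pcompose p q + h * pcompose (pderiv p) q + h\<^sup>2 * t"
proof (induction p)
  case (pCons a p)
  then obtain t where t: "pcompose p (q + h) = pcompose p q + h * pcompose (pderiv p) q + h\<^sup>2 * t" by blast
  have "pcompose (pCons a p) (q + h) = pcompose (pCons a p) q + h * pcompose (pderiv (pCons a p)) q
      + h\<^sup>2 * (pcompose (pderiv p) q + (q + h) * t)"
    by (simp add: pcompose_pCons t pderiv_pCons pcompose_add)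
      (simp add: algebra_simps power2_eq_square)
  then show ?case by blast
qed auto

text \<open>Newton's method for the root X of \<open>p\<close> modulo \<open>p\<close>, with
  quadratic convergence. It produces the polynomial for the semisimple part of an operator over the
  base field itself.\<close>

lemma newton_iteration:
  fixes p :: "'a::field poly"
  assumes "comaximal p (pderiv p)"
  shows "\<exists>q. p dvd q - [:0, 1:] \<and> p ^ (2 ^ k) dvd pcompose p q"
proof (induction k)
  case 0
  show ?case by (rule exI[of _ "[:0, 1:]"]) simp
next
  case (Suc k)
  then obtain q where q: "p dvd q - [:0, 1:]" "p ^ (2 ^ k) dvd pcompose p q" by blast
  obtain r s where rs: "r * p + s * pderiv p = 1" using assms unfolding comaximal_def by blast
  let ?u = "pcompose p q"
  \<comment> \<open>The Newton step: modulo \<open>p\<close>, the Bezout coefficient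
    \<open>s\<close> inverts the derivative of \<open>p\<close>.\<close>
  define h where "h = - (?u * pcompose s q)"
  obtain t where t: "pcompose p (q + h) = ?u + h * pcompose (pderiv p) q + h\<^sup>2 * t"
    using pcompose_taylor by blast
  have "pcompose (r * p + s * pderiv p) q = 1" unfolding rs by (simp add: one_pCons pcompose_const)
  then have "1 - pcompose s q * pcompose (pderiv p) q = pcompose r q * ?u"
    by (simp add: pcompose_add pcompose_mult algebra_simps)
  moreover have "?u + h * pcompose (pderiv p) q = ?u * (1 - pcompose s q * pcompose (pderiv p) q)"
    by (simp add: h_def algebra_simps)
  ultimately have "pcompose p (q + h) = ?u\<^sup>2 * (pcompose r q + (pcompose s q)\<^sup>2 * t)"
    unfolding t by (simp add: h_def power2_eq_square) (simp add: algebra_simps)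
  moreover have "p ^ (2 ^ Suc k) dvd ?u\<^sup>2"
    using dvd_power_same[OF q(2), of 2] by (simp add: power_mult[symmetric] mult.commute)
  ultimately have 1: "p ^ (2 ^ Suc k) dvd pcompose p (q + h)" by simp
  have "p dvd ?u" using q(2) dvd_power[of "2 ^ k" p] by (metis dvd_trans zero_less_numeral zero_less_power)
  then have "p dvd (q - [:0, 1:]) + h" using q(1) by (auto simp: h_def intro!: dvd_add)
  then have "p dvd (q + h) - [:0, 1:]" by (simp add: algebra_simps)
  then show ?case using 1 by blast
qed

section \<open>Evaluating polynomials at operators\<close>

context lin_space
begin

text \<open>A Horner scheme applied to a vector, so that identities of polynomials can be used at
  single vectors even where the operator is not annihilated globally.\<close>

definition opoly :: "'a poly \<Rightarrow> ('b \<Rightarrow> 'b) \<Rightarrow> 'b \<Rightarrow> 'b" where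
  "opoly p f v = fold_coeffs (\<lambda>a w. a *s v + f w) p 0"

lemma opoly_0 [simp]: "opoly 0 f v = 0"
  by (simp add: opoly_def)

lemma opoly_pCons: "lin f \<Longrightarrow> opoly (pCons a p) f v = a *s v + f (opoly p f v)"
  by (cases "p = 0 \<and> a = 0") (auto simp: opoly_def lin_0)

lemma opoly_lin: "lin f \<Longrightarrow> lin (opoly p f)"
proof (induction p)
  case 0
  show ?case by (rule linI) simp_all
next
  case (pCons a p)
  show ?case
    by (rule linI) (simp_all add: pCons opoly_pCons lin_add lin_scale scale_right_distrib scale_left_commute)
qed

lemma opoly_add: "lin f \<Longrightarrow> opoly (p + q) f v = opoly p f v + opoly q f v"
proof (induction p arbitrary: q)
  case (pCons a p)
  then show ?case
    by (cases q) (simp add: opoly_pCons lin_add scale_left_distrib)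
qed simp

lemma opoly_smult: "lin f \<Longrightarrow> opoly (smult c p) f v = c *s opoly p f v"
  by (induction p) (simp_all add: opoly_pCons lin_scale scale_right_distrib)

lemma opoly_minus: "lin f \<Longrightarrow> opoly (- p) f v = - opoly p f v"
  using opoly_smult[of f "- 1" p v] by simp

lemma opoly_diff: "lin f \<Longrightarrow> opoly (p - q) f v = opoly p f v - opoly q f v"
  using opoly_add[of f p "- q" v] by (simp add: opoly_minus)

lemma opoly_mult: "lin f \<Longrightarrow> opoly (p * q) f v = opoly p f (opoly q f v)"
proof (induction p)
  case (pCons a p)
  then show ?case by (simp add: opoly_pCons opoly_add opoly_smult)
qed simp

lemma opoly_const: "lin f \<Longrightarrow> opoly [:c:] f v = c *s v"
  by (simp add: opoly_pCons lin_0)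

lemma opoly_1: "lin f \<Longrightarrow> opoly 1 f v = v"
  by (simp add: one_pCons opoly_const)

lemma opoly_X: "lin f \<Longrightarrow> opoly [:0, 1:] f v = f v"
  by (simp add: opoly_pCons lin_0)

lemma opoly_power: "lin f \<Longrightarrow> opoly (p ^ n) f v = (opoly p f ^^ n) v"
  by (induction n) (simp_all add: opoly_1 opoly_mult)

lemma opoly_sum: "lin f \<Longrightarrow> opoly (\<Sum>i\<in>I. p i) f v = (\<Sum>i\<in>I. opoly (p i) f v)"
  by (induction I rule: infinite_finite_induct) (simp_all add: opoly_add)

lemma opoly_monom: "lin f \<Longrightarrow> opoly (monom c n) f v = c *s (f ^^ n) v"
  by (induction n) (simp_all add: monom_0 monom_Suc opoly_const opoly_pCons lin_scale lin_0)

lemma opoly_altdef: "lin f \<Longrightarrow> opoly p f v = (\<Sum>i\<le>degree p. coeff p i *s (f ^^ i) v)"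
  by (subst (1) poly_as_sum_of_monoms[of p, symmetric]) (simp add: opoly_sum opoly_monom)

lemma opoly_pcompose: "lin f \<Longrightarrow> opoly (pcompose p q) f v = opoly p (opoly q f) v"
  by (induction p)
    (simp_all add: opoly_pCons opoly_lin pcompose_pCons opoly_add opoly_mult opoly_const lin_0)

lemma opoly_dvd_0: "lin f \<Longrightarrow> p dvd q \<Longrightarrow> opoly p f v = 0 \<Longrightarrow> opoly q f v = 0"
  by (auto elim!: dvdE simp: mult.commute[of p] opoly_mult lin_0[OF opoly_lin])

lemma opoly_commute:
  "lin f \<Longrightarrow> lin g \<Longrightarrow> (\<And>x. g (f x) = f (g x)) \<Longrightarrow> g (opoly p f v) = opoly p f (g v)"
  by (induction p) (simp_all add: opoly_pCons lin_0 lin_add lin_scale)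

lemma opoly_mem:
  assumes "lin f" "subspace M" "\<And>x. x \<in> M \<Longrightarrow> f x \<in> M" "v \<in> M"
  shows "opoly p f v \<in> M"
  by (induction p) (use assms in \<open>simp_all add: opoly_pCons subspace_0 subspace_add subspace_scale\<close>)

lemma lin_add_fun: "lin f \<Longrightarrow> lin g \<Longrightarrow> lin (\<lambda>x. f x + g x)"
  by (rule linI) (simp_all add: lin_add lin_scale scale_right_distrib)

lemma lin_diff_fun: "lin f \<Longrightarrow> lin g \<Longrightarrow> lin (\<lambda>x. f x - g x)"
  by (rule linI) (simp_all add: lin_add lin_scale scale_right_diff_distrib)

lemma lin_scale_fun: "lin f \<Longrightarrow> lin (\<lambda>x. c *s f x)"
  by (rule linI) (simp_all add: lin_add lin_scale scale_right_distrib scale_left_commute)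

lemma lin_image_span: "lin f \<Longrightarrow> span (f ` S) = f ` span S"
  using module_hom.span_image linear_iff_module_hom by blast

lemma lin_independent_image:
  "lin f \<Longrightarrow> independent S \<Longrightarrow> inj_on f (span S) \<Longrightarrow> independent (f ` S)"
  using module_hom.independent_injective_image linear_iff_module_hom by blast

section \<open>Dimension counts, annihilating polynomials and Fitting's lemma\<close>

lemma independent_Un:
  assumes A: "finite A" "independent A" and B: "finite B" "independent B"
    and AB: "span A \<inter> span B \<subseteq> {0}"
  shows "independent (A \<union> B)" "A \<inter> B = {}"
proof -
  show disj: "A \<inter> B = {}"
  proof (rule ccontr)
    assume "A \<inter> B \<noteq> {}"
    then obtain x where x: "x \<in> A" "x \<in> B" by blast
    then have "x = 0" using AB span_base by blast
    then show False using x(1) A(2) dependent_zero by blast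
  qed
  show "independent (A \<union> B)"
  proof (rule independent_if_scalars_zero)
    fix f x assume s: "(\<Sum>x\<in>A \<union> B. f x *s x) = 0" and x: "x \<in> A \<union> B"
    have sum: "(\<Sum>x\<in>A. f x *s x) = - (\<Sum>x\<in>B. f x *s x)"
      using s by (simp add: sum.union_disjoint A B disj eq_neg_iff_add_eq_0)
    have "(\<Sum>x\<in>A. f x *s x) \<in> span A" "- (\<Sum>x\<in>B. f x *s x) \<in> span B"
      by (auto intro!: span_sum span_scale span_neg intro: span_base)
    then have "(\<Sum>x\<in>A. f x *s x) = 0" "(\<Sum>x\<in>B. f x *s x) = 0" using sum AB by auto
    then show "f x = 0"
      using x independentD[OF A(2) A(1) order_refl] independentD[OF B(2) B(1) order_refl] by blast
  qed (use A B in simp)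
qed

lemma independent_of_card:
  assumes S: "finite S" and T: "independent T" "T \<subseteq> span S" "card S \<le> card T"
  shows "independent S" "card S = card T"
proof -
  show "card S = card T" using independent_span_bound[OF S T(1,2)] T(3) by simp
  show "independent S"
  proof
    assume "dependent S"
    then obtain a where a: "a \<in> S" "a \<in> span (S - {a})" unfolding dependent_def by blast
    then have "span S = span (S - {a})" using span_redundant[of a "S - {a}"] insert_Diff by metis
    then have "card T \<le> card (S - {a})" using independent_span_bound[of "S - {a}" T] S T by auto
    then show False using a S T(3) by (metis card_Diff1_less leD le_trans)
  qed
qed

text \<open>In the basis \<open>A \<union> B\<close> the matrix has zero diagonal, since neither
  half has a component in itself.\<close>

lemma trace_on_swap:
  assumes A: "finite A" and B: "finite B" and ind: "independent (A \<union> B)" and disj: "A \<inter> B = {}"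
    and f: "lin f" "\<And>x. x \<in> A \<Longrightarrow> f x \<in> span B" "\<And>x. x \<in> B \<Longrightarrow> f x \<in> span A"
  shows "trace_on (span (A \<union> B)) f = 0"
proof -
  have fin: "finite (A \<union> B)" using A B by simp
  have mono: "span A \<subseteq> span (A \<union> B)" "span B \<subseteq> span (A \<union> B)" by (intro span_mono; blast)+
  have "f x \<in> span (A \<union> B)" if "x \<in> span (A \<union> B)" for x
    by (rule lin_span_image[OF f(1) _ subspace_span that]) (use f mono in blast)
  then have "trace_on (span (A \<union> B)) f = basis_trace (A \<union> B) f"
    by (rule trace_on_basis[OF fin ind refl f(1)])
  also have "\<dots> = 0" unfolding basis_trace_def
  proof (rule sum.neutral, rule ballI)
    fix b assume "b \<in> A \<union> B"
    then consider "b \<in> A" "b \<notin> B" | "b \<in> B" "b \<notin> A" using disj by blast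
    then show "representation (A \<union> B) (f b) b = 0"
    proof cases
      case 1
      have "representation (A \<union> B) (f b) = representation B (f b)"
        by (rule representation_extend[OF ind f(2)[OF 1(1)]]) simp
      then show ?thesis using representation_ne_zero[of B "f b" b] 1 by metis
    next
      case 2
      have "representation (A \<union> B) (f b) = representation A (f b)"
        by (rule representation_extend[OF ind f(3)[OF 2(1)]]) simp
      then show ?thesis using representation_ne_zero[of A "f b" b] 2 by metis
    qed
  qed
  finally show ?thesis .
qed

text \<open>More iterates of \<open>v\<close> than the dimension are dependent. Dependence concerns
  the set of iterates, so a repeated iterate is treated apart, with a difference of two
  monomials.\<close>

lemma vector_annihilator:
  assumes M: "fin_span M" and f: "lin f" "\<And>x. x \<in> M \<Longrightarrow> f x \<in> M" and v: "v \<in> M"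
  shows "\<exists>p. p \<noteq> 0 \<and> opoly p f v = 0"
proof (cases "inj (\<lambda>i. (f ^^ i) v)")
  case False
  then obtain i j where ij: "i \<noteq> j" "(f ^^ i) v = (f ^^ j) v" by (auto simp: inj_def)
  let ?p = "monom 1 i - monom 1 j :: 'a poly"
  have "coeff ?p i = 1" using ij by (simp add: coeff_monom)
  then have "?p \<noteq> 0" by (metis coeff_0 zero_neq_one)
  moreover have "opoly ?p f v = 0" using ij f by (simp add: opoly_diff opoly_monom)
  ultimately show ?thesis by blast
next
  case True
  obtain B where B: "finite B" "span B = M" using M by (auto simp: fin_span_def)
  let ?g = "\<lambda>i. (f ^^ i) v"
  let ?S = "?g ` {..card B}"
  have inj: "inj_on ?g {..card B}" using True by (rule inj_on_subset) simp
  then have "card ?S = Suc (card B)" by (simp add: card_image)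
  moreover have "?S \<subseteq> span B" using funpow_image[of M f v] f v B by auto
  ultimately have "dependent ?S" using independent_span_bound[OF B(1), of ?S] by auto
  then obtain u where u: "\<exists>w\<in>?S. u w \<noteq> 0" "(\<Sum>w\<in>?S. u w *s w) = 0"
    using dependent_finite[of ?S] by auto
  let ?p = "\<Sum>i\<le>card B. monom (u (?g i)) i"
  obtain i where i: "i \<le> card B" "u (?g i) \<noteq> 0" using u by auto
  have "coeff ?p i = u (?g i)" using i by (simp add: coeff_sum coeff_monom if_distrib cong: if_cong)
  then have "?p \<noteq> 0" using i by (metis coeff_0)
  moreover have "opoly ?p f v = (\<Sum>i\<le>card B. u (?g i) *s ?g i)"
    using f by (simp add: opoly_sum opoly_monom)
  then have "opoly ?p f v = 0" using u(2) sum.reindex[OF inj, of "\<lambda>w. u w *s w"] by simp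
  ultimately show ?thesis by blast
qed

lemma annihilator:
  assumes M: "fin_span M" and f: "lin f" "\<And>x. x \<in> M \<Longrightarrow> f x \<in> M"
  shows "\<exists>p. p \<noteq> 0 \<and> (\<forall>x\<in>M. opoly p f x = 0)"
proof -
  obtain B where B: "finite B" "span B = M" using M by (auto simp: fin_span_def)
  have "\<forall>b\<in>B. \<exists>p. p \<noteq> 0 \<and> opoly p f b = 0"
    using vector_annihilator[OF M f] B span_base by blast
  then obtain p where p: "\<And>b. b \<in> B \<Longrightarrow> p b \<noteq> 0 \<and> opoly (p b) f b = 0" by metis
  let ?p = "\<Prod>b\<in>B. p b"
  have "opoly ?p f x = 0" if "x \<in> M" for x
  proof -
    have "opoly ?p f b = 0" if "b \<in> B" for b
      using opoly_dvd_0[OF f(1), of "p b" ?p b] p[OF that] B(1) that by (simp add: dvd_prodI)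
    then show ?thesis
      using lin_span_image[OF opoly_lin[OF f(1)], of B ?p "{0}" x] that B by auto
  qed
  moreover have "?p \<noteq> 0" using p B by simp
  ultimately show ?thesis by blast
qed

text \<open>Write an annihilating polynomial as X^k q with q(0) nonzero. Then q vanishes on the
  \<open>k\<close>-th image, and solving q = 0 for its constant term shows that \<open>h\<close>
  evaluated at \<open>f\<close> inverts \<open>f\<close> there.\<close>

lemma fitting:
  assumes M: "fin_span M" and f: "lin f" "\<And>x. x \<in> M \<Longrightarrow> f x \<in> M"
  obtains k h where "\<And>x. x \<in> (f ^^ k) ` M \<Longrightarrow> opoly ([:0, 1:] * h) f x = x"
proof -
  obtain p where p: "p \<noteq> 0" "\<And>x. x \<in> M \<Longrightarrow> opoly p f x = 0"
    using annihilator[OF M f] by blast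
  obtain k q where q: "p = [:0, 1:] ^ k * q" "\<not> [:0, 1:] dvd q"
    using order_decomp[OF p(1), of 0] by auto
  obtain c q' where cq: "q = pCons c q'" by (cases q)
  have c: "c \<noteq> 0"
    using q(2) unfolding cq by (auto simp: dvd_def)
  define h where "h = smult (- 1 / c) q'"
  have Xh: "1 - [:0, 1:] * h = smult (1 / c) q"
    using c by (simp add: h_def cq one_pCons)
  have "opoly ([:0, 1:] * h) f x = x" if x: "x \<in> (f ^^ k) ` M" for x
  proof -
    obtain y where y: "y \<in> M" "x = (f ^^ k) y" using x by blast
    have "x = opoly ([:0, 1:] ^ k) f y"
      unfolding y opoly_power[OF f(1)] using opoly_X[OF f(1)] by (metis ext)
    then have "opoly q f x = 0"
      using p(2)[OF y(1)] unfolding q(1) by (simp add: opoly_mult[OF f(1), symmetric] mult.commute)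
    then have "opoly (1 - [:0, 1:] * h) f x = 0" unfolding Xh by (simp add: opoly_smult f)
    then show ?thesis by (simp add: opoly_diff opoly_1 f(1))
  qed
  then show ?thesis by (rule that)
qed

lemma trace_on_opoly:
  assumes M: "fin_span M" and f: "lin f" "\<And>x. x \<in> M \<Longrightarrow> f x \<in> M"
  shows "trace_on M (opoly p f) = (\<Sum>i\<le>degree p. coeff p i * trace_on M (f ^^ i))"
proof -
  have "opoly p f = (\<lambda>v. \<Sum>i\<le>degree p. coeff p i *s (f ^^ i) v)"
    using opoly_altdef[OF f(1)] by blast
  then show ?thesis
    using trace_on_lincomb[OF M, of "{..degree p}" "\<lambda>i. f ^^ i" "coeff p"] f
    by (simp add: lin_funpow funpow_image)
qed

end

section \<open>Consequences of characteristic 0\<close>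

locale lin_space_0 = lin_space scale
  for scale :: "'a::field_char_0 \<Rightarrow> 'b::ab_group_add \<Rightarrow> 'b" (infixr "*s" 75)
begin

text \<open>The projection onto the stable image of \<open>f\<close> is a polynomial in
  \<open>f\<close> without constant term. Its trace is therefore 0, yet equals the dimension of that
  image.\<close>

lemma nilpotent_of_traces:
  assumes M: "fin_span M" and f: "lin f" "\<And>x. x \<in> M \<Longrightarrow> f x \<in> M"
    and tr: "\<And>k. k \<ge> 1 \<Longrightarrow> trace_on M (f ^^ k) = 0"
  shows "\<exists>n. \<forall>x\<in>M. (f ^^ n) x = 0"
proof -
  obtain k h where fix_h: "\<And>x. x \<in> (f ^^ k) ` M \<Longrightarrow> opoly ([:0, 1:] * h) f x = x"
    using fitting[OF M f] by blast
  let ?M = "(f ^^ k) ` M"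
  have sM: "subspace ?M" by (rule lin_subspace_image) (use f M in \<open>auto intro: lin_funpow fin_span_subspace\<close>)
  have sub: "?M \<subseteq> M" using funpow_image[of M f] f by auto
  have fM: "fin_span ?M" by (rule fin_span_subset[OF sM sub M])
  \<comment> \<open>The exponent \<open>Suc k\<close> makes \<open>?r\<close> divisible by X^k, so
    that all its values lie in the \<open>k\<close>-th image; a further factor X removes the
    constant term.\<close>
  let ?r = "([:0, 1:] * h) ^ Suc k"
  have fixr: "opoly ?r f x = x" if "x \<in> ?M" for x
  proof -
    have "(opoly ([:0, 1:] * h) f ^^ n) x = x" for n
      by (induction n) (use fix_h[OF that] in simp_all)
    then show ?thesis by (simp add: opoly_power f(1) del: power_Suc funpow.simps)
  qed
  have "coeff ?r 0 = 0" by (simp add: coeff_mult)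
  then have 0: "coeff ?r i * trace_on M (f ^^ i) = 0" for i
    using tr[of i] by (cases i) simp_all
  have "trace_on M (opoly ?r f) = (\<Sum>i\<le>degree ?r. coeff ?r i * trace_on M (f ^^ i))"
    by (rule trace_on_opoly[OF M f])
  also have "\<dots> = 0" by (simp only: 0 sum.neutral_const)
  finally have "trace_on M (opoly ?r f) = 0" .
  moreover have "trace_on M (opoly ?r f) = trace_on ?M (opoly ?r f)"
  proof (rule trace_on_sub[OF M sM sub opoly_lin[OF f(1)]])
    fix x assume x: "x \<in> M"
    have "(z * h) ^ Suc k = z ^ k * (z * h ^ Suc k)" for z
      by (simp add: power_mult_distrib mult_ac)
    then have "?r = [:0, 1:] ^ k * ([:0, 1:] * h ^ Suc k)" .
    then have "opoly ?r f x = (f ^^ k) (opoly ([:0, 1:] * h ^ Suc k) f x)"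
      using f(1) opoly_X[OF f(1)] by (metis opoly_mult opoly_power ext)
    then show "opoly ?r f x \<in> ?M"
      using opoly_mem[OF f(1) fin_span_subspace[OF M] f(2) x] by blast
  qed
  moreover have "trace_on ?M (opoly ?r f) = trace_on ?M (\<lambda>x. x)"
    by (rule trace_on_cong[OF fM]) (rule fixr)
  moreover have "trace_on ?M (\<lambda>x. x) = of_nat (card (some_basis ?M))"
    by (rule trace_on_id) (use some_basis[OF fM] in auto)
  ultimately have "card (some_basis ?M) = 0" by simp
  then have "some_basis ?M = {}" using some_basis(1)[OF fM] by simp
  then have "?M = {0}" using some_basis(3)[OF fM] span_empty by metis
  then show ?thesis by blast
qed

text \<open>Take \<open>p\<close> of least degree among the nonzero polynomials with a power that
  annihilates \<open>f\<close>: it is separable, and sufficiently many Newton steps give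
  \<open>q\<close>.\<close>

lemma jordan_chevalley:
  assumes M: "fin_span UNIV" and f: "lin f"
  obtains p q n where "p \<noteq> 0" "comaximal p (pderiv p)" "\<And>x. opoly p (opoly q f) x = 0"
    "\<And>x. ((\<lambda>x. f x - opoly q f x) ^^ n) x = 0"
proof -
  let ?P = "\<lambda>g. g \<noteq> 0 \<and> (\<exists>n. \<forall>x. opoly (g ^ n) f x = 0)"
  obtain g where "g \<noteq> 0" "\<And>x. opoly g f x = 0" using annihilator[OF M f] by auto
  then have "?P g" by (intro conjI exI[of _ 1]) auto
  then obtain p where p: "?P p" and min: "\<And>c. ?P c \<Longrightarrow> degree p \<le> degree c"
    using ex_has_least_nat[of ?P g degree] by blast
  obtain n where n: "\<And>x. opoly (p ^ n) f x = 0" using p by blast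
  have comaximal: "comaximal p (pderiv p)"
  proof (rule comaximal_pderiv)
    fix c m assume c: "c \<noteq> 0" "p dvd c ^ m"
    have "p ^ n dvd c ^ (m * n)" using dvd_power_same[OF c(2), of n] by (simp add: power_mult)
    then have "opoly (c ^ (m * n)) f x = 0" for x using opoly_dvd_0[OF f] n by blast
    then show "degree p \<le> degree c" using min c by blast
  qed (use p in auto)
  obtain q where q: "p dvd q - [:0, 1:]" "p ^ (2 ^ n) dvd pcompose p q"
    using newton_iteration[OF comaximal] by blast
  have "p ^ n dvd pcompose p q"
    using q(2) le_imp_power_dvd[of n "2 ^ n" p] by (meson dvd_trans less_exp less_imp_le)
  then have 1: "opoly p (opoly q f) x = 0" for x
    using opoly_dvd_0[OF f _ n] opoly_pcompose[OF f] by metis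
  have "p dvd [:0, 1:] - q" using q(1) by (metis dvd_minus_iff minus_diff_eq)
  then have "p ^ n dvd ([:0, 1:] - q) ^ n" by (rule dvd_power_same)
  then have "opoly (([:0, 1:] - q) ^ n) f x = 0" for x using opoly_dvd_0[OF f _ n] by blast
  moreover have "opoly ([:0, 1:] - q) f = (\<lambda>x. f x - opoly q f x)"
    using f by (simp add: fun_eq_iff opoly_diff opoly_X)
  ultimately have "((\<lambda>x. f x - opoly q f x) ^^ n) x = 0" for x
    using opoly_power[OF f] by metis
  then show ?thesis using that p comaximal 1 by blast
qed

end

section \<open>Words in left multiplications\<close>

text \<open>Operators, functionals and functions of two arguments are all treated as vectors of a
  full function space with pointwise operations; the linear ones are subspaces of it.\<close>

definition scale_fun :: "('a \<Rightarrow> 'b \<Rightarrow> 'b) \<Rightarrow> 'a \<Rightarrow> ('c \<Rightarrow> 'b) \<Rightarrow> 'c \<Rightarrow> 'b" where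
  "scale_fun s c f = (\<lambda>x. s c (f x))"

lemma scale_fun_apply [simp]: "scale_fun s c f x = s c (f x)"
  by (simp add: scale_fun_def)

lemma sum_fun_apply: "(\<Sum>i\<in>I. f i) x = (\<Sum>i\<in>I. f i x)"
  by (induction I rule: infinite_finite_induct) simp_all

lemma minus_fun_apply [simp]: "(f - g) x = f x - (g x :: 'b::ab_group_add)"
  by (simp add: fun_diff_def)

lemma lin_space_scale_fun:
  assumes "lin_space_0 s"
  shows "lin_space_0 (scale_fun s :: _ \<Rightarrow> ('c \<Rightarrow> _) \<Rightarrow> _)"
proof -
  interpret lin_space_0 s by fact
  show ?thesis
    by unfold_locales
      (simp_all add: fun_eq_iff scale_right_distrib scale_left_distrib)
qed

section \<open>Unital algebras, their operators and their centre\<close>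

locale fd_algebra = lin_space_0 scale
  for scale :: "'a::field_char_0 \<Rightarrow> 'b::ab_group_add \<Rightarrow> 'b" (infixr "*s" 75) +
  fixes mult :: "'b \<Rightarrow> 'b \<Rightarrow> 'b" (infixl "\<cdot>" 70) and e :: 'b
  assumes fin_UNIV: "fin_span UNIV"
    and lin_L: "lin ((\<cdot>) x)"
    and lin_R: "lin (\<lambda>x. x \<cdot> y)"
    and unit_left [simp]: "e \<cdot> x = x"
    and unit_right [simp]: "x \<cdot> e = x"
begin

sublocale E: lin_space_0 "scale_fun scale :: 'a \<Rightarrow> ('b \<Rightarrow> 'b) \<Rightarrow> 'b \<Rightarrow> 'b"
  by (rule lin_space_scale_fun) unfold_locales

abbreviation (input) L :: "'b \<Rightarrow> 'b \<Rightarrow> 'b" where "L x \<equiv> (\<cdot>) x"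

lemma double: "x + x = 2 *s x"
  using scale_left_distrib[of 1 1 x] by simp

lemma half_mem:
  assumes "subspace S" "2 *s x \<in> S"
  shows "x \<in> S"
  using subspace_scale[OF assms(1,2), of "1/2"] by simp

lemma E_half_mem:
  assumes "E.subspace S" "scale_fun scale 2 x \<in> S"
  shows "x \<in> S"
proof -
  have "scale_fun scale (1/2) (scale_fun scale 2 x) \<in> S" by (rule E.subspace_scale) fact+
  then show ?thesis by (simp add: scale_fun_def)
qed

lemma mult_simps:
  "x \<cdot> (y + z) = x \<cdot> y + x \<cdot> z" "(x + y) \<cdot> z = x \<cdot> z + y \<cdot> z"
  "x \<cdot> (y - z) = x \<cdot> y - x \<cdot> z" "(x - y) \<cdot> z = x \<cdot> z - y \<cdot> z"
  "x \<cdot> (c *s y) = c *s (x \<cdot> y)" "(c *s x) \<cdot> y = c *s (x \<cdot> y)"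
  "x \<cdot> (- y) = - (x \<cdot> y)" "(- x) \<cdot> y = - (x \<cdot> y)" "x \<cdot> 0 = 0" "0 \<cdot> x = 0"
  using lin_add[OF lin_L] lin_add[OF lin_R[of z]] lin_diff[OF lin_L] lin_diff[OF lin_R[of z]]
    lin_scale[OF lin_L] lin_scale[OF lin_R[of y]] lin_neg[OF lin_L] lin_neg[OF lin_R[of y]]
    lin_0[OF lin_L] lin_0[OF lin_R[of x]]
  by simp_all

lemma L_lin_simps:
  "L (x + y) = L x + L y" "L (x - y) = L x - L y" "L (c *s x) = scale_fun scale c (L x)" "L 0 = 0"
  by (simp_all add: fun_eq_iff mult_simps)

lemma L_inj: "L x = L y \<Longrightarrow> x = y"
  by (metis unit_right)

lemma E_lin_comp_left: "lin f \<Longrightarrow> E.lin (\<lambda>T. f \<circ> T)"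
  by (rule E.linI) (simp_all add: fun_eq_iff lin_add lin_scale)

lemma E_lin_comp_right: "E.lin (\<lambda>T. T \<circ> f)"
  by (rule E.linI) (simp_all add: fun_eq_iff)

text \<open>The commutator of \<open>L a\<close> and \<open>L b\<close> applied to \<open>c\<close>.
  For commuting \<open>a\<close> and \<open>b\<close> the last two terms of \<open>triple\<close>
  cancel and it agrees with the triple product.\<close>

definition triple_comm :: "'b \<Rightarrow> 'b \<Rightarrow> 'b \<Rightarrow> 'b" where
  "triple_comm a b c = a \<cdot> (b \<cdot> c) - b \<cdot> (a \<cdot> c)"

abbreviation Z :: "'b set" where "Z \<equiv> centre mult"

lemma Z_D:
  assumes "z \<in> Z"
  shows "z \<cdot> x = x \<cdot> z" "(z \<cdot> x) \<cdot> y = z \<cdot> (x \<cdot> y)" "(x \<cdot> z) \<cdot> y = x \<cdot> (z \<cdot> y)"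
    "(x \<cdot> y) \<cdot> z = x \<cdot> (y \<cdot> z)" "x \<cdot> (z \<cdot> y) = z \<cdot> (x \<cdot> y)"
proof -
  show 1: "z \<cdot> x = x \<cdot> z" for x using assms by (auto simp: centre_def)
  show 2: "(z \<cdot> x) \<cdot> y = z \<cdot> (x \<cdot> y)" for x y using assms by (auto simp: centre_def associator_def)
  show 3: "(x \<cdot> z) \<cdot> y = x \<cdot> (z \<cdot> y)" using assms by (auto simp: centre_def associator_def)
  show "(x \<cdot> y) \<cdot> z = x \<cdot> (y \<cdot> z)" using assms by (auto simp: centre_def associator_def)
  show "x \<cdot> (z \<cdot> y) = z \<cdot> (x \<cdot> y)" using 1[of x] 2[of x y] 3 by simp
qed

lemma Z_I:
  assumes "\<And>x. z \<cdot> x = x \<cdot> z" "\<And>x y. (z \<cdot> x) \<cdot> y = z \<cdot> (x \<cdot> y)" "\<And>x y. (x \<cdot> z) \<cdot> y = x \<cdot> (z \<cdot> y)"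
    "\<And>x y. (x \<cdot> y) \<cdot> z = x \<cdot> (y \<cdot> z)"
  shows "z \<in> Z"
  using assms by (simp add: centre_def associator_def)

lemma e_Z: "e \<in> Z"
  by (rule Z_I) simp_all

lemma Z_mult: "z \<in> Z \<Longrightarrow> z' \<in> Z \<Longrightarrow> z \<cdot> z' \<in> Z"
  by (rule Z_I) (metis Z_D)+

lemma Z_subspace: "subspace Z"
proof (rule subspaceI)
  show "0 \<in> Z" by (rule Z_I) (simp_all add: mult_simps)
  fix x y c assume x: "x \<in> Z"
  show "c *s x \<in> Z"
  proof (rule Z_I)
    show "(c *s x) \<cdot> u = u \<cdot> (c *s x)" for u using Z_D(1)[OF x, of u] by (simp add: mult_simps)
  qed (simp_all add: mult_simps Z_D(2-4) x)
  assume y: "y \<in> Z"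
  show "x + y \<in> Z"
  proof (rule Z_I)
    show "(x + y) \<cdot> u = u \<cdot> (x + y)" for u
      using Z_D(1)[OF x, of u] Z_D(1)[OF y, of u] by (simp add: mult_simps)
  qed (simp_all add: mult_simps Z_D(2-4) x y)
qed

lemma eval_span:
  assumes "subspace S" "\<And>T. T \<in> A \<Longrightarrow> T e \<in> S" "T \<in> E.span A"
  shows "T e \<in> S"
  using assms(3)
  by (induction rule: E.span_induct_alt)
    (use assms in \<open>simp_all add: subspace_0 subspace_add subspace_scale\<close>)

end

text \<open>The first index of a word only bounds the number of its letters; the second one is its weight.\<close>

inductive word :: "('b \<Rightarrow> 'b \<Rightarrow> 'b) \<Rightarrow> 'b set \<Rightarrow> (nat \<Rightarrow> 'b \<Rightarrow> bool) \<Rightarrow> nat \<Rightarrow> nat \<Rightarrow> ('b \<Rightarrow> 'b) \<Rightarrow> bool"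
  for mult Z Lt where
  base: "z \<in> Z \<Longrightarrow> word mult Z Lt k 0 (mult z)"
| step: "word mult Z Lt k w T \<Longrightarrow> Lt v b \<Longrightarrow> word mult Z Lt (Suc k) (w + v) (mult b \<circ> T)"

text \<open>The condition \<open>Z_V\<close> allows central elements to be subtracted without
  leaving \<open>V\<close>; the final proof provides it by replacing the given subsystem by its sum
  with the centre.\<close>

locale comm_alt_algebra = fd_algebra scale mult e
  for scale :: "'a::field_char_0 \<Rightarrow> 'b::ab_group_add \<Rightarrow> 'b" (infixr "*s" 75)
    and mult :: "'b \<Rightarrow> 'b \<Rightarrow> 'b" (infixl "\<cdot>" 70) and e :: 'b +
  fixes V :: "'b set"
  assumes V_subspace: "subspace V"
    and V_alt: "a \<in> V \<Longrightarrow> (a \<cdot> x + x \<cdot> a) \<cdot> y = a \<cdot> (x \<cdot> y) + x \<cdot> (a \<cdot> y)"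
    and V_comm: "a \<in> V \<Longrightarrow> b \<in> V \<Longrightarrow> a \<cdot> b = b \<cdot> a"
    and V_triple: "a \<in> V \<Longrightarrow> b \<in> V \<Longrightarrow> c \<in> V \<Longrightarrow> triple_comm a b c \<in> V"
    and V_gen: "subspace S \<Longrightarrow> e \<in> S \<Longrightarrow> V \<subseteq> S \<Longrightarrow> (\<And>x y. x \<in> S \<Longrightarrow> y \<in> S \<Longrightarrow> x \<cdot> y \<in> S) \<Longrightarrow> S = UNIV"
    and Z_V: "Z \<subseteq> V"
begin

text \<open>The law \<open>V_alt\<close> moves \<open>a\<close> and \<open>b\<close> out of left
  multiplications by a(bc) and b(ac), leaving products with bc and ac. For commuting letters it also
  says 2 L(bc) = L b L c + L c L b, which resolves those.\<close>

lemma L_triple: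
  assumes "a \<in> V" "b \<in> V" "c \<in> V"
  shows "triple_comm a b c \<cdot> y = triple_comm a b (c \<cdot> y) - c \<cdot> triple_comm a b y"
proof -
  have sw: "(u \<cdot> x) \<cdot> y = u \<cdot> (x \<cdot> y) + x \<cdot> (u \<cdot> y) - (x \<cdot> u) \<cdot> y" if "u \<in> V" for u x y
    using V_alt[OF that, of x y] by (simp add: mult_simps algebra_simps)
  have db: "2 *s ((u \<cdot> v) \<cdot> y) = u \<cdot> (v \<cdot> y) + v \<cdot> (u \<cdot> y)" if "u \<in> V" "v \<in> V" for u v y
    using V_alt[OF that(1), of v y] V_comm[OF that]
    by (simp add: mult_simps double)
  have 1: "(a \<cdot> (b \<cdot> c)) \<cdot> y = a \<cdot> ((b \<cdot> c) \<cdot> y) + (b \<cdot> c) \<cdot> (a \<cdot> y) - ((b \<cdot> c) \<cdot> a) \<cdot> y"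
    by (rule sw) fact
  have 2: "(b \<cdot> (a \<cdot> c)) \<cdot> y = b \<cdot> ((a \<cdot> c) \<cdot> y) + (a \<cdot> c) \<cdot> (b \<cdot> y) - ((a \<cdot> c) \<cdot> b) \<cdot> y"
    by (rule sw) fact
  have A: "2 *s ((b \<cdot> c) \<cdot> a) = b \<cdot> (c \<cdot> a) + c \<cdot> (b \<cdot> a)"
    and B: "2 *s ((a \<cdot> c) \<cdot> b) = a \<cdot> (c \<cdot> b) + c \<cdot> (a \<cdot> b)"
    using db assms by auto
  have "2 *s ((b \<cdot> c) \<cdot> a - (a \<cdot> c) \<cdot> b) = b \<cdot> (a \<cdot> c) - a \<cdot> (b \<cdot> c)"
    using A B V_comm assms by (simp add: scale_right_diff_distrib mult_simps)
  then have "2 *s ((((b \<cdot> c) \<cdot> a - (a \<cdot> c) \<cdot> b)) \<cdot> y) = (b \<cdot> (a \<cdot> c) - a \<cdot> (b \<cdot> c)) \<cdot> y"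
    by (metis mult_simps(6))
  then have 3: "2 *s (((b \<cdot> c) \<cdot> a) \<cdot> y - ((a \<cdot> c) \<cdot> b) \<cdot> y) = - (triple_comm a b c \<cdot> y)"
    by (simp add: mult_simps triple_comm_def scale_right_diff_distrib)
  define x0 where "x0 = triple_comm a b c \<cdot> y"
  define p0 where "p0 = a \<cdot> ((b \<cdot> c) \<cdot> y) + (b \<cdot> c) \<cdot> (a \<cdot> y) - b \<cdot> ((a \<cdot> c) \<cdot> y) - (a \<cdot> c) \<cdot> (b \<cdot> y)"
  define y0 where "y0 = ((b \<cdot> c) \<cdot> a) \<cdot> y - ((a \<cdot> c) \<cdot> b) \<cdot> y"
  have 4: "x0 = p0 - y0"
    unfolding x0_def p0_def y0_def triple_comm_def mult_simps 1 2 by (simp add: algebra_simps)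
  \<comment> \<open>The remainder \<open>y0\<close> is not a product of letters; by commutativity 2
    \<open>y0\<close> = - \<open>x0\<close>, which turns the relation into \<open>x0\<close> = 2
    \<open>p0\<close>.\<close>
  have "x0 + x0 = 2 *s p0 - 2 *s y0" unfolding double by (subst 4) (rule scale_right_diff_distrib)
  then have "x0 + x0 = 2 *s p0 + x0" using 3 by (simp add: x0_def y0_def)
  then have "triple_comm a b c \<cdot> y = 2 *s p0" by (simp add: x0_def)
  also have "\<dots> = a \<cdot> (2 *s ((b \<cdot> c) \<cdot> y)) + 2 *s ((b \<cdot> c) \<cdot> (a \<cdot> y))
      - b \<cdot> (2 *s ((a \<cdot> c) \<cdot> y)) - 2 *s ((a \<cdot> c) \<cdot> (b \<cdot> y))"
    by (simp add: p0_def mult_simps scale_right_diff_distrib scale_right_distrib)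
  also have "\<dots> = triple_comm a b (c \<cdot> y) - c \<cdot> triple_comm a b y"
    unfolding db[OF assms(2,3)] db[OF assms(1,3)] by (simp add: mult_simps triple_comm_def)
  finally show ?thesis .
qed

lemma triple_e: "a \<in> V \<Longrightarrow> b \<in> V \<Longrightarrow> triple_comm a b e = 0"
  using V_comm by (simp add: triple_comm_def)

lemma triple_lin: "lin (triple_comm a b)"
  by (rule linI) (simp_all add: triple_comm_def mult_simps scale_right_diff_distrib)

lemma triple_Z: "a \<in> V \<Longrightarrow> b \<in> V \<Longrightarrow> z \<in> Z \<Longrightarrow> triple_comm a b z = 0"
  using V_comm[of a b] Z_D(1)[of z a] Z_D(1)[of z b] Z_D(5)[of z a b] Z_D(5)[of z b a]
  unfolding triple_comm_def by (metis diff_self)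

end

text \<open>Instantiated twice: with all of \<open>V\<close> in weight 0, to obtain an induction
  principle for \<open>A\<close>, and with \<open>V'\<close> in positive weights, to obtain the
  filtration that proves nilpotency.\<close>

locale letters = comm_alt_algebra +
  fixes Lt :: "nat \<Rightarrow> 'b \<Rightarrow> bool"
  assumes Lt_V: "Lt v b \<Longrightarrow> b \<in> V"
    and Lt_triple: "Lt u a \<Longrightarrow> Lt v b \<Longrightarrow> Lt w c \<Longrightarrow> Lt (u + v + w) (triple_comm a b c)"
begin

section \<open>Spans of words and the induced filtration\<close>

abbreviation "wd \<equiv> word mult Z Lt"

definition SW :: "nat \<Rightarrow> nat \<Rightarrow> ('b \<Rightarrow> 'b) set" where
  "SW k w = E.span {T. wd k w T}"

definition PW :: "nat \<Rightarrow> nat \<Rightarrow> 'b set" where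
  "PW k w = (\<lambda>T. T e) ` SW k w"

lemma wd_lin: "wd k w T \<Longrightarrow> lin T"
  by (induction rule: word.induct) (blast intro: lin_L lin_comp)+

lemma wd_Suc: "wd k w T \<Longrightarrow> wd (Suc k) w T"
  by (induction rule: word.induct) (blast intro: word.intros)+

lemma PW_I: "wd k w T \<Longrightarrow> T e \<in> PW k w"
  unfolding PW_def SW_def by (rule imageI) (rule E.span_base, simp)

lemma SW_Suc: "SW k w \<subseteq> SW (Suc k) w"
  unfolding SW_def by (rule E.span_mono) (auto intro: wd_Suc)

lemma PW_Suc: "PW k w \<subseteq> PW (Suc k) w"
  unfolding PW_def using SW_Suc by blast

lemma PW_subspace: "subspace (PW k w)"
proof (rule subspaceI)
  show "0 \<in> PW k w" unfolding PW_def SW_def by (rule image_eqI[of _ _ 0]) (simp_all add: E.span_zero)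
  show "x + y \<in> PW k w" if xy: "x \<in> PW k w" "y \<in> PW k w" for x y
  proof -
    obtain T T' where "x = T e" "y = T' e" "T \<in> SW k w" "T' \<in> SW k w" using xy unfolding PW_def by blast
    then show ?thesis unfolding PW_def SW_def by (intro image_eqI[of _ _ "T + T'"]) (simp_all add: E.span_add)
  qed
  show "c *s x \<in> PW k w" if x: "x \<in> PW k w" for c x
  proof -
    obtain T where "x = T e" "T \<in> SW k w" using x unfolding PW_def by blast
    then show ?thesis unfolding PW_def SW_def by (intro image_eqI[of _ _ "scale_fun scale c T"]) (simp_all add: E.span_scale)
  qed
qed

lemma SW_step:
  assumes T: "T \<in> SW k w" and b: "Lt v b"
  shows "L b \<circ> T \<in> SW (Suc k) (w + v)"
  unfolding SW_def
proof (rule E.lin_span_image[OF E_lin_comp_left[OF lin_L] _ E.subspace_span T[unfolded SW_def]])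
  fix T assume "T \<in> {T. wd k w T}"
  then have "wd (Suc k) (w + v) (L b \<circ> T)" by (intro word.step b) simp
  then show "L b \<circ> T \<in> E.span {T. wd (Suc k) (w + v) T}" by (intro E.span_base) simp
qed

lemma PW_step:
  assumes x: "x \<in> PW k w" and b: "Lt v b"
  shows "b \<cdot> x \<in> PW (Suc k) (w + v)"
proof -
  obtain T where T: "x = T e" "T \<in> SW k w" using x unfolding PW_def by (rule imageE)
  show ?thesis unfolding PW_def
    by (rule image_eqI[OF _ SW_step[OF T(2) b]]) (simp add: T(1))
qed

lemma wd_Z: "wd k w T \<Longrightarrow> z \<in> Z \<Longrightarrow> wd k w (L z \<circ> T)"
proof (induction rule: word.induct)
  case (base z' k)
  then have "L z \<circ> L z' = L (z \<cdot> z')" by (simp add: fun_eq_iff Z_D(2))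
  then show ?case using base by (simp add: Z_mult word.base)
next
  case (step k w T v b)
  then have "L z \<circ> (L b \<circ> T) = L b \<circ> (L z \<circ> T)" by (auto simp: fun_eq_iff intro: Z_D(5)[symmetric])
  then show ?case using step by (metis word.step)
qed

lemma wd_comp: "wd k w T \<Longrightarrow> wd k' w' T' \<Longrightarrow> wd (k + k') (w + w') (T \<circ> T')"
proof (induction rule: word.induct)
  case (base z k)
  have "wd (k + k') w' T'" using base(2) by (induction k) (simp_all add: wd_Suc)
  then have "wd (k + k') w' (L z \<circ> T')" using base(1) by (rule wd_Z)
  then show ?case by (simp only: add_0)
next
  case (step k w T v b)
  have "wd (Suc (k + k')) (w + w' + v) (L b \<circ> (T \<circ> T'))"
    by (rule word.step[OF step.IH[OF step.prems] step.hyps(2)])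
  moreover have "w + w' + v = w + v + w'" "Suc (k + k') = Suc k + k'" by simp_all
  ultimately show ?case by (simp only: comp_assoc)
qed

text \<open>By \<open>L_triple\<close> the commutator of two letters acts on a word by replacing one
  letter after another by a triple product, and it kills the centre. The length bound thus does not
  grow.\<close>

lemma wd_triple:
  assumes "Lt u a" "Lt v b"
  shows "wd k w T \<Longrightarrow> triple_comm a b (T e) \<in> PW k (w + (u + v))"
proof (induction rule: word.induct)
  case (base z k)
  have "triple_comm a b z = 0" using triple_Z Lt_V assms base by blast
  then show ?case using subspace_0[OF PW_subspace] by simp
next
  case (step k w T x c)
  have c: "c \<in> V" using Lt_V step by blast
  have 1: "c \<cdot> triple_comm a b (T e) \<in> PW (Suc k) (w + (u + v) + x)"
    by (rule PW_step) (use step in auto)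
  have "wd (Suc k) (w + (u + v + x)) (L (triple_comm a b c) \<circ> T)"
    by (rule word.step) (use step assms Lt_triple in auto)
  from PW_I[OF this] have 2: "triple_comm a b c \<cdot> T e \<in> PW (Suc k) (w + (u + v + x))" by simp
  have "triple_comm a b (c \<cdot> T e) = triple_comm a b c \<cdot> T e + c \<cdot> triple_comm a b (T e)"
    using L_triple[of a b c "T e"] Lt_V assms c by force
  then show ?case using 1 2 subspace_add[OF PW_subspace] by (simp add: ac_simps)
qed

text \<open>Each of the two terms may need \<open>Suc k\<close> letters. Carrying \<open>c\<close>
  through \<open>T\<close> costs only commutators of letters, which shorten the word by
  \<open>wd_triple\<close>; this is what makes inductions on the length possible.\<close>

lemma wd_commutator:
  assumes c: "Lt v c"
  shows "wd k w T \<Longrightarrow> T c - c \<cdot> T e \<in> PW k (w + v)"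
proof (induction rule: word.induct)
  case (base z k)
  then show ?case using subspace_0[OF PW_subspace] Z_D(1)[of z c] by simp
next
  case (step k w T u b)
  have 1: "b \<cdot> (T c - c \<cdot> T e) \<in> PW (Suc k) (w + v + u)"
    by (rule PW_step) (use step in auto)
  have "triple_comm b c (T e) \<in> PW k (w + (u + v))"
    by (rule wd_triple) (use step c in auto)
  then have 2: "triple_comm b c (T e) \<in> PW (Suc k) (w + (u + v))" using PW_Suc by blast
  have "b \<cdot> T c - c \<cdot> (b \<cdot> T e) = b \<cdot> (T c - c \<cdot> T e) + triple_comm b c (T e)"
    by (simp add: triple_comm_def mult_simps)
  then show ?case using 1 2 subspace_add[OF PW_subspace] by (simp add: ac_simps)
qed

lemma SW_commutator:
  assumes c: "Lt v c" and T: "T \<in> SW k w"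
  shows "T c - c \<cdot> T e \<in> PW k (w + v)"
proof -
  have l: "Vector_Spaces.linear (scale_fun scale) scale (\<lambda>T. T c - c \<cdot> T e)"
    by (simp add: Vector_Spaces.linear_iff vector_space_axioms E.vector_space_axioms mult_simps scale_right_diff_distrib)
  show ?thesis using T unfolding SW_def
  proof (induction rule: E.span_induct_alt)
    case base
    show ?case using subspace_0[OF PW_subspace] by (simp add: mult_simps)
  next
    case (step r T T')
    have eq: "(scale_fun scale r T + T') c - c \<cdot> (scale_fun scale r T + T') e
        = r *s (T c - c \<cdot> T e) + (T' c - c \<cdot> T' e)"
      by (simp add: mult_simps scale_right_diff_distrib)
    have "T c - c \<cdot> T e \<in> PW k (w + v)" by (rule wd_commutator[OF c]) (use step in simp)
    then show ?case unfolding eq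
      by (intro subspace_add[OF PW_subspace] subspace_scale[OF PW_subspace] step)
  qed
qed

lemma SW_I: "wd k w T \<Longrightarrow> T \<in> SW k w"
  unfolding SW_def by (rule E.span_base) simp

lemma SW_step_right:
  assumes T: "T \<in> SW k w" and b: "Lt v b"
  shows "T \<circ> L b \<in> SW (Suc k) (w + v)"
proof -
  have "wd (Suc 0) (0 + v) (L b \<circ> L e)" by (intro word.intros e_Z b)
  then have b': "wd (Suc 0) v (L b)" by (simp add: comp_def)
  show ?thesis
  proof (rule E.lin_span_image[OF E_lin_comp_right _ _ T[unfolded SW_def]])
    fix T assume "T \<in> {T. wd k w T}"
    then have "wd (k + Suc 0) (w + v) (T \<circ> L b)" by (intro wd_comp b') simp
    then show "T \<circ> L b \<in> SW (Suc k) (w + v)" by (intro SW_I) simp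
  qed (simp add: SW_def)
qed

lemma L_eval_lin: "E.lin (\<lambda>T. L (T e))"
  by (rule E.linI) (simp_all add: fun_eq_iff mult_simps)

text \<open>For a letter b one has 2 b x = (b x + x b) + (b x - x b); the first summand is governed by the
  generalised alternative law, the second one is a combination of shorter words.\<close>

lemma L_word: "T \<in> SW k w \<Longrightarrow> L (T e) \<in> SW k w"
proof (induction k arbitrary: w T)
  case 0
  have "L (T e) \<in> SW 0 w" if "wd 0 w T" for T
    using that by (cases rule: word.cases) (auto simp: SW_def intro!: E.span_base word.base)
  then show ?case
    using E.lin_span_image[OF L_eval_lin, of "{T. wd 0 w T}" "SW 0 w" T] 0 by (simp add: SW_def)
next
  case (Suc k)
  have "L (T e) \<in> SW (Suc k) w" if "wd (Suc k) w T" for T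
    using that
  proof (cases rule: word.cases)
    case (base z)
    then show ?thesis by (auto simp: SW_def intro!: E.span_base word.base)
  next
    case (step w' T' v b)
    let ?x = "T' e" let ?p = "?x \<cdot> b - b \<cdot> ?x"
    have b: "b \<in> V" using step Lt_V by blast
    have Lx: "L ?x \<in> SW k w'" by (rule Suc.IH) (rule SW_I[OF step(3)])
    have "?p \<in> PW k (w' + v)" using SW_commutator[OF step(4) Lx] by simp
    then obtain P where P: "P \<in> SW k (w' + v)" "?p = P e" unfolding PW_def by (rule imageE)
    have "L ?p \<in> SW k (w' + v)" unfolding P(2) by (rule Suc.IH[OF P(1)])
    then have 1: "L ?p \<in> SW (Suc k) (w' + v)" using SW_Suc by blast
    have 2: "L b \<circ> L ?x \<in> SW (Suc k) (w' + v)" and 3: "L ?x \<circ> L b \<in> SW (Suc k) (w' + v)"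
      by (rule SW_step[OF Lx step(4)]) (rule SW_step_right[OF Lx step(4)])
    have "scale_fun scale 2 (L (b \<cdot> ?x)) = (L b \<circ> L ?x) + (L ?x \<circ> L b) - L ?p"
      using V_alt[OF b, of ?x] by (simp add: fun_eq_iff mult_simps double[symmetric] algebra_simps)
    moreover have "\<dots> \<in> SW (Suc k) (w' + v)"
      using 1 2 3 unfolding SW_def by (intro E.span_diff E.span_add)
    ultimately have "L (b \<cdot> ?x) \<in> SW (Suc k) (w' + v)"
      using E_half_mem[of "SW (Suc k) (w' + v)"] unfolding SW_def by simp
    then show ?thesis using step by simp
  qed
  then show ?case
    using E.lin_span_image[OF L_eval_lin, of "{T. wd (Suc k) w T}" "SW (Suc k) w" T] Suc.prems
    by (simp add: SW_def)
qed

text \<open>For a letter \<open>b\<close> and a shorter value \<open>x\<close>, twice b x is b x + x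
  b minus x b - b x. The first part is in \<open>S\<close> by hypothesis, the second by induction,
  being a value of shorter words.\<close>

lemma PW_subset:
  assumes S: "subspace S" "Z \<subseteq> S" "\<And>b x v. Lt v b \<Longrightarrow> x \<in> S \<Longrightarrow> b \<cdot> x + x \<cdot> b \<in> S"
  shows "PW k w \<subseteq> S"
proof (induction k arbitrary: w)
  case 0
  have "T e \<in> S" if "wd 0 w T" for T
    using that by (cases rule: word.cases) (use S in auto)
  then show ?case unfolding PW_def SW_def using eval_span[OF S(1), of "{T. wd 0 w T}"] by blast
next
  case (Suc k)
  have "T e \<in> S" if "wd (Suc k) w T" for T
    using that
  proof (cases rule: word.cases)
    case (step w' T' v b)
    let ?x = "T' e" let ?p = "?x \<cdot> b - b \<cdot> ?x"
    have T': "T' \<in> SW k w'" by (rule SW_I[OF step(3)])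
    have "?p \<in> PW k (w' + v)" using SW_commutator[OF step(4) L_word[OF T']] by simp
    then have p: "?p \<in> S" using Suc.IH by (rule subsetD[rotated])
    have x: "?x \<in> S" using Suc.IH T' unfolding PW_def by blast
    have "2 *s (b \<cdot> ?x) = (b \<cdot> ?x + ?x \<cdot> b) - ?p" by (simp add: double[symmetric])
    also have "\<dots> \<in> S" by (rule subspace_diff[OF S(1)]) (use S(3) x p step in auto)
    finally have "b \<cdot> ?x \<in> S" by (rule half_mem[OF S(1)])
    then show ?thesis using step by simp
  qed (use S in auto)
  then show ?case unfolding PW_def SW_def
    using eval_span[OF S(1), of "{T. wd (Suc k) w T}"] by blast
qed

definition SG :: "nat \<Rightarrow> ('b \<Rightarrow> 'b) set" where
  "SG n = E.span {T. \<exists>k w. n \<le> w \<and> wd k w T}"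

definition PG :: "nat \<Rightarrow> 'b set" where
  "PG n = (\<lambda>T. T e) ` SG n"

lemma SG_I: "wd k w T \<Longrightarrow> n \<le> w \<Longrightarrow> T \<in> SG n"
  unfolding SG_def by (rule E.span_base) blast

lemma SW_SG: "n \<le> w \<Longrightarrow> SW k w \<subseteq> SG n"
  unfolding SW_def SG_def by (rule E.span_mono) blast

lemma SG_comp:
  assumes "T \<in> SG m" "T' \<in> SG n"
  shows "T \<circ> T' \<in> SG (m + n)"
proof -
  have 1: "T \<circ> T' \<in> SG (m + n)" if T: "T \<in> {T. \<exists>k w. m \<le> w \<and> wd k w T}" for T
  proof -
    obtain k w where T: "m \<le> w" "wd k w T" using T by blast
    have "T \<circ> T'' \<in> SG (m + n)" if "T'' \<in> {T. \<exists>k w. n \<le> w \<and> wd k w T}" for T''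
      using that T wd_comp SG_I by (smt (verit, best) mem_Collect_eq add_mono)
    then show ?thesis
      using E.lin_span_image[OF E_lin_comp_left[OF wd_lin[OF T(2)]], of _ "SG (m + n)" T'] assms(2)
      unfolding SG_def by blast
  qed
  show ?thesis
    using E.lin_span_image[OF E_lin_comp_right[of T'], of _ "SG (m + n)" T] 1 assms(1)
    unfolding SG_def by blast
qed

lemma L_SG: "T \<in> SG n \<Longrightarrow> L (T e) \<in> SG n"
proof -
  assume T: "T \<in> SG n"
  have "L (T e) \<in> SG n" if T: "T \<in> {T. \<exists>k w. n \<le> w \<and> wd k w T}" for T
  proof -
    obtain k w where "n \<le> w" "wd k w T" using T by blast
    then show ?thesis using L_word[of T k w] SW_SG by (auto simp: SW_def E.span_base)
  qed
  then show ?thesis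
    using E.lin_span_image[OF L_eval_lin, of _ "SG n" T] T unfolding SG_def by blast
qed

text \<open>Membership of \<open>x\<close> becomes a statement about the operator
  \<open>L x\<close>, so that products in \<open>A\<close> are controlled by compositions of
  words.\<close>

lemma PG_SG: "x \<in> PG n \<longleftrightarrow> L x \<in> SG n"
proof
  show "x \<in> PG n \<Longrightarrow> L x \<in> SG n" unfolding PG_def using L_SG by blast
  show "L x \<in> SG n \<Longrightarrow> x \<in> PG n" unfolding PG_def by (rule image_eqI[of _ _ "L x"]) simp_all
qed

lemma PG_subspace: "subspace (PG n)"
  by (rule subspaceI)
    (simp_all only: PG_SG L_lin_simps SG_def E.span_zero E.span_add E.span_scale)

lemma PG_mult: "x \<in> PG m \<Longrightarrow> y \<in> PG n \<Longrightarrow> x \<cdot> y \<in> PG (m + n)"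
proof -
  assume "x \<in> PG m" "y \<in> PG n"
  then have "L x \<circ> L y \<in> SG (m + n)" by (simp add: PG_SG SG_comp)
  then show ?thesis unfolding PG_def by (rule image_eqI[rotated]) simp
qed

lemma PG_UNIV:
  assumes "V \<subseteq> PG 0"
  shows "PG 0 = UNIV"
proof (rule V_gen[OF PG_subspace _ assms])
  show "e \<in> PG 0" using SG_I[OF word.base[OF e_Z], of 0] by (simp add: PG_SG)
qed (use PG_mult[of _ 0 _ 0] in simp)

\<comment> \<open>Induction over the algebra, derivations and centrality\<close>
end

context comm_alt_algebra
begin

sublocale W0: letters scale mult e V "\<lambda>w b. w = 0 \<and> b \<in> V"
  by unfold_locales (auto intro: V_triple)

text \<open>An induction principle for \<open>A\<close>: the step concerns exactly the elements b x
  + x b whose left multiplication is known from \<open>V_alt\<close>.\<close>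

lemma SPAN:
  assumes S: "subspace S" "e \<in> S" "\<And>b x. b \<in> V \<Longrightarrow> x \<in> S \<Longrightarrow> b \<cdot> x + x \<cdot> b \<in> S"
  shows "S = UNIV"
proof -
  have VS: "V \<subseteq> S"
  proof
    fix b assume "b \<in> V"
    then have "b \<cdot> e + e \<cdot> b \<in> S" using S by blast
    then show "b \<in> S" using half_mem[OF S(1)] by (simp add: double)
  qed
  have wd0: "W0.wd k w T \<Longrightarrow> w = 0" for k w T
    by (induction rule: word.induct) auto
  have PW: "W0.PW k w \<subseteq> S" for k w
    by (rule W0.PW_subset[OF S(1)]) (use S VS Z_V in auto)
  have "V \<subseteq> W0.PG 0"
  proof
    fix b assume b: "b \<in> V"
    have "W0.wd (Suc 0) (0 + 0) (L b \<circ> L e)" by (intro word.intros e_Z) (simp add: b)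
    from W0.SG_I[OF this, of 0] have "L b \<in> W0.SG 0" by (simp add: comp_def)
    then show "b \<in> W0.PG 0" by (simp add: W0.PG_SG)
  qed
  then have U: "W0.PG 0 = UNIV" by (rule W0.PG_UNIV)
  have "T e \<in> S" if "T \<in> W0.SG 0" for T
    using eval_span[OF S(1) _ that[unfolded W0.SG_def]] W0.PW_I PW by blast
  then have "W0.PG 0 \<subseteq> S" unfolding W0.PG_def by blast
  then show ?thesis using U by blast
qed

text \<open>For \<open>x\<close> in \<open>V\<close> this is \<open>L_triple\<close>. The induction
  \<open>SPAN\<close> extends it to all \<open>x\<close>, as \<open>V_alt\<close> applies both to
  the letter \<open>c\<close> and to its image under the derivation, which is again in
  \<open>V\<close>.\<close>

lemma derivation:
  assumes ab: "a \<in> V" "b \<in> V"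
  shows "triple_comm a b (x \<cdot> y) = triple_comm a b x \<cdot> y + x \<cdot> triple_comm a b y"
proof -
  let ?D = "triple_comm a b"
  let ?S = "{x. \<forall>y. ?D (x \<cdot> y) = ?D x \<cdot> y + x \<cdot> ?D y}"
  have "?S = UNIV"
  proof (rule SPAN)
    show "subspace ?S"
      by (rule subspaceI)
        (simp_all add: mult_simps lin_add[OF triple_lin] lin_scale[OF triple_lin] lin_0[OF triple_lin]
          scale_right_distrib)
    show "e \<in> ?S" using triple_e[OF ab] by (simp add: mult_simps)
    fix c x assume c: "c \<in> V" and x: "x \<in> ?S"
    have Dc: "?D c \<in> V" using V_triple ab c by blast
    have 1: "?D (c \<cdot> y) = ?D c \<cdot> y + c \<cdot> ?D y" for y using L_triple[OF ab c, of y] by simp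
    have 2: "?D (x \<cdot> y) = ?D x \<cdot> y + x \<cdot> ?D y" for y using x by blast
    have "?D ((c \<cdot> x + x \<cdot> c) \<cdot> y) = ?D (c \<cdot> x + x \<cdot> c) \<cdot> y + (c \<cdot> x + x \<cdot> c) \<cdot> ?D y" for y
    proof -
      have "?D ((c \<cdot> x + x \<cdot> c) \<cdot> y) = ?D (c \<cdot> (x \<cdot> y)) + ?D (x \<cdot> (c \<cdot> y))"
        unfolding V_alt[OF c] by (rule lin_add[OF triple_lin])
      also have "\<dots> = (?D c \<cdot> (x \<cdot> y) + x \<cdot> (?D c \<cdot> y)) + (c \<cdot> (?D x \<cdot> y) + ?D x \<cdot> (c \<cdot> y))
          + (c \<cdot> (x \<cdot> ?D y) + x \<cdot> (c \<cdot> ?D y))"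
        unfolding 1 2 by (simp add: mult_simps)
      also have "\<dots> = (?D c \<cdot> x + x \<cdot> ?D c) \<cdot> y + (c \<cdot> ?D x + ?D x \<cdot> c) \<cdot> y + (c \<cdot> x + x \<cdot> c) \<cdot> ?D y"
        unfolding V_alt[OF c] V_alt[OF Dc] ..
      also have "(?D c \<cdot> x + x \<cdot> ?D c) \<cdot> y + (c \<cdot> ?D x + ?D x \<cdot> c) \<cdot> y = ?D (c \<cdot> x + x \<cdot> c) \<cdot> y"
        unfolding lin_add[OF triple_lin] 1 2 by (simp add: mult_simps)
      finally show ?thesis .
    qed
    then show "c \<cdot> x + x \<cdot> c \<in> ?S" by blast
  qed
  then show ?thesis by blast
qed

text \<open>A first use of \<open>SPAN\<close> makes \<open>L z\<close> commute with every
  \<open>L x\<close>, hence \<open>z\<close> with every \<open>x\<close>; a second one gives that z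
  x acts as the composition of \<open>L z\<close> and \<open>L x\<close>. The remaining associators
  follow.\<close>

lemma central_of_commuting:
  assumes z: "\<And>b y. b \<in> V \<Longrightarrow> z \<cdot> (b \<cdot> y) = b \<cdot> (z \<cdot> y)"
  shows "z \<in> Z"
proof -
  let ?S = "{x. \<forall>y. z \<cdot> (x \<cdot> y) = x \<cdot> (z \<cdot> y)}"
  have S1: "?S = UNIV"
  proof (rule SPAN)
    show "subspace ?S" by (rule subspaceI) (simp_all add: mult_simps)
    show "e \<in> ?S" by simp
    fix c x assume c: "c \<in> V" and x: "x \<in> ?S"
    have x': "z \<cdot> (x \<cdot> y) = x \<cdot> (z \<cdot> y)" for y using x by blast
    have "z \<cdot> ((c \<cdot> x + x \<cdot> c) \<cdot> y) = (c \<cdot> x + x \<cdot> c) \<cdot> (z \<cdot> y)" for y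
      unfolding V_alt[OF c] by (simp only: mult_simps(1) z[OF c] x')
    then show "c \<cdot> x + x \<cdot> c \<in> ?S" by blast
  qed
  then have 1: "z \<cdot> (x \<cdot> y) = x \<cdot> (z \<cdot> y)" for x y by blast
  have comm: "z \<cdot> x = x \<cdot> z" for x using 1[of x e] by simp
  let ?S = "{x. \<forall>y. (z \<cdot> x) \<cdot> y = z \<cdot> (x \<cdot> y)}"
  have "?S = UNIV"
  proof (rule SPAN)
    show "subspace ?S" by (rule subspaceI) (simp_all add: mult_simps)
    show "e \<in> ?S" by simp
    fix c x assume c: "c \<in> V" and x: "x \<in> ?S"
    have x': "(z \<cdot> x) \<cdot> y = z \<cdot> (x \<cdot> y)" for y using x by blast
    have "z \<cdot> (c \<cdot> x + x \<cdot> c) = c \<cdot> (z \<cdot> x) + (z \<cdot> x) \<cdot> c"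
      unfolding mult_simps z[OF c] x' ..
    then have "(z \<cdot> (c \<cdot> x + x \<cdot> c)) \<cdot> y = c \<cdot> ((z \<cdot> x) \<cdot> y) + (z \<cdot> x) \<cdot> (c \<cdot> y)" for y
      using V_alt[OF c, of "z \<cdot> x" y] by simp
    then have "(z \<cdot> (c \<cdot> x + x \<cdot> c)) \<cdot> y = z \<cdot> ((c \<cdot> x + x \<cdot> c) \<cdot> y)" for y
      unfolding V_alt[OF c] by (simp only: x' mult_simps(1) z[OF c])
    then show "c \<cdot> x + x \<cdot> c \<in> ?S" by blast
  qed
  then have 2: "(z \<cdot> x) \<cdot> y = z \<cdot> (x \<cdot> y)" for x y by blast
  show ?thesis
  proof (rule Z_I)
    show "(x \<cdot> z) \<cdot> y = x \<cdot> (z \<cdot> y)" for x y by (simp add: comm[symmetric] 1 2)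
    show "(x \<cdot> y) \<cdot> z = x \<cdot> (y \<cdot> z)" for x y by (simp add: comm[symmetric] 1)
  qed (fact comm 2)+
qed

text \<open>A polynomial in \<open>L a\<close> sends \<open>e\<close> to an element \<open>x\<close>
  commuting with \<open>a\<close>, so that \<open>V_alt\<close> reads 2 L(a x) = 2 L a L x.\<close>

lemma L_opoly:
  assumes a: "a \<in> V"
  shows "L (opoly p (L a) e) = opoly p (L a)"
proof (induction p)
  case 0
  show ?case by (simp add: fun_eq_iff mult_simps)
next
  case (pCons c p)
  let ?x = "opoly p (L a) e"
  have x: "?x \<cdot> y = opoly p (L a) y" for y using fun_cong[OF pCons(2)] .
  have co: "a \<cdot> opoly p (L a) y = opoly p (L a) (a \<cdot> y)" for y by (rule opoly_commute) (simp_all add: lin_L)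
  have "?x \<cdot> a = a \<cdot> ?x" using x[of a] co[of e] by simp
  then have "2 *s ((a \<cdot> ?x) \<cdot> y) = 2 *s (a \<cdot> opoly p (L a) y)" for y
    using V_alt[OF a, of ?x y] by (simp add: x co mult_simps double)
  then have "(a \<cdot> ?x) \<cdot> y = a \<cdot> opoly p (L a) y" for y by (simp add: scale_cancel_left)
  then show ?case by (simp add: fun_eq_iff opoly_pCons lin_L mult_simps)
qed

end

section \<open>Nilpotency of the inner action of V\<close>

context lin_space
begin

definition orb :: "('b \<Rightarrow> 'b) \<Rightarrow> 'b set \<Rightarrow> 'b set" where
  "orb f G = span {(f ^^ i) g | i g. g \<in> G}"

lemma orb_subspace: "subspace (orb f G)"
  by (simp add: orb_def)

lemma orb_base: "g \<in> G \<Longrightarrow> g \<in> orb f G"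
  unfolding orb_def by (rule span_base) (metis (mono_tags, lifting) funpow_0 mem_Collect_eq)

lemma orb_step:
  assumes f: "lin f" and x: "x \<in> orb f G"
  shows "f x \<in> orb f G"
  unfolding orb_def
proof (rule lin_span_image[OF f _ subspace_span x[unfolded orb_def]])
  fix y assume "y \<in> {(f ^^ i) g | i g. g \<in> G}"
  then obtain i g where "y = (f ^^ i) g" "g \<in> G" by blast
  then have "f y = (f ^^ Suc i) g" "g \<in> G" by simp_all
  then show "f y \<in> span {(f ^^ i) g | i g. g \<in> G}" by (intro span_base) blast
qed

lemma orb_least:
  assumes "subspace S" "G \<subseteq> S" "\<And>x. x \<in> S \<Longrightarrow> f x \<in> S"
  shows "orb f G \<subseteq> S"
  unfolding orb_def by (rule span_minimal) (use assms funpow_image[of S f] in auto)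

lemma funpow_commute: "(\<And>x. c (f x) = f (c x)) \<Longrightarrow> c ((f ^^ i) x) = (f ^^ i) (c x)"
  by (induction i) simp_all

lemma orb_image:
  assumes c: "lin c" "\<And>x. c (f x) = f (c x)" "\<And>g. g \<in> G \<Longrightarrow> c g \<in> G" and x: "x \<in> orb f G"
  shows "c x \<in> orb f G"
  unfolding orb_def
proof (rule lin_span_image[OF c(1) _ subspace_span x[unfolded orb_def]])
  fix y assume "y \<in> {(f ^^ i) g | i g. g \<in> G}"
  then obtain i g where "y = (f ^^ i) g" "g \<in> G" by blast
  then have "c y = (f ^^ i) (c g)" "c g \<in> G" using funpow_commute[of c f] c by auto
  then show "c y \<in> span {(f ^^ i) g | i g. g \<in> G}" by (intro span_base) blast
qed

lemma orb_surj:
  assumes c: "lin c" "\<And>x. c (f x) = f (c x)" "\<And>g. g \<in> G \<Longrightarrow> \<exists>h\<in>G. g = c h" and x: "x \<in> orb f G"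
  shows "\<exists>y\<in>orb f G. x = c y"
proof -
  let ?S = "{(f ^^ i) g | i g. g \<in> G}"
  have "?S \<subseteq> c ` ?S"
  proof
    fix y assume "y \<in> ?S"
    then obtain i g where y: "y = (f ^^ i) g" "g \<in> G" by blast
    then obtain h where h: "h \<in> G" "g = c h" using c by blast
    then have "y = c ((f ^^ i) h)" using y funpow_commute[of c f] c by simp
    then show "y \<in> c ` ?S" using h by blast
  qed
  then have "span ?S \<subseteq> c ` span ?S" unfolding lin_image_span[OF c(1), symmetric] by (rule span_mono)
  then show ?thesis using x unfolding orb_def by blast
qed

definition dbl :: "('b \<Rightarrow> 'b) \<Rightarrow> 'b set \<Rightarrow> 'b set" where
  "dbl d P = {x + d y | x y. x \<in> P \<and> y \<in> P}"

lemma dbl_I: "x \<in> P \<Longrightarrow> y \<in> P \<Longrightarrow> x + d y \<in> dbl d P"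
  unfolding dbl_def by blast

lemma dbl_E:
  assumes "x \<in> dbl d P"
  obtains u v where "x = u + d v" "u \<in> P" "v \<in> P"
  using assms unfolding dbl_def by blast

lemma dbl_subspace:
  assumes d: "lin d" and P: "subspace P"
  shows "subspace (dbl d P)"
proof (rule subspaceI)
  show "0 \<in> dbl d P" using dbl_I[OF subspace_0[OF P] subspace_0[OF P], of d] by (simp add: lin_0[OF d])
  show "x + y \<in> dbl d P" if x: "x \<in> dbl d P" and y: "y \<in> dbl d P" for x y
  proof -
    obtain u v where uv: "x = u + d v" "u \<in> P" "v \<in> P" using x by (rule dbl_E)
    obtain u' v' where uv': "y = u' + d v'" "u' \<in> P" "v' \<in> P" using y by (rule dbl_E)
    have "x + y = (u + u') + d (v + v')" by (simp add: uv uv' lin_add[OF d])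
    then show ?thesis using dbl_I subspace_add[OF P] uv uv' by metis
  qed
  show "c *s x \<in> dbl d P" if x: "x \<in> dbl d P" for c x
  proof -
    obtain u v where uv: "x = u + d v" "u \<in> P" "v \<in> P" using x by (rule dbl_E)
    have "c *s x = c *s u + d (c *s v)" by (simp add: uv lin_scale[OF d] scale_right_distrib)
    then show ?thesis using dbl_I subspace_scale[OF P] uv by metis
  qed
qed

lemma dbl_base: "lin d \<Longrightarrow> subspace P \<Longrightarrow> x \<in> P \<Longrightarrow> x \<in> dbl d P"
  using dbl_I[of x P 0 d] by (simp add: lin_0 subspace_0)

lemma dbl_d:
  assumes d: "lin d" and P: "subspace P" and dd: "\<And>x. x \<in> P \<Longrightarrow> d (d x) \<in> P" and x: "x \<in> dbl d P"
  shows "d x \<in> dbl d P"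
proof -
  obtain u v where uv: "x = u + d v" "u \<in> P" "v \<in> P" using x by (rule dbl_E)
  have "d x = d (d v) + d u" by (simp add: uv lin_add[OF d])
  then show ?thesis using dbl_I[OF dd[OF uv(3)] uv(2), of d] by simp
qed

lemma dbl_commuting:
  assumes d: "lin d" and f: "lin f" "\<And>x. f (d x) = d (f x)" "\<And>x. x \<in> P \<Longrightarrow> f x \<in> P" and x: "x \<in> dbl d P"
  shows "f x \<in> dbl d P"
proof -
  obtain u v where uv: "x = u + d v" "u \<in> P" "v \<in> P" using x by (rule dbl_E)
  have "f x = f u + d (f v)" by (simp add: uv lin_add[OF f(1)] f)
  then show ?thesis using dbl_I[of "f u" P "f v" d] f(3) uv by simp
qed

lemma dbl_span:
  assumes "lin d" "span B = P"
  shows "span (B \<union> d ` B) = dbl d P"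
  unfolding span_Un dbl_def using assms by (auto simp: lin_image_span)

end

context lin_space_0
begin

text \<open>The operator d exchanges P and d P and so do s d^(2j+1) (for M = P + d P) and l d^(2j+1)
  (for M = N + d N); if both sums are direct, these operators have trace 0, hence so has
  d^(2j+2) = 2 l d^(2j+1) - s d^(2j+1).\<close>

lemma orb_collapse:
  assumes s: "lin s" and d: "lin d" and l: "lin l"
    and sd: "\<And>x. s (d x) = d (s x)" and ld: "\<And>x. l (d x) = d (l x)"
    and sl: "\<And>x. s x + d x = 2 *s l x"
    and M0: "fin_span M0" "G \<subseteq> M0" "\<And>x. x \<in> M0 \<Longrightarrow> s x \<in> M0" "\<And>x. x \<in> M0 \<Longrightarrow> d x \<in> M0"
    and G: "\<And>g. g \<in> G \<Longrightarrow> d (d g) \<in> G" "\<And>g. g \<in> G \<Longrightarrow> \<exists>h\<in>G. g = d (d h)"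
    and disj: "orb s G \<inter> d ` orb l G \<subseteq> {0}"
  shows "G \<subseteq> {0}"
proof -
  define P where "P = orb s G"
  define N where "N = orb l G"
  define M where "M = dbl d P"
  have P: "subspace P" and N: "subspace N" by (simp_all add: P_def N_def orb_subspace)
  have dd: "lin (\<lambda>x. d (d x))" using lin_comp[OF d d] by (simp add: comp_def)
  have ddP: "d (d x) \<in> P" if "x \<in> P" for x
    unfolding P_def by (rule orb_image[OF dd _ G(1) that[unfolded P_def]]) (simp add: sd)
  have ddN: "d (d x) \<in> N" if "x \<in> N" for x
    unfolding N_def by (rule orb_image[OF dd _ G(1) that[unfolded N_def]]) (simp add: ld)
  have ddP': "\<exists>y\<in>P. x = d (d y)" if "x \<in> P" for x
    unfolding P_def by (rule orb_surj[OF dd _ G(2) that[unfolded P_def]]) (simp add: sd)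
  have sP: "s x \<in> P" if "x \<in> P" for x
    unfolding P_def by (rule orb_step[OF s that[unfolded P_def]])
  have lN: "l x \<in> N" if "x \<in> N" for x
    unfolding N_def by (rule orb_step[OF l that[unfolded N_def]])
  have M: "subspace M" unfolding M_def by (rule dbl_subspace[OF d P])
  have dM: "d x \<in> M" if "x \<in> M" for x
    using dbl_d[OF d P ddP] that unfolding M_def by blast
  have sM: "s x \<in> M" if "x \<in> M" for x
    using dbl_commuting[OF d s sd sP] that unfolding M_def by blast
  have lM: "l x \<in> M" if "x \<in> M" for x
  proof -
    have "l x = (1/2) *s (s x + d x)" by (simp add: sl)
    then show ?thesis using subspace_scale[OF M] subspace_add[OF M] dM sM that by metis
  qed
  \<comment> \<open>Since 2 \<open>l\<close> = \<open>s\<close> + \<open>d\<close>, both sums are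
    stable under all three operators, and both contain \<open>G\<close>; so each contains the orbit
    generating the other.\<close>
  have MN: "M = dbl d N"
  proof
    have N': "subspace (dbl d N)" by (rule dbl_subspace[OF d N])
    have dN': "d x \<in> dbl d N" if "x \<in> dbl d N" for x by (rule dbl_d[OF d N ddN that])
    have lN': "l x \<in> dbl d N" if "x \<in> dbl d N" for x by (rule dbl_commuting[OF d l ld lN that])
    have sN': "s x \<in> dbl d N" if "x \<in> dbl d N" for x
    proof -
      have "s x = 2 *s l x - d x" using sl[of x] by (simp add: algebra_simps)
      then show ?thesis using subspace_scale[OF N'] subspace_diff[OF N'] dN' lN' that by metis
    qed
    have GN: "G \<subseteq> dbl d N" using dbl_base[OF d N] orb_base unfolding N_def by blast
    have PN: "P \<subseteq> dbl d N" unfolding P_def by (rule orb_least[OF N' GN sN'])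
    show "M \<subseteq> dbl d N"
    proof
      fix x assume "x \<in> M"
      then obtain u v where "x = u + d v" "u \<in> P" "v \<in> P" unfolding M_def by (rule dbl_E)
      then show "x \<in> dbl d N" using PN dN' subspace_add[OF N'] by blast
    qed
    have GM: "G \<subseteq> M" using dbl_base[OF d P] orb_base unfolding M_def P_def by blast
    have NM: "N \<subseteq> M" unfolding N_def by (rule orb_least[OF M GM lM])
    show "dbl d N \<subseteq> M"
    proof
      fix x assume "x \<in> dbl d N"
      then obtain u v where "x = u + d v" "u \<in> N" "v \<in> N" by (rule dbl_E)
      then show "x \<in> M" using NM dM subspace_add[OF M] by blast
    qed
  qed
  have PM0: "P \<subseteq> M0"
    unfolding P_def by (rule orb_least[OF fin_span_subspace[OF M0(1)] M0(2,3)])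
  have "M \<subseteq> M0"
  proof
    fix x assume "x \<in> M"
    then obtain u v where "x = u + d v" "u \<in> P" "v \<in> P" unfolding M_def by (rule dbl_E)
    then show "x \<in> M0" using PM0 M0(4) subspace_add[OF fin_span_subspace[OF M0(1)]] by blast
  qed
  then have fM: "fin_span M" using fin_span_subset[OF M _ M0(1)] by blast
  have PM: "P \<subseteq> M" "N \<subseteq> M" using dbl_base[OF d P] dbl_base[OF d N] MN M_def by blast+
  have fP: "fin_span P" and fN: "fin_span N" by (rule fin_span_subset[OF _ _ fM]; fact)+
  have surj: "\<exists>y\<in>M. x = d y" if x: "x \<in> M" for x
  proof -
    obtain u v where uv: "x = u + d v" "u \<in> P" "v \<in> P" using x unfolding M_def by (rule dbl_E)
    obtain w where w: "w \<in> P" "u = d (d w)" using ddP'[OF uv(2)] by blast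
    have "x = d (v + d w)" by (simp add: uv w lin_add[OF d])
    then show ?thesis using dbl_I[OF uv(3) w(1), of d] unfolding M_def by blast
  qed
  have surj_pow: "\<exists>y\<in>M. x = (d ^^ k) y" if "x \<in> M" for x k
    using that
  proof (induction k arbitrary: x)
    case (Suc k)
    then show ?case using surj by (metis comp_apply funpow.simps(2))
  qed auto
  \<comment> \<open>As \<open>d\<close> is onto \<open>M\<close>, a Fitting polynomial of the form X
    h fixes all of \<open>M\<close>; applied to a vector of the kernel it gives 0.\<close>
  have inj0: "x = 0" if x: "x \<in> M" "d x = 0" for x
  proof -
    obtain k h where h: "\<And>x. x \<in> (d ^^ k) ` M \<Longrightarrow> opoly ([:0, 1:] * h) d x = x"
      using fitting[OF fM d dM] by blast
    have "x = opoly ([:0, 1:] * h) d x" using h surj_pow[OF x(1), of k] by force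
    also have "\<dots> = d (opoly h d x)" using opoly_mult[OF d] opoly_X[OF d] by metis
    also have "\<dots> = opoly h d (d x)" by (rule opoly_commute[OF d d refl])
    also have "\<dots> = 0" using x(2) lin_0[OF opoly_lin[OF d]] by simp
    finally show ?thesis .
  qed
  have inj: "inj_on d S" if "S \<subseteq> M" for S
  proof (rule inj_onI)
    fix x y assume "x \<in> S" "y \<in> S" "d x = d y"
    then have "x - y = 0" using inj0[of "x - y"] subspace_diff[OF M] that lin_diff[OF d] by auto
    then show "x = y" by simp
  qed
  obtain B where B: "finite B" "independent B" "span B = P" using fP by (auto simp: fin_span_def)
  obtain C where C: "finite C" "independent C" "span C = N" using fN by (auto simp: fin_span_def)
  have dB: "independent (d ` B)" "card (d ` B) = card B" "finite (d ` B)"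
    using lin_independent_image[OF d B(2)] inj[of "span B"] PM B card_image[of d B]
      inj[of B] span_superset[of B] by auto
  have dC: "independent (d ` C)" "card (d ` C) = card C" "finite (d ` C)"
    using lin_independent_image[OF d C(2)] inj[of "span C"] PM C card_image[of d C]
      inj[of C] span_superset[of C] by auto
  have spB: "span (B \<union> d ` B) = M" using dbl_span[OF d B(3)] by (simp add: M_def)
  have spC: "span (C \<union> d ` C) = M" using dbl_span[OF d C(3)] by (simp add: MN)
  have BC: "independent (B \<union> d ` C)" "B \<inter> d ` C = {}"
    using independent_Un[OF B(1,2) dC(3,1)] disj lin_image_span[OF d, of C] B C
    by (auto simp: P_def N_def)
  have cBC: "card (B \<union> d ` C) = card B + card C"
    using card_Un_disjoint[OF B(1) dC(3) BC(2)] dC by simp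
  have subBC: "B \<union> d ` C \<subseteq> M"
    using B C PM dM span_superset by blast
  have "card (B \<union> d ` C) \<le> card (B \<union> d ` B)"
    using independent_span_bound[OF _ BC(1), of "B \<union> d ` B"] subBC spB B(1) by simp
  moreover have "card (B \<union> d ` C) \<le> card (C \<union> d ` C)"
    using independent_span_bound[OF _ BC(1), of "C \<union> d ` C"] subBC spC C(1) by simp
  moreover have leB: "card (B \<union> d ` B) \<le> card B + card B" and leC: "card (C \<union> d ` C) \<le> card C + card C"
    using card_Un_le[of B "d ` B"] card_Un_le[of C "d ` C"] dB dC by simp_all
  ultimately have cc: "card B = card C" using cBC by linarith
  have iB: "independent (B \<union> d ` B)" "card (B \<union> d ` B) = card (B \<union> d ` C)"
    using independent_of_card[OF _ BC(1), of "B \<union> d ` B"] subBC spB B(1) cBC cc leB by simp_all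
  have iC: "independent (C \<union> d ` C)" "card (C \<union> d ` C) = card (B \<union> d ` C)"
    using independent_of_card[OF _ BC(1), of "C \<union> d ` C"] subBC spC C(1) cBC cc leC by simp_all
  have jB: "B \<inter> d ` B = {}"
    using card_Un_Int[OF B(1) dB(3)] iB(2) cBC cc dB(2,3) B(1) by simp
  have jC: "C \<inter> d ` C = {}"
    using card_Un_Int[OF C(1) dC(3)] iC(2) cBC cc dC(2,3) C(1) by simp
  have lin_pow: "lin (d ^^ n)" for n by (rule lin_funpow[OF d])
  have even: "(d ^^ (2 * j)) x \<in> Q" if "\<And>x. x \<in> Q \<Longrightarrow> d (d x) \<in> Q" "x \<in> Q" for j x Q
    using that by (induction j) (simp_all)
  have odd_zero: "trace_on M (\<lambda>x. f ((d ^^ Suc (2 * j)) x)) = 0"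
    if f: "lin f" "\<And>x. f (d x) = d (f x)" "\<And>x. x \<in> Q \<Longrightarrow> f x \<in> Q"
      and Q: "\<And>x. x \<in> Q \<Longrightarrow> d (d x) \<in> Q" "span D = Q" "finite D" "independent (D \<union> d ` D)"
        "D \<inter> d ` D = {}" "span (D \<union> d ` D) = M" for f Q D j
  proof -
    have lf: "lin (\<lambda>x. f ((d ^^ Suc (2 * j)) x))"
      using lin_comp[OF f(1) lin_pow[of "Suc (2 * j)"]] by (simp add: comp_def)
    have spd: "span (d ` D) = d ` Q" using lin_image_span[OF d] Q(2) by simp
    have "trace_on (span (D \<union> d ` D)) (\<lambda>x. f ((d ^^ Suc (2 * j)) x)) = 0"
    proof (rule trace_on_swap[OF Q(3) _ Q(4,5) lf])
      fix x assume "x \<in> D"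
      then have "x \<in> Q" using Q(2) span_base by blast
      then have "f ((d ^^ (2 * j)) x) \<in> Q" by (intro f(3) even Q(1))
      then have "d (f ((d ^^ (2 * j)) x)) \<in> span (d ` D)" unfolding spd by (rule imageI)
      then show "f ((d ^^ Suc (2 * j)) x) \<in> span (d ` D)" using f(2) by simp
    next
      fix x assume "x \<in> d ` D"
      then obtain y where y: "y \<in> D" "x = d y" by blast
      then have "y \<in> Q" using Q(2) span_base by blast
      then have "f ((d ^^ (2 * Suc j)) y) \<in> Q" by (intro f(3) even Q(1))
      moreover have "(d ^^ Suc (2 * j)) x = (d ^^ (2 * Suc j)) y"
        unfolding y by (simp add: funpow_swap1)
      ultimately show "f ((d ^^ Suc (2 * j)) x) \<in> span D" using Q(2) by simp
    qed (use Q in simp)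
    then show ?thesis using Q(6) by simp
  qed
  have t1: "trace_on M (\<lambda>x. s ((d ^^ Suc (2 * j)) x)) = 0" for j
    by (rule odd_zero[OF s sd sP ddP B(3,1) iB(1) jB spB])
  have t2: "trace_on M (\<lambda>x. l ((d ^^ Suc (2 * j)) x)) = 0" for j
    by (rule odd_zero[OF l ld lN ddN C(3,1) iC(1) jC spC])
  have t3: "trace_on M (d ^^ (2 * Suc j)) = 0" for j
  proof -
    let ?g = "\<lambda>x. (d ^^ Suc (2 * j)) x"
    have gM: "?g x \<in> M" if "x \<in> M" for x using funpow_image[of M d] dM that by blast
    have ls: "lin (\<lambda>x. s (?g x))" and ll: "lin (\<lambda>x. l (?g x))"
      using lin_comp[OF s lin_pow[of "Suc (2 * j)"]] lin_comp[OF l lin_pow[of "Suc (2 * j)"]]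
      by (simp_all add: comp_def)
    have "d ^^ (2 * Suc j) = (\<lambda>x. 2 *s l (?g x) - s (?g x))"
    proof
      fix x
      have "2 *s l (?g x) - s (?g x) = d (?g x)" using sl[of "?g x"] by (simp add: algebra_simps)
      then show "(d ^^ (2 * Suc j)) x = 2 *s l (?g x) - s (?g x)" by simp
    qed
    then have "trace_on M (d ^^ (2 * Suc j)) = trace_on M (\<lambda>x. 2 *s l (?g x) - s (?g x))" by (simp only:)
    also have "\<dots> = trace_on M (\<lambda>x. 2 *s l (?g x)) - trace_on M (\<lambda>x. s (?g x))"
      by (rule trace_on_diff[OF fM lin_scale_fun[OF ll] _ ls]) (use gM lM sM subspace_scale[OF M] in blast)+
    also have "trace_on M (\<lambda>x. 2 *s l (?g x)) = 2 * trace_on M (\<lambda>x. l (?g x))"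
      by (rule trace_on_scale[OF fM ll]) (use gM lM in blast)
    finally show ?thesis by (simp only: t1 t2) simp
  qed
  have "\<exists>n. \<forall>x\<in>M. ((\<lambda>x. d (d x)) ^^ n) x = 0"
  proof (rule nilpotent_of_traces[OF fM dd])
    fix k :: nat assume "1 \<le> k"
    then obtain j where j: "k = Suc j" by (cases k) auto
    have "((\<lambda>x. d (d x)) ^^ n) = d ^^ (2 * n)" for n by (induction n) (auto simp: fun_eq_iff)
    then show "trace_on M ((\<lambda>x. d (d x)) ^^ k) = 0" using t3[of j] j by simp
  qed (use dM in blast)
  then obtain n where n: "\<And>x. x \<in> M \<Longrightarrow> ((\<lambda>x. d (d x)) ^^ n) x = 0" by blast
  have "x = 0" if "x \<in> M" "((\<lambda>x. d (d x)) ^^ m) x = 0" for x m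
    using that
  proof (induction m)
    case (Suc m)
    let ?y = "((\<lambda>x. d (d x)) ^^ m) x"
    have "?y \<in> M" using funpow_image[of M "\<lambda>x. d (d x)" x m] dM Suc.prems by blast
    then have "?y = 0" using inj0[of ?y] inj0[of "d ?y"] dM Suc.prems by simp
    then show ?case using Suc by blast
  qed simp
  then have "x = 0" if "x \<in> M" for x using n that by blast
  moreover have "G \<subseteq> M" using PM orb_base unfolding P_def by blast
  ultimately show ?thesis by blast
qed

end

section \<open>The operator algebra and the inner action of a letter\<close>

context fd_algebra
begin

lemma fin_End: "E.fin_span {f. lin f}"
proof -
  obtain B where B: "finite B" "independent B" "span B = UNIV" using fin_UNIV by (auto simp: fin_span_def)
  let ?u = "\<lambda>b c x. representation B x b *s c"
  let ?T = "(\<lambda>(b, c). ?u b c) ` (B \<times> B)"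
  have expand: "x = (\<Sum>b\<in>B. representation B x b *s b)" for x
    by (rule sum_representation_eq[OF B(2) _ B(1) order_refl, symmetric]) (simp add: B)
  show ?thesis
  proof (rule E.fin_span_sub[of _ ?T])
    show "E.subspace {f. lin f}"
    proof (rule E.subspaceI)
      show "0 \<in> {f. lin f}" by (auto intro!: linI)
      show "x + y \<in> {f. lin f}" if "x \<in> {f. lin f}" "y \<in> {f. lin f}" for x y
        using lin_add_fun[of x y] that by (simp add: plus_fun_def)
      show "scale_fun scale c x \<in> {f. lin f}" if "x \<in> {f. lin f}" for c x
        using lin_scale_fun[of x c] that by (simp add: scale_fun_def)
    qed
    show "{f. lin f} \<subseteq> E.span ?T"
    proof
      fix f assume "f \<in> {f. lin f}"
      then have f: "lin f" by simp
      have eq: "f x = (\<Sum>b\<in>B. \<Sum>c\<in>B. representation B (f b) c *s (representation B x b *s c))" for x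
      proof -
        have "f x = f (\<Sum>b\<in>B. representation B x b *s b)" by (rule arg_cong[of _ _ f]) (rule expand)
        also have "\<dots> = (\<Sum>b\<in>B. representation B x b *s f b)" by (simp add: lin_sum[OF f] lin_scale[OF f])
        also have "\<dots> = (\<Sum>b\<in>B. representation B x b *s (\<Sum>c\<in>B. representation B (f b) c *s c))"
          by (intro sum.cong refl arg_cong[of _ _ "scale _"]) (rule expand)
        finally show ?thesis by (simp add: scale_sum_right mult.commute)
      qed
      have "f = (\<Sum>b\<in>B. \<Sum>c\<in>B. scale_fun scale (representation B (f b) c) (?u b c))"
        by (rule ext) (unfold sum_fun_apply scale_fun_apply, rule eq)
      moreover have "\<dots> \<in> E.span ?T"
      proof (intro E.span_sum E.span_scale E.span_base)
        fix b c assume "b \<in> B" "c \<in> B"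
        then have "(b, c) \<in> B \<times> B" by simp
        then show "?u b c \<in> ?T" by (rule image_eqI[rotated]) simp
      qed
      ultimately show "f \<in> E.span ?T" by simp
    qed
  qed (use B in simp)
qed

definition adj :: "'b \<Rightarrow> ('b \<Rightarrow> 'b) \<Rightarrow> 'b \<Rightarrow> 'b" where
  "adj a Y = (L a \<circ> Y) - (Y \<circ> L a)"

lemma adj_apply: "adj a Y x = a \<cdot> Y x - Y (a \<cdot> x)"
  by (simp add: adj_def)

end

context comm_alt_algebra
begin

lemma fin_V: "fin_span V"
  by (rule fin_span_subset[OF V_subspace subset_UNIV fin_UNIV])

lemma adj_adj:
  assumes "a \<in> V" "b \<in> V"
  shows "adj a (adj a (L b)) = L (- triple_comm a b a)"
  using L_triple[OF assms assms(1)]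
  by (simp add: fun_eq_iff adj_apply mult_simps) (simp add: triple_comm_def mult_simps)

text \<open>On \<open>L V\<close> the square of \<open>adj a\<close> is induced by the map
  \<open>?T\<close>. The claim reduces to the vanishing of the Fitting component of
  \<open>?T\<close> on which it is invertible, to which \<open>orb_collapse\<close> is
  applied.\<close>

lemma adj_nilpotent:
  assumes a: "a \<in> V"
  obtains n where "\<And>b. b \<in> V \<Longrightarrow> (adj a ^^ n) (L b) = 0"
proof -
  let ?T = "\<lambda>b. - triple_comm a b a"
  let ?s = "\<lambda>Y. (L a \<circ> Y) + (Y \<circ> L a)" and ?l = "\<lambda>Y. L a \<circ> Y"
  have T: "lin ?T" by (rule linI) (simp_all add: triple_comm_def mult_simps scale_right_diff_distrib)
  have TV: "?T b \<in> V" if "b \<in> V" for b using subspace_neg[OF V_subspace] V_triple a that by blast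
  obtain k h where h: "\<And>x. x \<in> (?T ^^ k) ` V \<Longrightarrow> opoly ([:0, 1:] * h) ?T x = x"
    using fitting[OF fin_V T TV] by blast
  define V1 where "V1 = (?T ^^ k) ` V"
  have V1V: "V1 \<subseteq> V" unfolding V1_def using funpow_image[of V ?T] TV by auto
  have sV1: "subspace V1" unfolding V1_def by (rule lin_subspace_image[OF lin_funpow[OF T] V_subspace])
  have TV1: "?T b \<in> V1" if b: "b \<in> V1" for b
  proof -
    obtain c where "c \<in> V" "b = (?T ^^ k) c" using b unfolding V1_def by blast
    then have "?T b = (?T ^^ k) (?T c)" "?T c \<in> V" using funpow_swap1[of ?T k c] TV by simp_all
    then show ?thesis unfolding V1_def by blast
  qed
  have TV1': "\<exists>c\<in>V1. b = ?T c" if b: "b \<in> V1" for b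
  proof -
    have "b = opoly ([:0, 1:] * h) ?T b" using h b unfolding V1_def by metis
    also have "\<dots> = ?T (opoly h ?T b)" using opoly_mult[OF T] opoly_X[OF T] by metis
    finally show ?thesis using opoly_mem[OF T sV1 TV1 b] by blast
  qed
  have lin_s: "E.lin ?s" and lin_d: "E.lin (adj a)" and lin_l: "E.lin ?l"
    by (rule E.linI; simp add: fun_eq_iff mult_simps adj_apply scale_right_distrib scale_right_diff_distrib)+
  have "L ` V1 \<subseteq> {0}"
  proof (rule E.orb_collapse[OF lin_s lin_d lin_l _ _ _ fin_End])
    show "?s (adj a Y) = adj a (?s Y)" "?l (adj a Y) = adj a (?l Y)" for Y
      by (simp_all add: fun_eq_iff mult_simps adj_apply)
    show "?s Y + adj a Y = scale_fun scale 2 (?l Y)" for Y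
      by (simp add: fun_eq_iff adj_apply double[symmetric])
    show "L ` V1 \<subseteq> {f. lin f}" using lin_L by blast
    show "?s Y \<in> {f. lin f}" "adj a Y \<in> {f. lin f}" if "Y \<in> {f. lin f}" for Y
    proof -
      have "lin (L a \<circ> Y)" "lin (Y \<circ> L a)" using that lin_L lin_comp by blast+
      then show "?s Y \<in> {f. lin f}" "adj a Y \<in> {f. lin f}"
        using lin_add_fun[of "L a \<circ> Y" "Y \<circ> L a"] lin_diff_fun[of "L a \<circ> Y" "Y \<circ> L a"]
        by (simp_all add: plus_fun_def fun_diff_def adj_def)
    qed
    show "adj a (adj a g) \<in> L ` V1" if "g \<in> L ` V1" for g
      using that adj_adj[OF a] V1V TV1 by blast
    show "\<exists>h\<in>L ` V1. g = adj a (adj a h)" if g: "g \<in> L ` V1" for g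
    proof -
      obtain b where b: "b \<in> V1" "g = L b" using g by blast
      obtain c where c: "c \<in> V1" "b = ?T c" using TV1'[OF b(1)] by blast
      have "g = adj a (adj a (L c))" unfolding adj_adj[OF a subsetD[OF V1V c(1)]] b c(2) ..
      then show ?thesis using c(1) by blast
    qed
    have sub1: "E.subspace (range L)"
    proof (rule E.subspaceI)
      show "0 \<in> range L" by (rule image_eqI[of _ _ 0]) (simp_all only: L_lin_simps UNIV_I)
      show "scale_fun scale c Y \<in> range L" if "Y \<in> range L" for c Y
        using that by (auto simp only: L_lin_simps(3)[symmetric])
      show "Y + Y' \<in> range L" if "Y \<in> range L" "Y' \<in> range L" for Y Y'
        using that by (auto simp only: L_lin_simps(1)[symmetric])
    qed
    \<comment> \<open>By \<open>V_alt\<close>, \<open>?s\<close> maps \<open>L x\<close> to L(a x +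
      x a).\<close>
    have ev: "E.orb ?s (L ` V1) \<subseteq> range L"
    proof (rule E.orb_least[OF sub1])
      fix Y assume "Y \<in> range L"
      then obtain x where x: "Y = L x" by blast
      have "?s Y = L (a \<cdot> x + x \<cdot> a)"
        by (rule ext) (simp only: V_alt[OF a] x plus_fun_apply comp_apply)
      then show "?s Y \<in> range L" by blast
    qed blast
    have sub2: "E.subspace {Y. adj a Y e = 0}"
      by (rule E.subspaceI) (simp_all add: adj_apply mult_simps scale_right_diff_distrib[symmetric] algebra_simps)
    \<comment> \<open>Here commutativity enters: \<open>adj a (L b) e\<close> = ab - ba = 0 for a
      letter \<open>b\<close>, and multiplying an operator by \<open>L a\<close> from the left
      multiplies this value by \<open>a\<close>.\<close>
    have ev2: "E.orb ?l (L ` V1) \<subseteq> {Y. adj a Y e = 0}"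
    proof (rule E.orb_least[OF sub2])
      show "L ` V1 \<subseteq> {Y. adj a Y e = 0}" using V_comm[OF a] V1V by (auto simp: adj_apply)
      fix Y assume "Y \<in> {Y. adj a Y e = 0}"
      then show "?l Y \<in> {Y. adj a Y e = 0}" by (simp add: adj_apply mult_simps)
    qed
    show "E.orb ?s (L ` V1) \<inter> adj a ` E.orb ?l (L ` V1) \<subseteq> {0}"
    proof
      fix Y assume Y: "Y \<in> E.orb ?s (L ` V1) \<inter> adj a ` E.orb ?l (L ` V1)"
      then have "Y e = 0" using ev2 by auto
      moreover obtain x where "Y = L x" using Y ev by blast
      ultimately show "Y \<in> {0}" using L_lin_simps(4) by simp
    qed
  qed
  then have "b = 0" if "b \<in> V1" for b using that L_inj[of b 0] L_lin_simps(4) by auto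
  then have Tk: "(?T ^^ k) b = 0" if "b \<in> V" for b using that unfolding V1_def by blast
  have pow: "(adj a ^^ (2 * i)) (L b) = L ((?T ^^ i) b) \<and> (?T ^^ i) b \<in> V" if b: "b \<in> V" for b i
    by (induction i) (use b adj_adj[OF a] TV in auto)
  show ?thesis
  \<comment> \<open>The factor 2 appears because \<open>?T\<close> represents the square of
    \<open>adj a\<close>.\<close>
  proof (rule that[of "2 * k"])
    fix b assume "b \<in> V"
    then show "(adj a ^^ (2 * k)) (L b) = 0" using pow[of b k] Tk L_lin_simps(4) by simp
  qed
qed

end

section \<open>Eigenvalues in the algebraic closure\<close>

lemma lin_space_mult: "lin_space_0 ((*) :: 'k::field_char_0 \<Rightarrow> 'k \<Rightarrow> 'k)"
  by unfold_locales (simp_all add: algebra_simps)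

text \<open>Used twice for a field regarded as a vector space over a smaller one: over the rationals
  in Cartan's argument, and over the base field to descend from the closure.\<close>

lemma ex_linear_functional:
  fixes s :: "'k::field \<Rightarrow> 'v::ab_group_add \<Rightarrow> 'v"
  assumes "vector_space s" "v \<noteq> 0"
  obtains \<psi> where "\<And>x y. \<psi> (x + y) = \<psi> x + \<psi> y" "\<And>c x. \<psi> (s c x) = c * \<psi> x" "\<psi> v = 1"
proof -
  interpret vs1: vector_space s by fact
  interpret vs2: vector_space "(*) :: 'k \<Rightarrow> 'k \<Rightarrow> 'k"
    by unfold_locales (simp_all add: algebra_simps)
  interpret vector_space_pair s "(*) :: 'k \<Rightarrow> 'k \<Rightarrow> 'k" by unfold_locales
  have "vs1.independent {v}" using assms(2) by simp
  then obtain \<psi> where "Vector_Spaces.linear s (*) \<psi>" "\<forall>x\<in>{v}. \<psi> x = 1"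
    using linear_independent_extend[of "{v}" "\<lambda>_. 1"] by blast
  then show ?thesis using that[of \<psi>] by (simp add: Vector_Spaces.linear_iff)
qed

section \<open>Splitting polynomials over an algebraically closed field\<close>

lemma prod_mset_dvd_power:
  fixes f :: "'a \<Rightarrow> 'b::comm_semiring_1"
  shows "(\<Prod>x\<in>#A. f x) dvd (\<Prod>x\<in>set_mset A. f x) ^ size A"
proof (induction A)
  case (add a A)
  have 1: "f a dvd (\<Prod>x\<in>set_mset (add_mset a A). f x)" by (rule dvd_prodI) auto
  have "(\<Prod>x\<in>set_mset A. f x) dvd (\<Prod>x\<in>set_mset (add_mset a A). f x)"
    by (rule prod_dvd_prod_subset) auto
  then have "(\<Prod>x\<in>#A. f x) dvd (\<Prod>x\<in>set_mset (add_mset a A). f x) ^ size A"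
    using add dvd_power_same dvd_trans by blast
  then show ?case using mult_dvd_mono[OF 1] by simp
qed simp

lemma prod_mset_distinct:
  assumes "\<And>x. count A x \<le> 1"
  shows "(\<Prod>x\<in>#A. f x) = (\<Prod>x\<in>set_mset A. f x)"
  using assms
proof (induction A)
  case (add a A)
  have "a \<notin># A" using add(2)[of a] by (simp add: not_in_iff)
  moreover have "count A x \<le> 1" for x using add(2)[of x] by (simp split: if_splits)
  ultimately show ?case using add(1) by simp
qed simp

lemma split_power:
  fixes p :: "'k::alg_closed_field poly"
  assumes "p \<noteq> 0"
  obtains A n where "finite A" "p dvd (\<Prod>a\<in>A. [:- a, 1:] ^ n)"
proof -
  obtain A where A: "p = smult (lead_coeff p) (\<Prod>x\<in>#A. [:- x, 1:])"
    using alg_closed_imp_factorization[OF assms] by blast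
  have "p dvd (\<Prod>x\<in>#A. [:- x, 1:])"
    by (subst A) (use assms in \<open>simp add: smult_dvd_iff\<close>)
  also have "\<dots> dvd (\<Prod>x\<in>set_mset A. [:- x, 1:]) ^ size A" by (rule prod_mset_dvd_power)
  finally show ?thesis using that[of "set_mset A" "size A"] by (simp add: prod_power_distrib)
qed

lemma split_separable:
  fixes p :: "'k::alg_closed_field poly"
  assumes "p \<noteq> 0" "comaximal p (pderiv p)"
  obtains A where "finite A" "p dvd (\<Prod>a\<in>A. [:- a, 1:])"
proof -
  obtain A where A: "p = smult (lead_coeff p) (\<Prod>x\<in>#A. [:- x, 1:])"
    using alg_closed_imp_factorization[OF assms(1)] by blast
  have "count A x \<le> 1" for x
  proof (rule ccontr)
    assume "\<not> count A x \<le> 1"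
    then have "x \<in># A" using not_in_iff[of x A] by linarith
    then obtain C where C: "A = add_mset x C" by (auto dest: multi_member_split)
    then have "x \<in># C" using \<open>\<not> count A x \<le> 1\<close> not_in_iff[of x C] by auto
    then obtain B where "A = add_mset x (add_mset x B)" using C by (auto dest: multi_member_split)
    then have "p = [:- x, 1:] * ([:- x, 1:] * smult (lead_coeff p) (\<Prod>x\<in>#B. [:- x, 1:]))"
      by (subst A) (simp add: mult_smult_right)
    then obtain q where q: "p = [:- x, 1:] * ([:- x, 1:] * q)" by blast
    have "[:- x, 1:] dvd p" by (subst q) (rule dvd_triv_left)
    moreover have "[:- x, 1:] dvd pderiv p"
      by (subst q, subst pderiv_mult) (intro dvd_add dvd_triv_left dvd_mult2)
    moreover obtain r s where "r * p + s * pderiv p = 1" using assms(2) unfolding comaximal_def by blast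
    ultimately have "[:- x, 1:] dvd 1" by (metis dvd_add dvd_mult)
    then show False by (simp add: is_unit_pCons_iff)
  qed
  then have "(\<Prod>x\<in>#A. [:- x, 1:]) = (\<Prod>x\<in>set_mset A. [:- x, 1:])" by (rule prod_mset_distinct)
  moreover have "p dvd (\<Prod>x\<in>#A. [:- x, 1:])"
    by (subst A) (use assms in \<open>simp add: smult_dvd_iff\<close>)
  ultimately show ?thesis using that[of "set_mset A"] by simp
qed

section \<open>Primary decomposition for commuting operators\<close>

context lin_space
begin

text \<open>The Chinese remainder theorem for the indicator functions of the points of
  \<open>A\<close>: evaluated at an operator killed by the product, the \<open>P a\<close> project
  onto the generalised eigenspaces.\<close>

lemma primary_projections:
  assumes A: "finite A"
  obtains P where "(\<Prod>a\<in>A. [:- a, 1:] ^ n) dvd 1 - (\<Sum>a\<in>A. P a)"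
    "\<And>a. a \<in> A \<Longrightarrow> (\<Prod>a\<in>A. [:- a, 1:] ^ n) dvd [:- a, 1:] ^ n * (P a :: 'a poly)"
    "\<And>a b. a \<in> A \<Longrightarrow> b \<in> A \<Longrightarrow> [:- b, 1:] ^ n dvd P a - [:if a = b then 1 else 0:]"
proof -
  have "\<forall>a. \<exists>g. \<forall>b\<in>A. [:- b, 1:] ^ n dvd g - [:if a = b then 1 else 0:]"
    by (rule allI) (rule poly_crt[OF A])
  then obtain P :: "'a \<Rightarrow> 'a poly" where
    P: "\<And>a b. b \<in> A \<Longrightarrow> [:- b, 1:] ^ n dvd P a - [:if a = b then 1 else 0:]" by metis
  have dvdI: "(\<Prod>a\<in>A. [:- a, 1:] ^ n) dvd f" if "\<And>a. a \<in> A \<Longrightarrow> [:- a, 1:] ^ n dvd f" for f :: "'a poly"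
    by (rule prod_dvd_of_comaximal[OF A _ that]) (auto intro!: comaximal_power comaximal_linear)
  show ?thesis
  proof (rule that[of P])
    show "(\<Prod>a\<in>A. [:- a, 1:] ^ n) dvd 1 - (\<Sum>a\<in>A. P a)"
    proof (rule dvdI)
      fix b assume b: "b \<in> A"
      have "[:- b, 1:] ^ n dvd (\<Sum>a\<in>A. P a - [:if a = b then 1 else 0:])"
        by (rule dvd_sum) (rule P[OF b])
      also have "(\<Sum>a\<in>A. P a - [:if a = b then 1 else 0:]) = (\<Sum>a\<in>A. P a) - 1"
      proof -
        have "(\<Sum>a\<in>A. [:if a = b then 1 else (0::'a):]) = (\<Sum>a\<in>A. if a = b then 1 else 0)"
          by (rule sum.cong) (auto simp: one_pCons)
        also have "\<dots> = 1" using A b by simp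
        finally show ?thesis by (simp add: sum_subtractf)
      qed
      finally show "[:- b, 1:] ^ n dvd 1 - (\<Sum>a\<in>A. P a)" by (metis dvd_minus_iff minus_diff_eq)
    qed
    show "(\<Prod>a\<in>A. [:- a, 1:] ^ n) dvd [:- a, 1:] ^ n * P a" if a: "a \<in> A" for a
    proof (rule dvdI)
      fix b assume b: "b \<in> A"
      show "[:- b, 1:] ^ n dvd [:- a, 1:] ^ n * P a"
        using P[OF b, of a] by (cases "a = b") auto
    qed
  qed (rule P)
qed

text \<open>Stated for a single vector, because on the full function spaces used later an
  annihilating polynomial is known only for the functionals and forms at hand.\<close>

lemma joint_primary:
  assumes f: "lin f" and g: "lin g" and fg: "\<And>x. f (g x) = g (f x)"
    and A: "finite A" "opoly (\<Prod>a\<in>A. [:- a, 1:] ^ n) f w = 0"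
    and B: "finite B" "opoly (\<Prod>b\<in>B. [:- b, 1:] ^ n) g w = 0"
  obtains P Q where "w = (\<Sum>a\<in>A. \<Sum>b\<in>B. opoly (P a) f (opoly (Q b) g w))"
    "\<And>a b. a \<in> A \<Longrightarrow> opoly ([:- a, 1:] ^ n) f (opoly (P a) f (opoly (Q b) g w)) = 0"
    "\<And>a b. b \<in> B \<Longrightarrow> opoly ([:- b, 1:] ^ n) g (opoly (P a) f (opoly (Q b) g w)) = 0"
proof -
  obtain P where P: "(\<Prod>a\<in>A. [:- a, 1:] ^ n) dvd 1 - (\<Sum>a\<in>A. P a)"
    "\<And>a. a \<in> A \<Longrightarrow> (\<Prod>a\<in>A. [:- a, 1:] ^ n) dvd [:- a, 1:] ^ n * P a"
    by (rule primary_projections[OF A(1), of n]) (rule that)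
  obtain Q where Q: "(\<Prod>b\<in>B. [:- b, 1:] ^ n) dvd 1 - (\<Sum>b\<in>B. Q b)"
    "\<And>b. b \<in> B \<Longrightarrow> (\<Prod>b\<in>B. [:- b, 1:] ^ n) dvd [:- b, 1:] ^ n * Q b"
    by (rule primary_projections[OF B(1), of n]) (rule that)
  have comm1: "g (opoly p f x) = opoly p f (g x)" for p x by (rule opoly_commute[OF f g]) (simp add: fg)
  have comm: "opoly q g (opoly p f x) = opoly p f (opoly q g x)" for p q x
    by (rule opoly_commute[OF f opoly_lin[OF g]]) (rule opoly_commute[OF g f fg, symmetric])
  have sumf: "(\<Sum>a\<in>A. opoly (P a) f x) = x" if "opoly (\<Prod>a\<in>A. [:- a, 1:] ^ n) f x = 0" for x
    using opoly_dvd_0[OF f P(1) that] by (simp add: opoly_diff[OF f] opoly_1[OF f] opoly_sum[OF f])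
  have sumg: "(\<Sum>b\<in>B. opoly (Q b) g w) = w"
    using opoly_dvd_0[OF g Q(1) B(2)] by (simp add: opoly_diff[OF g] opoly_1[OF g] opoly_sum[OF g])
  have kf: "opoly (\<Prod>a\<in>A. [:- a, 1:] ^ n) f (opoly q g w) = 0" for q
    using comm[of q "\<Prod>a\<in>A. [:- a, 1:] ^ n" w] A(2) lin_0[OF opoly_lin[OF g]] by simp
  show ?thesis
  proof (rule that[of P Q])
    have "(\<Sum>a\<in>A. \<Sum>b\<in>B. opoly (P a) f (opoly (Q b) g w)) = (\<Sum>b\<in>B. \<Sum>a\<in>A. opoly (P a) f (opoly (Q b) g w))"
      by (rule sum.swap)
    also have "\<dots> = w" by (simp only: sumf[OF kf] sumg)
    finally show "w = (\<Sum>a\<in>A. \<Sum>b\<in>B. opoly (P a) f (opoly (Q b) g w))" by simp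
    show "opoly ([:- a, 1:] ^ n) f (opoly (P a) f (opoly (Q b) g w)) = 0" if "a \<in> A" for a b
      using opoly_dvd_0[OF f P(2)[OF that] kf] by (simp add: opoly_mult[OF f])
    show "opoly ([:- b, 1:] ^ n) g (opoly (P a) f (opoly (Q b) g w)) = 0" if "b \<in> B" for a b
    proof -
      have "opoly ([:- b, 1:] ^ n) g (opoly (Q b) g w) = 0"
        using opoly_dvd_0[OF g Q(2)[OF that] B(2)] by (simp add: opoly_mult[OF g])
      then show ?thesis using comm lin_0[OF opoly_lin[OF f]] by simp
    qed
  qed
qed

lemma nilpotent_add:
  assumes f: "lin f" and g: "lin g" and fg: "\<And>x. f (g x) = g (f x)"
  shows "(f ^^ i) x = 0 \<Longrightarrow> (g ^^ j) x = 0 \<Longrightarrow> ((\<lambda>x. f x + g x) ^^ (i + j)) x = 0"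
proof (induction "i + j" arbitrary: i j x)
  case 0
  then show ?case by simp
next
  case (Suc m)
  have l: "lin (\<lambda>x. f x + g x)" by (rule lin_add_fun[OF f g])
  let ?h = "\<lambda>x. f x + g x"
  show ?case
  proof (cases "i = 0 \<or> j = 0")
    case True
    then have "x = 0" using Suc.prems by auto
    then show ?thesis using lin_0[OF lin_funpow[OF l]] by simp
  next
    case False
    then obtain i' j' where ij: "i = Suc i'" "j = Suc j'" by (metis not0_implies_Suc)
    have 1: "(f ^^ i') (f x) = 0" "(g ^^ j) (f x) = 0"
      using Suc.prems ij funpow_swap1[of f i' x] funpow_commute[of f g j x] fg lin_0[OF f] by simp_all
    have 2: "(f ^^ i) (g x) = 0" "(g ^^ j') (g x) = 0"
      using Suc.prems ij funpow_swap1[of g j' x] funpow_commute[of g f i x] fg lin_0[OF g] by simp_all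
    have "(?h ^^ (i' + j)) (f x) = 0" "(?h ^^ (i + j')) (g x) = 0"
      using Suc.hyps(1)[OF _ 1] Suc.hyps(1)[OF _ 2] Suc.hyps(2) ij by auto
    then have "(?h ^^ m) (f x) = 0" "(?h ^^ m) (g x) = 0" using Suc.hyps(2) ij by simp_all
    then have "(?h ^^ m) (?h x) = 0" by (simp only: lin_add[OF lin_funpow[OF l]] add_0)
    then have "(?h ^^ Suc m) x = 0" by (simp only: funpow_Suc_right comp_apply)
    then show ?thesis using Suc.hyps(2) by simp
  qed
qed

lemma opoly_shift: "lin f \<Longrightarrow> opoly ([:- a, 1:] ^ n) f x = ((\<lambda>x. f x - a *s x) ^^ n) x"
proof -
  assume f: "lin f"
  then have "opoly [:- a, 1:] f = (\<lambda>x. f x - a *s x)"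
    by (simp add: fun_eq_iff opoly_pCons lin_0)
  then show ?thesis using opoly_power[OF f] by simp
qed

text \<open>The polynomial p acts on the generalised eigenspace of eigenvalue a as the scalar phi a, so the
  additivity of phi carries over to p.\<close>

lemma opoly_additive:
  assumes f: "lin f" and g: "lin g" and fg: "\<And>x. f (g x) = g (f x)" and A: "finite A"
    and kf: "opoly (\<Prod>a\<in>A. [:- a, 1:] ^ n) f w = 0" and kg: "opoly (\<Prod>a\<in>A. [:- a, 1:] ^ n) g w = 0"
    and kfg: "opoly (\<Prod>a\<in>A. [:- a, 1:] ^ n) (\<lambda>x. f x + g x) w = 0"
    and p: "\<And>a. a \<in> A \<Longrightarrow> [:- a, 1:] ^ (n + n) dvd p - [:\<phi> a:]"
    and add: "\<And>a b. \<phi> (a + b) = \<phi> a + \<phi> b"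
  shows "opoly p (\<lambda>x. f x + g x) w = opoly p f w + opoly p g w"
proof -
  let ?h = "\<lambda>x. f x + g x"
  have h: "lin ?h" by (rule lin_add_fun[OF f g])
  obtain P Q where w: "w = (\<Sum>a\<in>A. \<Sum>b\<in>A. opoly (P a) f (opoly (Q b) g w))"
    and Pk: "\<And>a b. a \<in> A \<Longrightarrow> opoly ([:- a, 1:] ^ n) f (opoly (P a) f (opoly (Q b) g w)) = 0"
    and Qk: "\<And>a b. b \<in> A \<Longrightarrow> opoly ([:- b, 1:] ^ n) g (opoly (P a) f (opoly (Q b) g w)) = 0"
    by (rule joint_primary[OF f g fg A kf A kg]) (rule that)
  define u where "u a b = opoly (P a) f (opoly (Q b) g w)" for a b
  have val: "opoly p k x = \<phi> a *s x" if "lin k" "opoly ([:- a, 1:] ^ (n + n)) k x = 0" "a \<in> A" for k x a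
    using opoly_dvd_0[OF that(1) p[OF that(3)] that(2)]
    by (simp add: opoly_diff[OF that(1)] opoly_const[OF that(1)])
  have ab: "opoly p ?h (u a b) = opoly p f (u a b) + opoly p g (u a b)" if a: "a \<in> A" and b: "b \<in> A" for a b
  proof -
    have fa: "opoly ([:- a, 1:] ^ n) f (u a b) = 0" unfolding u_def by (rule Pk[OF a])
    have gb: "opoly ([:- b, 1:] ^ n) g (u a b) = 0" unfolding u_def by (rule Qk[OF b])
    have 1: "opoly p f (u a b) = \<phi> a *s u a b" "opoly p g (u a b) = \<phi> b *s u a b"
      by (rule val[OF f _ a], rule opoly_dvd_0[OF f le_imp_power_dvd fa], simp)
        (rule val[OF g _ b], rule opoly_dvd_0[OF g le_imp_power_dvd gb], simp)
    have "((\<lambda>x. (f x - a *s x) + (g x - b *s x)) ^^ (n + n)) (u a b) = 0"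
    proof (rule nilpotent_add)
      show "lin (\<lambda>x. f x - a *s x)" "lin (\<lambda>x. g x - b *s x)"
        by (rule lin_diff_fun[OF f lin_scale_fun[OF lin_id]], rule lin_diff_fun[OF g lin_scale_fun[OF lin_id]])
      show "f (g x - b *s x) - a *s (g x - b *s x) = g (f x - a *s x) - b *s (f x - a *s x)" for x
        by (simp add: lin_diff[OF f] lin_diff[OF g] lin_scale[OF f] lin_scale[OF g] fg
            scale_right_diff_distrib scale_left_commute[of a b])
      show "((\<lambda>x. f x - a *s x) ^^ n) (u a b) = 0" using fa opoly_shift[OF f] by simp
      show "((\<lambda>x. g x - b *s x) ^^ n) (u a b) = 0" using gb opoly_shift[OF g] by simp
    qed
    moreover have "(\<lambda>x. (f x - a *s x) + (g x - b *s x)) = (\<lambda>x. ?h x - (a + b) *s x)"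
      by (simp add: fun_eq_iff scale_left_distrib)
    ultimately have hk: "opoly ([:- (a + b), 1:] ^ (n + n)) ?h (u a b) = 0"
      unfolding opoly_shift[OF h] by simp
    have comm_h: "opoly q ?h (opoly r f x) = opoly r f (opoly q ?h x)" for q r x
      by (rule opoly_commute[OF f opoly_lin[OF h]])
        (rule opoly_commute[OF h f, symmetric], simp add: lin_add[OF f] fg)
    have comm_h': "opoly q ?h (opoly r g x) = opoly r g (opoly q ?h x)" for q r x
      by (rule opoly_commute[OF g opoly_lin[OF h]])
        (rule opoly_commute[OF h g, symmetric], simp add: lin_add[OF g] fg)
    have hA: "opoly (\<Prod>a\<in>A. [:- a, 1:] ^ n) ?h (u a b) = 0"
      unfolding u_def comm_h comm_h' kfg by (simp add: lin_0[OF opoly_lin[OF f]] lin_0[OF opoly_lin[OF g]])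
    show ?thesis
    proof (cases "a + b \<in> A")
      case True
      have "opoly p ?h (u a b) = \<phi> (a + b) *s u a b" by (rule val[OF h hk True])
      then show ?thesis by (simp add: 1 add scale_left_distrib)
    next
      case False
      \<comment> \<open>If the sum of the eigenvalues is not in \<open>A\<close>, the component is
        killed by two comaximal polynomials of the same operator and so is 0; the value of \<phi> at
        the sum then does not matter.\<close>
      have "comaximal ([:- (a + b), 1:] ^ (n + n)) (\<Prod>a\<in>A. [:- a, 1:] ^ n)"
        by (rule comaximal_prod_right) (rule comaximal_power, rule comaximal_linear, use False in auto)
      then obtain r s where rs: "r * [:- (a + b), 1:] ^ (n + n) + s * (\<Prod>a\<in>A. [:- a, 1:] ^ n) = 1"
        unfolding comaximal_def by blast
      have "u a b = opoly (r * [:- (a + b), 1:] ^ (n + n) + s * (\<Prod>a\<in>A. [:- a, 1:] ^ n)) ?h (u a b)"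
        unfolding rs by (simp add: opoly_1[OF h])
      also have "\<dots> = 0"
        unfolding opoly_add[OF h] opoly_mult[OF h] hk hA by (simp add: lin_0[OF opoly_lin[OF h]])
      finally show ?thesis using lin_0[OF opoly_lin[OF h]] lin_0[OF opoly_lin[OF f]] lin_0[OF opoly_lin[OF g]] by simp
    qed
  qed
  have W: "w = (\<Sum>a\<in>A. \<Sum>b\<in>A. u a b)" using w unfolding u_def .
  have sm: "opoly p k w = (\<Sum>a\<in>A. \<Sum>b\<in>A. opoly p k (u a b))" if "lin k" for k
    by (subst (1) W) (simp add: lin_sum[OF opoly_lin[OF that]])
  show ?thesis unfolding sm[OF f] sm[OF g] sm[OF h] using ab by (simp add: sum.distrib)
qed

lemma trace_on_opoly_le:
  assumes M: "fin_span M" and f: "lin f" "\<And>x. x \<in> M \<Longrightarrow> f x \<in> M" and n: "degree p \<le> n"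
  shows "trace_on M (opoly p f) = (\<Sum>i\<le>n. coeff p i * trace_on M (f ^^ i))"
proof -
  have "trace_on M (opoly p f) = (\<Sum>i\<le>degree p. coeff p i * trace_on M (f ^^ i))" by (rule trace_on_opoly[OF M f])
  also have "\<dots> = (\<Sum>i\<le>n. coeff p i * trace_on M (f ^^ i))"
    by (rule sum.mono_neutral_left) (use n in \<open>auto simp: coeff_eq_0\<close>)
  finally show ?thesis .
qed

lemma opoly_altdef_le:
  assumes f: "lin f" and n: "degree p \<le> n"
  shows "opoly p f v = (\<Sum>i\<le>n. coeff p i *s (f ^^ i) v)"
  unfolding opoly_altdef[OF f]
  by (rule sum.mono_neutral_left) (use n in \<open>auto simp: coeff_eq_0\<close>)

end

declare scale_fun_apply [simp del]

section \<open>Functionals with values in the algebraic closure\<close>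

context fd_algebra
begin

sublocale K: lin_space_0 "scale_fun (*) :: 'a alg_closure \<Rightarrow> ('b \<Rightarrow> 'a alg_closure) \<Rightarrow> 'b \<Rightarrow> 'a alg_closure"
  by (rule lin_space_scale_fun[OF lin_space_mult])

sublocale K2: lin_space_0 "scale_fun (scale_fun (*)) ::
    'a alg_closure \<Rightarrow> ('b \<Rightarrow> 'b \<Rightarrow> 'a alg_closure) \<Rightarrow> 'b \<Rightarrow> 'b \<Rightarrow> 'a alg_closure"
  by (rule lin_space_scale_fun[OF lin_space_scale_fun[OF lin_space_mult]])

text \<open>This is the dual of the scalar extension of \<open>A\<close> to the closure, obtained
  without forming the tensor product.\<close>

definition semi :: "('b \<Rightarrow> 'a alg_closure) set" where
  "semi = {h. (\<forall>x y. h (x + y) = h x + h y) \<and> (\<forall>c x. h (c *s x) = to_ac c * h x)}"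

lemma semi_simps:
  assumes "h \<in> semi"
  shows "h (x + y) = h x + h y" "h (c *s x) = to_ac c * h x" "h 0 = 0"
    "h (\<Sum>i\<in>I. g i) = (\<Sum>i\<in>I. h (g i))"
proof -
  show 1: "h (x + y) = h x + h y" for x y using assms by (simp add: semi_def)
  show 2: "h (c *s x) = to_ac c * h x" for c x using assms by (simp add: semi_def)
  show 3: "h 0 = 0" using 2[of 0 0] by simp
  show "h (\<Sum>i\<in>I. g i) = (\<Sum>i\<in>I. h (g i))"
    by (induction I rule: infinite_finite_induct) (simp_all add: 1 3)
qed

lemma semi_subspace: "K.subspace semi"
  by (rule K.subspaceI) (simp_all add: semi_def algebra_simps scale_fun_apply)

text \<open>The transpose of \<open>f\<close>. It reverses compositions, which leaves polynomials in
  one operator intact.\<close>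

definition pull :: "('b \<Rightarrow> 'b) \<Rightarrow> ('b \<Rightarrow> 'a alg_closure) \<Rightarrow> 'b \<Rightarrow> 'a alg_closure" where
  "pull f h = h \<circ> f"

lemma pull_apply: "pull f h x = h (f x)"
  by (simp add: pull_def)

lemma pull_lin: "K.lin (pull f)"
  by (rule K.linI) (simp_all add: fun_eq_iff pull_apply scale_fun_apply)

lemma pull_semi: "lin f \<Longrightarrow> h \<in> semi \<Longrightarrow> pull f h \<in> semi"
  by (simp add: semi_def lin_add lin_scale pull_apply)

lemma pull_funpow: "pull f ^^ n = pull (f ^^ n)"
  by (induction n) (simp_all add: fun_eq_iff pull_apply funpow_swap1)

lemma opoly_pull:
  assumes f: "lin f" and h: "h \<in> semi"
  shows "K.opoly (map_poly to_ac p) (pull f) h = pull (opoly p f) h"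
proof (induction p)
  case 0
  show ?case by (rule ext) (simp only: map_poly_0 K.opoly_0 pull_apply opoly_0 semi_simps[OF h] zero_fun_apply)
next
  case (pCons c p)
  have "opoly p f (f x) = f (opoly p f x)" for x by (rule opoly_commute[OF f f refl, symmetric])
  moreover have "map_poly to_ac (pCons c p) = pCons (to_ac c) (map_poly to_ac p)"
    by (rule map_poly_pCons) simp
  ultimately show ?case
    by (intro ext) (simp only: K.opoly_pCons[OF pull_lin] pCons opoly_pCons[OF f],
        simp only: plus_fun_apply scale_fun_apply pull_apply semi_simps[OF h])
qed

lemma semi_coord:
  assumes "independent B" "span B = UNIV"
  shows "(\<lambda>x. to_ac (representation B x b)) \<in> semi"
  by (simp add: semi_def representation_add[OF assms(1)] representation_scale[OF assms(1)] assms(2))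

lemma semi_separates:
  assumes "\<And>h. h \<in> semi \<Longrightarrow> h x = 0"
  shows "x = 0"
proof -
  obtain B where B: "finite B" "independent B" "span B = UNIV" using fin_UNIV by (auto simp: fin_span_def)
  have "representation B x b = 0" for b
    using assms[OF semi_coord[OF B(2,3)]] by (simp add: to_ac_eq_0_iff)
  moreover have "(\<Sum>b\<in>B. representation B x b *s b) = x"
    by (rule sum_representation_eq[OF B(2) _ B(1) order_refl]) (simp add: B)
  ultimately show ?thesis by simp
qed

text \<open>The coordinates with respect to a basis of \<open>A\<close> over the base field form a
  basis of \<open>semi\<close> over the closure; in it \<open>pull f\<close> has the transposed
  matrix of \<open>f\<close>, hence the same trace.\<close>

lemma semi_dual_basis:
  assumes B: "finite B" "independent B" "span B = UNIV"
    and \<delta>_def: "\<delta> = (\<lambda>b x. to_ac (representation B x b))"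
  shows "inj_on \<delta> B" "K.independent (\<delta> ` B)" "K.span (\<delta> ` B) = semi"
    "\<And>h. h \<in> semi \<Longrightarrow> h = (\<Sum>b\<in>B. scale_fun (*) (h b) (\<delta> b))"
proof -
  have dd: "\<delta> b c = (if b = c then 1 else 0)" if "c \<in> B" for b c
    using that by (auto simp: \<delta>_def representation_basis[OF B(2)])
  show inj: "inj_on \<delta> B"
  proof (rule inj_onI)
    fix b c assume "b \<in> B" "c \<in> B" "\<delta> b = \<delta> c"
    then have "\<delta> b c = \<delta> c c" by simp
    then show "b = c" using dd[OF \<open>c \<in> B\<close>, of b] dd[OF \<open>c \<in> B\<close>, of c] by (simp split: if_splits)
  qed
  show "K.independent (\<delta> ` B)"
  proof (rule K.independent_if_scalars_zero)
    fix u x assume s: "(\<Sum>x\<in>\<delta> ` B. scale_fun (*) (u x) x) = 0" and x: "x \<in> \<delta> ` B"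
    obtain c where c: "c \<in> B" "x = \<delta> c" using x by blast
    have "0 = (\<Sum>b\<in>B. scale_fun (*) (u (\<delta> b)) (\<delta> b)) c"
      using s by (simp add: sum.reindex[OF inj])
    also have "\<dots> = (\<Sum>b\<in>B. if b = c then u (\<delta> c) else 0)"
      unfolding sum_fun_apply by (rule sum.cong) (simp_all add: dd[OF c(1)] scale_fun_apply)
    finally show "u x = 0" using B(1) c by simp
  qed (use B in simp)
  have sB: "x = (\<Sum>b\<in>B. representation B x b *s b)" for x
    by (rule sum_representation_eq[OF B(2) _ B(1) order_refl, symmetric]) (simp add: B)
  show exp: "h = (\<Sum>b\<in>B. scale_fun (*) (h b) (\<delta> b))" if h: "h \<in> semi" for h
  proof
    fix x
    have "h x = h (\<Sum>b\<in>B. representation B x b *s b)" by (rule arg_cong[of _ _ h]) (rule sB)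
    also have "\<dots> = (\<Sum>b\<in>B. scale_fun (*) (h b) (\<delta> b) x)"
      by (simp add: semi_simps[OF h] \<delta>_def mult.commute scale_fun_apply)
    finally show "h x = (\<Sum>b\<in>B. scale_fun (*) (h b) (\<delta> b)) x" by (simp only: sum_fun_apply)
  qed
  show "K.span (\<delta> ` B) = semi"
  proof
    have "\<delta> b \<in> semi" for b unfolding \<delta>_def by (rule semi_coord[OF B(2,3)])
    then show "K.span (\<delta> ` B) \<subseteq> semi" by (intro K.span_minimal semi_subspace) blast
    show "semi \<subseteq> K.span (\<delta> ` B)"
    proof
      fix h assume "h \<in> semi"
      then have "h = (\<Sum>b\<in>B. scale_fun (*) (h b) (\<delta> b))" by (rule exp)
      moreover have "\<dots> \<in> K.span (\<delta> ` B)"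
        by (intro K.span_sum K.span_scale K.span_base) blast
      ultimately show "h \<in> K.span (\<delta> ` B)" by simp
    qed
  qed
qed

lemma semi_fin_span: "K.fin_span semi"
proof -
  obtain B where B: "finite B" "independent B" "span B = UNIV" using fin_UNIV by (auto simp: fin_span_def)
  then show ?thesis unfolding K.fin_span_def using semi_dual_basis[OF B refl] by (metis finite_imageI)
qed

lemma trace_on_pull:
  assumes f: "lin f"
  shows "K.trace_on semi (pull f) = to_ac (trace_on UNIV f)"
proof -
  obtain B where B: "finite B" "independent B" "span B = UNIV" using fin_UNIV by (auto simp: fin_span_def)
  define \<delta> where "\<delta> = (\<lambda>b x. to_ac (representation B x b))"
  note dual = semi_dual_basis[OF B \<delta>_def]
  have db: "\<delta> b \<in> semi" for b unfolding \<delta>_def by (rule semi_coord[OF B(2,3)])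
  have rep: "K.representation (\<delta> ` B) h (\<delta> c) = h c" if h: "h \<in> semi" and c: "c \<in> B" for h c
  proof -
    have "K.representation (\<delta> ` B) h = K.representation (\<delta> ` B) (\<Sum>b\<in>B. scale_fun (*) (h b) (\<delta> b))"
      using dual(4)[OF h] by simp
    then have "K.representation (\<delta> ` B) h (\<delta> c)
        = (\<Sum>b\<in>B. h b * K.representation (\<delta> ` B) (\<delta> b) (\<delta> c))"
      using K.representation_sum_scale[OF dual(2), of B \<delta> h "\<delta> c"] dual(3) db by simp
    also have "\<dots> = (\<Sum>b\<in>B. if b = c then h c else 0)"
    proof (rule sum.cong[OF refl])
      fix b assume b: "b \<in> B"
      then have "(\<delta> c = \<delta> b) = (b = c)" using inj_onD[OF dual(1)] c by blast
      then show "h b * K.representation (\<delta> ` B) (\<delta> b) (\<delta> c) = (if b = c then h c else 0)"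
        using K.representation_basis[OF dual(2), of "\<delta> b"] b by auto
    qed
    finally show ?thesis using B(1) c by simp
  qed
  have "K.trace_on semi (pull f) = K.basis_trace (\<delta> ` B) (pull f)"
    by (rule K.trace_on_basis[OF _ dual(2,3) pull_lin pull_semi[OF f]]) (use B in auto)
  also have "\<dots> = (\<Sum>b\<in>B. K.representation (\<delta> ` B) (pull f (\<delta> b)) (\<delta> b))"
    unfolding K.basis_trace_def by (simp add: sum.reindex[OF dual(1)])
  also have "\<dots> = (\<Sum>b\<in>B. \<delta> b (f b))"
    by (rule sum.cong[OF refl]) (simp add: rep[OF pull_semi[OF f db]] pull_apply)
  also have "\<dots> = to_ac (basis_trace B f)" by (simp add: basis_trace_def to_ac_sum \<delta>_def)
  also have "basis_trace B f = trace_on UNIV f" by (rule trace_on_basis[OF B f, symmetric]) simp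
  finally show ?thesis .
qed

end

section \<open>Semisimple and nilpotent parts\<close>

lemma map_poly_to_ac_add: "map_poly to_ac (p + q) = map_poly to_ac p + map_poly to_ac q"
  by (rule poly_eqI) (simp add: coeff_map_poly)

lemma map_poly_to_ac_mult: "map_poly to_ac (p * q) = map_poly to_ac p * map_poly to_ac q"
  by (rule poly_eqI) (simp add: coeff_map_poly coeff_mult to_ac_sum)

lemma map_poly_to_ac_pderiv:
  fixes p :: "'a::field_char_0 poly"
  shows "map_poly to_ac (pderiv p) = pderiv (map_poly to_ac p)"
proof (rule poly_eqI)
  fix n
  have "to_ac (of_nat (Suc n) * coeff p (Suc n)) = of_nat (Suc n) * to_ac (coeff p (Suc n))"
    by (simp only: to_ac_mult to_ac_of_nat)
  then show "coeff (map_poly to_ac (pderiv p)) n = coeff (pderiv (map_poly to_ac p)) n"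
    by (simp only: coeff_map_poly[where f = to_ac, OF to_ac_0] coeff_pderiv)
qed

lemma comaximal_map_poly_to_ac:
  assumes "comaximal p q"
  shows "comaximal (map_poly to_ac p) (map_poly to_ac q)"
proof -
  obtain r s where "r * p + s * q = 1" using assms unfolding comaximal_def by blast
  then have "map_poly to_ac r * map_poly to_ac p + map_poly to_ac s * map_poly to_ac q = map_poly to_ac 1"
    by (simp only: map_poly_to_ac_add[symmetric] map_poly_to_ac_mult[symmetric])
  then show ?thesis unfolding comaximal_def by (metis map_poly_1' to_ac_1)
qed

section \<open>Iterated commutators of operators\<close>

context lin_space
begin

definition opcomm :: "('b \<Rightarrow> 'b) \<Rightarrow> ('b \<Rightarrow> 'b) \<Rightarrow> 'b \<Rightarrow> 'b" where
  "opcomm f g = (\<lambda>x. f (g x) - g (f x))"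

lemma opcomm_lin: "lin f \<Longrightarrow> lin g \<Longrightarrow> lin (opcomm f g)"
  unfolding opcomm_def by (rule linI) (simp_all add: lin_add lin_scale scale_right_diff_distrib)

lemma opcomm_pow_comp_left:
  assumes f: "lin f" and k: "lin k" "\<And>x. f (k x) = k (f x)"
  shows "(opcomm f ^^ n) (\<lambda>x. k (g x)) = (\<lambda>x. k ((opcomm f ^^ n) g x))"
  by (induction n) (simp_all add: opcomm_def fun_eq_iff lin_diff[OF k(1)] k(2))

lemma opcomm_pow_comp_right:
  assumes k: "\<And>x. f (k x) = k (f x)"
  shows "(opcomm f ^^ n) (\<lambda>x. g (k x)) = (\<lambda>x. (opcomm f ^^ n) g (k x))"
  by (induction n) (simp_all add: opcomm_def fun_eq_iff k)

lemma opcomm_pow_add: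
  assumes f: "lin f"
  shows "(opcomm f ^^ n) (\<lambda>x. g x + h x) = (\<lambda>x. (opcomm f ^^ n) g x + (opcomm f ^^ n) h x)"
  by (induction n) (simp_all add: opcomm_def fun_eq_iff lin_add[OF f])

lemma opcomm_pow_zero:
  assumes f: "lin f"
  shows "(opcomm f ^^ n) (\<lambda>x. 0) = (\<lambda>x. 0)"
  by (induction n) (simp_all add: opcomm_def fun_eq_iff lin_0[OF f])

lemma opcomm_opoly_pCons:
  assumes f: "lin f" and g: "lin g"
  shows "opcomm (opoly (pCons c p) f) g = (\<lambda>x. f (opcomm (opoly p f) g x) + opcomm f g (opoly p f x))"
  by (simp add: fun_eq_iff opcomm_def opoly_pCons[OF f] lin_diff[OF f] lin_add[OF g] lin_scale[OF g])

text \<open>The commutator of a polynomial in \<open>f\<close> with \<open>g\<close> is a sum of the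
  commutator of \<open>f\<close> with \<open>g\<close> multiplied on both sides by polynomials in
  \<open>f\<close>. These factors commute with \<open>f\<close>, so one commutation has been gained
  and the induction applies.\<close>

lemma opcomm_opoly_nilpotent:
  assumes f: "lin f"
  shows "lin g \<Longrightarrow> (opcomm f ^^ n) g = (\<lambda>x. 0) \<Longrightarrow> (opcomm (opoly p f) ^^ n) g = (\<lambda>x. 0)"
proof (induction n arbitrary: g)
  case (Suc n)
  have "(opcomm f ^^ n) (opcomm (opoly p f) g) = (\<lambda>x. 0)"
  proof (induction p)
    case 0
    have "opcomm (opoly 0 f) g = (\<lambda>x. 0)" by (simp add: opcomm_def fun_eq_iff lin_0[OF Suc.prems(1)])
    then show ?case by (simp only: opcomm_pow_zero[OF f])
  next
    case (pCons c p)
    have co: "f (opoly p f x) = opoly p f (f x)" for x by (rule opoly_commute[OF f f refl])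
    have "(opcomm f ^^ n) (opcomm f g) = (\<lambda>x. 0)" using Suc.prems(2) by (simp add: funpow_swap1)
    then show ?case
      unfolding opcomm_opoly_pCons[OF f Suc.prems(1)] opcomm_pow_add[OF f]
        opcomm_pow_comp_left[OF f f refl] opcomm_pow_comp_right[where f = f and k = "opoly p f", OF co] pCons
      by (simp add: lin_0[OF f])
  qed
  then have "(opcomm (opoly p f) ^^ n) (opcomm (opoly p f) g) = (\<lambda>x. 0)"
    by (intro Suc.IH opcomm_lin opoly_lin f Suc.prems(1))
  then show ?case by (simp add: funpow_swap1)
qed simp

text \<open>As \<open>?w\<close> commutes with \<open>f\<close>, the commutator of r(f) with
  \<open>g\<close> is r'(f) \<open>?w\<close> for every polynomial r. For r = \<open>p\<close> it is
  0, so both p(f) and p'(f) annihilate the values of \<open>?w\<close>; Bezout finishes.\<close>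

lemma opcomm_separable:
  assumes f: "lin f" and g: "lin g" and p: "comaximal p (pderiv p)" "\<And>x. opoly p f x = 0"
    and 2: "opcomm f (opcomm f g) = (\<lambda>x. 0)"
  shows "opcomm f g = (\<lambda>x. 0)"
proof -
  let ?w = "opcomm f g"
  have w: "f (?w x) = ?w (f x)" for x using fun_cong[OF 2, of x] by (simp add: opcomm_def[of f ?w])
  have lw: "lin ?w" by (rule opcomm_lin[OF f g])
  have wp: "?w (opoly r f x) = opoly r f (?w x)" for r x by (rule opoly_commute[OF f lw]) (simp add: w)
  have D: "opcomm (opoly r f) g x = opoly (pderiv r) f (?w x)" for r x
  proof (induction r)
    case (pCons c r)
    show ?case unfolding opcomm_opoly_pCons[OF f g] pCons wp
      by (simp add: pderiv_pCons opoly_add[OF f] opoly_pCons[OF f])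
  qed (simp add: opcomm_def lin_0[OF g])
  obtain r s where rs: "r * p + s * pderiv p = 1" using p(1) unfolding comaximal_def by blast
  have "?w x = 0" for x
  proof -
    have "?w x = opoly (r * p + s * pderiv p) f (?w x)" by (simp add: rs opoly_1[OF f])
    also have "\<dots> = opoly s f (opoly (pderiv p) f (?w x))"
      by (simp add: opoly_add[OF f] opoly_mult[OF f] p(2) lin_0[OF opoly_lin[OF f]])
    also have "opoly (pderiv p) f (?w x) = 0"
      unfolding D[symmetric] by (simp add: opcomm_def p(2) lin_0[OF g])
    finally show ?thesis by (simp add: lin_0[OF opoly_lin[OF f]])
  qed
  then show ?thesis by blast
qed

lemma opcomm_separable_nilpotent:
  assumes f: "lin f" and p: "comaximal p (pderiv p)" "\<And>x. opoly p f x = 0"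
  shows "lin g \<Longrightarrow> (opcomm f ^^ n) g = (\<lambda>x. 0) \<Longrightarrow> opcomm f g = (\<lambda>x. 0)"
proof (induction n arbitrary: g)
  case 0
  then show ?case by (simp add: opcomm_def lin_0[OF f])
next
  case (Suc n)
  have "(opcomm f ^^ n) (opcomm f g) = (\<lambda>x. 0)" using Suc.prems(2) by (simp add: funpow_swap1)
  then have "opcomm f (opcomm f g) = (\<lambda>x. 0)" by (intro Suc.IH opcomm_lin f Suc.prems(1))
  then show ?case by (rule opcomm_separable[OF f Suc.prems(1) p])
qed

lemma funpow_comp_commute:
  assumes "\<And>x. f (g x) = g (f x)"
  shows "((f \<circ> g) ^^ n) x = (f ^^ n) ((g ^^ n) x)"
  by (induction n arbitrary: x) (simp_all add: funpow_commute[of f g] funpow_commute[of f f] funpow_swap1 assms funpow_commute[of "g" f, OF assms[symmetric]])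

end

section \<open>Diagonalisable operators and the subalgebra Q\<close>

context fd_algebra
begin

text \<open>Since \<open>A\<close> is a set, the linear factors are distinct: \<open>f\<close> is
  diagonalisable over the algebraic closure, expressed through its transpose.\<close>

definition diagonal :: "('b \<Rightarrow> 'b) \<Rightarrow> bool" where
  "diagonal f \<longleftrightarrow> (\<exists>A. finite A \<and> (\<forall>h\<in>semi. K.opoly (\<Prod>a\<in>A. [:- a, 1:]) (pull f) h = 0))"

lemma diagonal_separable:
  assumes f: "lin f" and p: "p \<noteq> 0" "comaximal p (pderiv p)" "\<And>x. opoly p f x = 0"
  shows "diagonal f"
proof -
  have "map_poly to_ac p \<noteq> 0" using p(1) by (simp add: map_poly_eq_0_iff)
  moreover have "comaximal (map_poly to_ac p) (pderiv (map_poly to_ac p))"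
    using comaximal_map_poly_to_ac[OF p(2)] by (simp add: map_poly_to_ac_pderiv)
  ultimately obtain A where A: "finite A" "map_poly to_ac p dvd (\<Prod>a\<in>A. [:- a, 1:])"
    by (rule split_separable)
  have "K.opoly (\<Prod>a\<in>A. [:- a, 1:]) (pull f) h = 0" if h: "h \<in> semi" for h
  proof (rule K.opoly_dvd_0[OF pull_lin A(2)])
    show "K.opoly (map_poly to_ac p) (pull f) h = 0"
      unfolding opoly_pull[OF f h] by (simp add: fun_eq_iff pull_apply p(3) semi_simps[OF h])
  qed
  then show ?thesis unfolding diagonal_def using A(1) by blast
qed

text \<open>Common source of the closure under sums, products and scalars: every functional is a sum
  of joint eigenfunctionals of \<open>f\<close> and \<open>g\<close>, on which \<open>k\<close> acts
  by the scalar \<open>c a b\<close>.\<close>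

lemma diagonal_combine:
  assumes f: "lin f" "diagonal f" and g: "lin g" "diagonal g" and fg: "\<And>x. f (g x) = g (f x)"
    and k: "\<And>h a b x. h \<in> semi \<Longrightarrow> (\<And>x. h (f x) = a * h x) \<Longrightarrow> (\<And>x. h (g x) = b * h x) \<Longrightarrow> h (k x) = c a b * h x"
  shows "diagonal k"
proof -
  obtain A where A: "finite A" "\<And>h. h \<in> semi \<Longrightarrow> K.opoly (\<Prod>a\<in>A. [:- a, 1:]) (pull f) h = 0"
    using f(2) unfolding diagonal_def by blast
  obtain B where B: "finite B" "\<And>h. h \<in> semi \<Longrightarrow> K.opoly (\<Prod>a\<in>B. [:- a, 1:]) (pull g) h = 0"
    using g(2) unfolding diagonal_def by blast
  have co: "pull f (pull g h) = pull g (pull f h)" for h by (simp add: fun_eq_iff pull_apply fg)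
  let ?C = "(\<lambda>(a, b). c a b) ` (A \<times> B)"
  let ?p = "\<Prod>d\<in>?C. [:- d, 1:]"
  have "K.opoly ?p (pull k) h = 0" if h: "h \<in> semi" for h
  proof -
    have kk: "K.opoly (\<Prod>a\<in>A. [:- a, 1:] ^ 1) (pull f) h = 0" "K.opoly (\<Prod>a\<in>B. [:- a, 1:] ^ 1) (pull g) h = 0"
      using A(2)[OF h] B(2)[OF h] by simp_all
    obtain P Q where 1: "h = (\<Sum>a\<in>A. \<Sum>b\<in>B. K.opoly (P a) (pull f) (K.opoly (Q b) (pull g) h))"
      "\<And>a b. a \<in> A \<Longrightarrow> K.opoly ([:- a, 1:] ^ 1) (pull f) (K.opoly (P a) (pull f) (K.opoly (Q b) (pull g) h)) = 0"
      "\<And>a b. b \<in> B \<Longrightarrow> K.opoly ([:- b, 1:] ^ 1) (pull g) (K.opoly (P a) (pull f) (K.opoly (Q b) (pull g) h)) = 0"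
      by (rule K.joint_primary[OF pull_lin pull_lin co A(1) kk(1) B(1) kk(2)]) (rule that)
    define u where "u a b = K.opoly (P a) (pull f) (K.opoly (Q b) (pull g) h)" for a b
    have eig: "v (j x) = a * v x" if "K.opoly ([:- a, 1:] ^ 1) (pull j) v = 0" for j v a x
    proof -
      have "pull j v - scale_fun (*) a v = 0"
        using that K.opoly_shift[OF pull_lin, of a 1 j v] by simp
      then have "(pull j v - scale_fun (*) a v) x = 0" by (simp only: zero_fun_apply)
      then show ?thesis by (simp add: pull_apply scale_fun_apply)
    qed
    have us: "u a b \<in> semi" for a b
      unfolding u_def by (intro K.opoly_mem[OF pull_lin semi_subspace] pull_semi f g h)
    have zero: "K.opoly ?p (pull k) (u a b) = 0" if a: "a \<in> A" and b: "b \<in> B" for a b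
    proof (rule K.opoly_dvd_0[OF pull_lin])
      have C: "c a b \<in> ?C" using a b by force
      have "[:- c a b, 1:] dvd ?p" by (rule dvd_prodI[OF _ C]) (use A(1) B(1) in simp)
      then show "[:- c a b, 1:] ^ 1 dvd ?p" by simp
      have "u a b (k x) = c a b * u a b x" for x
        by (rule k[OF us]) (rule eig, unfold u_def, rule 1(2)[OF a], rule eig, rule 1(3)[OF b])
      then show "K.opoly ([:- c a b, 1:] ^ 1) (pull k) (u a b) = 0"
        unfolding K.opoly_shift[OF pull_lin] by (simp add: fun_eq_iff pull_apply scale_fun_apply)
    qed
    have W: "h = (\<Sum>a\<in>A. \<Sum>b\<in>B. u a b)" unfolding u_def by (rule 1(1))
    have "K.opoly ?p (pull k) h = (\<Sum>a\<in>A. \<Sum>b\<in>B. K.opoly ?p (pull k) (u a b))"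
      by (subst (1) W) (simp only: K.lin_sum[OF K.opoly_lin[OF pull_lin]])
    also have "\<dots> = 0" by (intro sum.neutral ballI zero)
    finally show ?thesis .
  qed
  then have "\<forall>h\<in>semi. K.opoly ?p (pull k) h = 0" by (intro ballI)
  moreover have "finite ?C" using A(1) B(1) by simp
  ultimately show ?thesis unfolding diagonal_def by (intro exI[of _ ?C] conjI)
qed

lemma diagonal_add:
  assumes f: "lin f" "diagonal f" and g: "lin g" "diagonal g" and fg: "\<And>x. f (g x) = g (f x)"
  shows "diagonal (\<lambda>x. f x + g x)"
  by (rule diagonal_combine[OF f g fg, where c = "\<lambda>a b. a + b"]) (simp_all add: semi_simps distrib_right)

lemma diagonal_comp:
  assumes f: "lin f" "diagonal f" and g: "lin g" "diagonal g" and fg: "\<And>x. f (g x) = g (f x)"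
  shows "diagonal (\<lambda>x. f (g x))"
  by (rule diagonal_combine[OF f g fg, where c = "\<lambda>a b. a * b"]) simp_all

lemma diagonal_scale:
  assumes f: "lin f" "diagonal f"
  shows "diagonal (\<lambda>x. c *s f x)"
  by (rule diagonal_combine[OF f f refl, where c = "\<lambda>a b. to_ac c * a"]) (simp_all add: semi_simps)

lemma diagonal_id: "diagonal (\<lambda>x. x)"
  unfolding diagonal_def
proof (intro exI[of _ "{1}"] conjI ballI)
  fix h :: "'b \<Rightarrow> 'a alg_closure"
  have "K.opoly ([:- 1, 1:] ^ 1) (pull (\<lambda>x. x)) h = 0"
    unfolding K.opoly_shift[OF pull_lin] by (simp add: fun_eq_iff pull_apply scale_fun_apply)
  then show "K.opoly (\<Prod>a\<in>{1}. [:- a, 1:]) (pull (\<lambda>x. x)) h = 0" by simp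
qed simp

text \<open>The functional \<open>pull f h\<close> is killed by X^n and by the product of the
  factors with nonzero roots; these are comaximal.\<close>

lemma diagonal_nilpotent:
  assumes f: "lin f" "diagonal f" and n: "\<And>x. (f ^^ n) x = 0"
  shows "f x = 0"
proof (rule semi_separates)
  fix h assume h: "h \<in> semi"
  obtain A where A: "finite A" "K.opoly (\<Prod>a\<in>A. [:- a, 1:]) (pull f) h = 0"
    using f(2) h unfolding diagonal_def by blast
  let ?q = "\<Prod>a\<in>A - {0}. [:- a, 1:]"
  have "(\<Prod>a\<in>A. [:- a, 1:]) dvd ?q * [:0, 1:]"
  proof (cases "0 \<in> A")
    case True
    then show ?thesis using prod.remove[OF A(1), of 0 "\<lambda>a. [:- a, 1:]"] by (simp add: mult.commute)
  next
    case False
    then have "A - {0} = A" by simp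
    then show ?thesis by (simp only: dvd_triv_left)
  qed
  then have "K.opoly (?q * [:0, 1:]) (pull f) h = 0" using K.opoly_dvd_0[OF pull_lin] A(2) by blast
  then have 1: "K.opoly ?q (pull f) (pull f h) = 0"
    by (simp only: K.opoly_mult[OF pull_lin] K.opoly_X[OF pull_lin])
  have "(pull f ^^ n) (pull f h) = 0"
    unfolding pull_funpow by (simp add: fun_eq_iff pull_apply n lin_0[OF f(1)] semi_simps[OF h]
        funpow_swap1[symmetric])
  then have 2: "K.opoly ([:- 0, 1:] ^ n) (pull f) (pull f h) = 0"
    unfolding K.opoly_shift[OF pull_lin] by (simp add: K.scale_zero_left)
  have "comaximal ([:- 0, 1:] ^ n) ?q"
    by (rule comaximal_prod_right) (use comaximal_power[OF comaximal_linear, of 0 _ n 1] in auto)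
  then obtain r s where rs: "r * [:- 0, 1:] ^ n + s * ?q = 1" unfolding comaximal_def by blast
  have "pull f h = K.opoly (r * [:- 0, 1:] ^ n + s * ?q) (pull f) (pull f h)"
    unfolding rs by (simp only: K.opoly_1[OF pull_lin])
  also have "\<dots> = 0"
    unfolding K.opoly_add[OF pull_lin] K.opoly_mult[OF pull_lin] 1 2
    by (simp only: K.lin_0[OF K.opoly_lin[OF pull_lin]] add_0)
  finally show "h (f x) = 0" by (metis pull_apply zero_fun_apply)
qed

definition Q :: "'b set" where
  "Q = {z \<in> Z. diagonal (L z)}"

lemma Q_Z: "Q \<subseteq> Z"
  by (simp add: Q_def)

lemma e_Q: "e \<in> Q"
proof -
  have "L e = (\<lambda>x. x)" by (simp add: fun_eq_iff)
  then show ?thesis using diagonal_id e_Z by (simp add: Q_def)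
qed

lemma Q_scale: "z \<in> Q \<Longrightarrow> c *s z \<in> Q"
  using diagonal_scale[OF lin_L[of z], of c] subspace_scale[OF Z_subspace, of z c]
  by (simp add: Q_def L_lin_simps scale_fun_def)

lemma Q_add: "z \<in> Q \<Longrightarrow> z' \<in> Q \<Longrightarrow> z + z' \<in> Q"
  using diagonal_add[OF lin_L _ lin_L, of z z'] subspace_add[OF Z_subspace, of z z'] Z_D(5)[of z' z]
  by (simp add: Q_def L_lin_simps plus_fun_def)

lemma Q_subspace: "subspace Q"
  using Q_scale[OF e_Q, of 0] by (intro subspaceI Q_add Q_scale) simp_all

lemma Q_mult:
  assumes "z \<in> Q" "z' \<in> Q"
  shows "z \<cdot> z' \<in> Q"
proof -
  have z: "z \<in> Z" "z' \<in> Z" "diagonal (L z)" "diagonal (L z')" using assms by (auto simp: Q_def)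
  have "diagonal (\<lambda>x. z \<cdot> (z' \<cdot> x))"
    by (rule diagonal_comp[OF lin_L z(3) lin_L z(4)]) (rule Z_D(5)[OF z(2)])
  moreover have "L (z \<cdot> z') = (\<lambda>x. z \<cdot> (z' \<cdot> x))" using Z_D(2)[OF z(1)] by (rule ext)
  ultimately show ?thesis using Z_mult z by (simp add: Q_def)
qed

lemma Z_rpow: "z \<in> Z \<Longrightarrow> rpow mult z n \<cdot> x = (L z ^^ Suc n) x"
proof (induction n arbitrary: x)
  case (Suc n)
  then show ?case using Z_D(3)[of z "rpow mult z n" x] by (simp add: funpow_swap1)
qed simp

lemma Q_nilpotent: "z \<in> Q \<Longrightarrow> nilpotent_elem mult z \<Longrightarrow> z = 0"
proof -
  assume z: "z \<in> Q" and "nilpotent_elem mult z"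
  then obtain n where n: "rpow mult z n = 0" by (auto simp: nilpotent_elem_def)
  have "(L z ^^ Suc n) x = 0" for x
    using Z_rpow[of z n x] z by (simp add: Q_def n mult_simps)
  then have "z \<cdot> e = 0" using diagonal_nilpotent[OF lin_L, of z "Suc n" e] z by (simp add: Q_def)
  then show "z = 0" by simp
qed

lemma L_pow_Z:
  assumes "z \<in> Z"
  shows "(L z ^^ n) e \<in> Z" "L ((L z ^^ n) e) = L z ^^ n"
proof -
  have "(L z ^^ n) e \<in> Z \<and> L ((L z ^^ n) e) = L z ^^ n"
  proof (induction n)
    case 0
    then show ?case by (simp add: e_Z fun_eq_iff)
  next
    case (Suc n)
    then have "L (z \<cdot> (L z ^^ n) e) = L z \<circ> (L z ^^ n)"
      using Z_D(2)[OF assms] by (simp add: fun_eq_iff)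
    then show ?case using Suc Z_mult[OF assms] by simp
  qed
  then show "(L z ^^ n) e \<in> Z" "L ((L z ^^ n) e) = L z ^^ n" by simp_all
qed

lemma trace_on_UNIV_nilpotent: "lin f \<Longrightarrow> (\<And>x. (f ^^ n) x = 0) \<Longrightarrow> trace_on UNIV f = 0"
  by (rule trace_on_nilpotent[OF fin_UNIV]) auto

lemma trace_on_UNIV_comm: "lin f \<Longrightarrow> lin g \<Longrightarrow> trace_on UNIV (\<lambda>x. f (g x)) = trace_on UNIV (\<lambda>x. g (f x))"
  using trace_on_comm[OF fin_UNIV, of f g] by (simp add: comp_def)

end

section \<open>Splitting off the semisimple part of a letter\<close>

context comm_alt_algebra
begin

text \<open>By \<open>adj_nilpotent\<close>, iterated commutators of \<open>L a\<close> with
  \<open>L V\<close> end in 0; this passes to the polynomial \<open>L u\<close> in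
  \<open>L a\<close>. For a separable operator the first commutator then vanishes already, and
  \<open>central_of_commuting\<close> applies.\<close>

lemma semisimple_part:
  assumes a: "a \<in> V"
  obtains u n where "u \<in> Q" "\<And>x. (L (a - u) ^^ n) x = 0"
proof -
  obtain p q n where p: "p \<noteq> 0" "comaximal p (pderiv p)" "\<And>x. opoly p (opoly q (L a)) x = 0"
    and n: "\<And>x. ((\<lambda>x. a \<cdot> x - opoly q (L a) x) ^^ n) x = 0"
    by (rule jordan_chevalley[OF fin_UNIV lin_L[of a]]) (rule that)
  define u where "u = opoly q (L a) e"
  have Lu: "L u = opoly q (L a)" unfolding u_def by (rule L_opoly[OF a])
  obtain m where m: "\<And>b. b \<in> V \<Longrightarrow> (adj a ^^ m) (L b) = 0" using adj_nilpotent[OF a] by blast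
  have adj: "adj a = opcomm (L a)" by (simp add: fun_eq_iff adj_apply opcomm_def)
  have "opcomm (L u) (L b) = (\<lambda>x. 0)" if b: "b \<in> V" for b
  proof (rule opcomm_separable_nilpotent[OF lin_L p(2)])
    show "opoly p (L u) x = 0" for x using p(3) Lu by simp
    have "(opcomm (L a) ^^ m) (L b) = (\<lambda>x. 0)" using m[OF b] by (simp add: adj zero_fun_def)
    then show "(opcomm (L u) ^^ m) (L b) = (\<lambda>x. 0)"
      unfolding Lu by (rule opcomm_opoly_nilpotent[OF lin_L lin_L])
  qed (rule lin_L)
  then have "u \<cdot> (b \<cdot> x) = b \<cdot> (u \<cdot> x)" if "b \<in> V" for b x
    using that unfolding opcomm_def by (metis eq_iff_diff_eq_0)
  then have "u \<in> Z" by (rule central_of_commuting)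
  moreover have "diagonal (L u)" by (rule diagonal_separable[OF lin_L p(1,2)]) (simp add: Lu p(3))
  moreover have "L (a - u) = (\<lambda>x. a \<cdot> x - opoly q (L a) x)"
    by (simp add: fun_eq_iff mult_simps Lu[symmetric])
  ultimately show ?thesis using that[of u n] n by (simp add: Q_def)
qed

text \<open>\<open>nilpotent_V'\<close> and \<open>V'_nilpotent\<close> identify this with the
  letters whose left multiplication is nilpotent. The trace condition is linear in \<open>a\<close>,
  which makes the subspace property immediate, and it suits commutators. The central factors
  \<open>z\<close> supply the powers of a semisimple part.\<close>

definition V' :: "'b set" where
  "V' = {a \<in> V. \<forall>z\<in>Z. trace_on UNIV (\<lambda>x. a \<cdot> (z \<cdot> x)) = 0}"

lemma V'_V: "a \<in> V' \<Longrightarrow> a \<in> V"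
  by (simp add: V'_def)

lemma lin_LL: "lin (\<lambda>x. a \<cdot> (b \<cdot> x))"
  using lin_comp[OF lin_L[of a] lin_L[of b]] by (simp add: comp_def)

lemma V'_subspace: "subspace V'"
proof (rule subspaceI)
  have "trace_on UNIV (\<lambda>x. 0) = 0" by (rule trace_on_UNIV_nilpotent[of _ 1]) (auto intro: linI)
  then show "0 \<in> V'" by (simp add: V'_def mult_simps subspace_0[OF V_subspace])
  fix x y c assume x: "x \<in> V'"
  show "c *s x \<in> V'"
    using x by (simp add: V'_def mult_simps subspace_scale[OF V_subspace] trace_on_scale[OF fin_UNIV lin_LL])
  assume y: "y \<in> V'"
  show "x + y \<in> V'"
    using x y by (simp add: V'_def mult_simps subspace_add[OF V_subspace] trace_on_add[OF fin_UNIV lin_LL _ lin_LL])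
qed

lemma nilpotent_V':
  assumes a: "a \<in> V" and n: "\<And>x. (L a ^^ n) x = 0"
  shows "a \<in> V'"
  unfolding V'_def
proof (intro CollectI conjI a ballI)
  fix z assume z: "z \<in> Z"
  have "((L a \<circ> L z) ^^ n) x = 0" for x
    using funpow_comp_commute[of "L a" "L z" n x] Z_D(5)[OF z] n by simp
  then show "trace_on UNIV (\<lambda>x. a \<cdot> (z \<cdot> x)) = 0"
    using trace_on_UNIV_nilpotent[OF lin_comp[OF lin_L lin_L], of n a z] by (simp add: comp_def)
qed

lemma V_split:
  assumes "a \<in> V"
  obtains u where "u \<in> Q" "a - u \<in> V'"
proof -
  obtain u n where u: "u \<in> Q" "\<And>x. (L (a - u) ^^ n) x = 0" by (rule semisimple_part[OF assms]) (rule that)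
  have "a - u \<in> V" using subspace_diff[OF V_subspace assms] u(1) Q_Z Z_V by blast
  then show ?thesis using that u nilpotent_V' by blast
qed

text \<open>The nilpotent part of \<open>a\<close> lies in \<open>V'\<close>, hence so does the
  semisimple part \<open>u\<close>. Taking powers of \<open>u\<close> as central factors makes all
  power traces of \<open>L u\<close> vanish; being nilpotent and diagonalisable, \<open>L u\<close>
  is 0.\<close>

lemma V'_nilpotent:
  assumes a: "a \<in> V'"
  shows "\<exists>n. \<forall>x. (L a ^^ n) x = 0"
proof -
  obtain u n where u: "u \<in> Q" and n: "\<And>x. (L (a - u) ^^ n) x = 0"
    by (rule semisimple_part[OF V'_V[OF a]]) (rule that)
  have uZ: "u \<in> Z" using u Q_Z by blast
  have "a - u \<in> V" using subspace_diff[OF V_subspace V'_V[OF a]] uZ Z_V by blast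
  then have au: "a - u \<in> V'" using nilpotent_V' n by blast
  have "u = a - (a - u)" by simp
  then have uV': "u \<in> V'" using subspace_diff[OF V'_subspace a au] by simp
  have "\<exists>k. \<forall>x\<in>UNIV. (L u ^^ k) x = 0"
  proof (rule nilpotent_of_traces[OF fin_UNIV lin_L])
    fix k :: nat assume "1 \<le> k"
    then obtain j where j: "k = Suc j" by (cases k) auto
    have "trace_on UNIV (\<lambda>x. u \<cdot> ((L u ^^ j) e \<cdot> x)) = 0"
      using uV' L_pow_Z(1)[OF uZ] by (simp add: V'_def)
    moreover have "(\<lambda>x. u \<cdot> ((L u ^^ j) e \<cdot> x)) = L u ^^ k"
      unfolding L_pow_Z(2)[OF uZ] j by (simp add: fun_eq_iff)
    ultimately show "trace_on UNIV (L u ^^ k) = 0" by simp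
  qed simp
  then obtain k where "\<And>x. (L u ^^ k) x = 0" by blast
  then have "u \<cdot> e = 0" using diagonal_nilpotent[OF lin_L, of u k e] u by (simp add: Q_def)
  then show ?thesis using n by auto
qed

text \<open>The operator in question is the commutator of \<open>?D\<close> with the composition of
  \<open>L c\<close> and \<open>L z\<close>, since central multiplications commute with
  \<open>L c\<close>; commutators have trace 0.\<close>

lemma triple_V':
  assumes "a \<in> V" "b \<in> V" "c \<in> V"
  shows "triple_comm a b c \<in> V'"
  unfolding V'_def
proof (intro CollectI conjI ballI)
  show "triple_comm a b c \<in> V" using V_triple assms by blast
  fix z assume z: "z \<in> Z"
  let ?D = "triple_comm a b"
  have l1: "lin (\<lambda>x. ?D (z \<cdot> x))" and l2: "lin (\<lambda>x. ?D (c \<cdot> (z \<cdot> x)))" and l3: "lin (\<lambda>x. c \<cdot> ?D (z \<cdot> x))"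
    using lin_comp[OF triple_lin lin_L] lin_comp[OF triple_lin lin_LL]
      lin_comp[OF lin_L lin_comp[OF triple_lin lin_L]] by (simp_all add: comp_def)
  have "trace_on UNIV (\<lambda>x. ?D c \<cdot> (z \<cdot> x)) = trace_on UNIV (\<lambda>x. ?D (c \<cdot> (z \<cdot> x)) - c \<cdot> ?D (z \<cdot> x))"
    by (simp add: L_triple[OF assms])
  also have "\<dots> = trace_on UNIV (\<lambda>x. ?D (c \<cdot> (z \<cdot> x))) - trace_on UNIV (\<lambda>x. c \<cdot> ?D (z \<cdot> x))"
    by (rule trace_on_diff[OF fin_UNIV l2 _ l3]) simp_all
  also have "trace_on UNIV (\<lambda>x. c \<cdot> ?D (z \<cdot> x)) = trace_on UNIV (\<lambda>x. ?D (z \<cdot> (c \<cdot> x)))"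
    by (rule trace_on_UNIV_comm[OF lin_L l1])
  also have "(\<lambda>x. ?D (z \<cdot> (c \<cdot> x))) = (\<lambda>x. ?D (c \<cdot> (z \<cdot> x)))"
    using Z_D(5)[OF z, of c] by simp
  finally show "trace_on UNIV (\<lambda>x. ?D c \<cdot> (z \<cdot> x)) = 0" by simp
qed

end

section \<open>Nilpotent derivations\<close>

context lin_space_0
begin

text \<open>Cartan's argument: with g acting as the rational number phi a on the generalised eigenspace of
  eigenvalue a, the trace of f g(f) is the sum of the a phi(a) d_a; applying phi gives the sum of the
  phi(a)^2 d_a, so that phi(a) = 0 whenever d_a is nonzero.\<close>

lemma nilpotent_of_rational_traces:
  assumes M: "fin_span M" and f: "lin f" "\<And>x. x \<in> M \<Longrightarrow> f x \<in> M"
    and A: "finite A" and kill: "\<And>x. x \<in> M \<Longrightarrow> opoly (\<Prod>a\<in>A. [:- a, 1:] ^ Suc n) f x = 0"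
    and tr: "\<And>\<phi> g. (\<And>a b. \<phi> (a + b) = \<phi> a + (\<phi> b :: rat)) \<Longrightarrow>
      (\<And>a. a \<in> A \<Longrightarrow> [:- a, 1:] ^ Suc n dvd g - [:of_rat (\<phi> a):]) \<Longrightarrow> trace_on M (opoly (pCons 0 g) f) = 0"
  shows "\<exists>k. \<forall>x\<in>M. (f ^^ k) x = 0"
proof -
  let ?m = "\<Prod>a\<in>A. [:- a, 1:] ^ Suc n"
  obtain P where P1: "?m dvd 1 - (\<Sum>a\<in>A. P a)"
    and P2: "\<And>a. a \<in> A \<Longrightarrow> ?m dvd [:- a, 1:] ^ Suc n * P a"
    and P3: "\<And>a b. a \<in> A \<Longrightarrow> b \<in> A \<Longrightarrow> [:- b, 1:] ^ Suc n dvd P a - [:if a = b then 1 else 0:]"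
    by (rule primary_projections[OF A, of "Suc n"]) (rule that)
  have dvdI: "?m dvd h" if "\<And>a. a \<in> A \<Longrightarrow> [:- a, 1:] ^ Suc n dvd h" for h :: "'a poly"
    by (rule prod_dvd_of_comaximal[OF A _ that]) (auto intro!: comaximal_power comaximal_linear simp del: power_Suc)
  have killd: "opoly h f x = 0" if "?m dvd h" "x \<in> M" for h x
    by (rule opoly_dvd_0[OF f(1) that(1) kill[OF that(2)]])
  have sumP: "(\<Sum>a\<in>A. opoly (P a) f x) = x" if "x \<in> M" for x
    using killd[OF P1 that] by (simp add: opoly_diff[OF f(1)] opoly_1[OF f(1)] opoly_sum[OF f(1)])
  have mem: "opoly h f x \<in> M" if "x \<in> M" for h x
    by (rule opoly_mem[OF f(1) fin_span_subspace[OF M] f(2) that])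
  have linp: "lin (opoly h f)" for h by (rule opoly_lin[OF f(1)])
  define H where "H a = opoly (P a) f ` M" for a
  have sH: "subspace (H a)" for a
    unfolding H_def by (rule lin_subspace_image[OF linp fin_span_subspace[OF M]])
  have HM: "H a \<subseteq> M" for a unfolding H_def using mem by blast
  have fH: "fin_span (H a)" for a by (rule fin_span_subset[OF sH HM M])
  define d where "d a = card (some_basis (H a))" for a
  have trP: "trace_on M (opoly (P a) f) = of_nat (d a)" if a: "a \<in> A" for a
  proof -
    have "trace_on M (opoly (P a) f) = trace_on (H a) (opoly (P a) f)"
      by (rule trace_on_sub[OF M sH HM linp]) (simp add: H_def)
    also have "\<dots> = trace_on (H a) (\<lambda>x. x)"
    proof (rule trace_on_cong[OF fH])
      fix x assume "x \<in> H a"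
      then obtain y where y: "y \<in> M" "x = opoly (P a) f y" unfolding H_def by blast
      have "?m dvd (P a - 1) * P a"
      proof (rule dvdI)
        fix b assume b: "b \<in> A"
        show "[:- b, 1:] ^ Suc n dvd (P a - 1) * P a"
          using P3[OF a b] by (cases "a = b") (simp_all add: one_pCons del: power_Suc)
      qed
      from killd[OF this y(1)] show "opoly (P a) f x = x"
        by (simp add: opoly_mult[OF f(1)] opoly_diff[OF f(1)] opoly_1[OF f(1)] y(2))
    qed
    also have "\<dots> = of_nat (d a)"
      unfolding d_def by (rule trace_on_id) (use some_basis[OF fH] in auto)
    finally show ?thesis .
  qed
  have d0: "opoly (P a) f x = 0" if a: "a \<in> A" "a \<noteq> 0" and x: "x \<in> M" for a x
  proof -
    have vsq: "vector_space (\<lambda>r (k::'a). of_rat r * k)"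
      by unfold_locales (simp_all add: algebra_simps of_rat_add of_rat_mult)
    obtain \<phi> where \<phi>_add: "\<And>x y. \<phi> (x + y) = \<phi> x + \<phi> y" and \<phi>_scale: "\<And>c x. \<phi> (of_rat c * x) = c * \<phi> x"
      and \<phi>1: "\<phi> a = (1::rat)"
      by (rule ex_linear_functional[OF vsq a(2)]) (rule that)
    have \<phi>0: "\<phi> 0 = 0" using \<phi>_scale[of 0 0] by simp
    have \<phi>_sum: "\<phi> (\<Sum>i\<in>I. h i) = (\<Sum>i\<in>I. \<phi> (h i))" for h :: "'a \<Rightarrow> 'a" and I
      by (induction I rule: infinite_finite_induct) (simp_all add: \<phi>0 \<phi>_add)
    obtain g where g: "\<And>a. a \<in> A \<Longrightarrow> [:- a, 1:] ^ Suc n dvd g - [:of_rat (\<phi> a):]"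
      using poly_crt[OF A, of "Suc n" "\<lambda>a. of_rat (\<phi> a)"] by blast
    have part: "trace_on M (opoly (pCons 0 g * P b) f) = b * of_rat (\<phi> b) * of_nat (d b)" if b: "b \<in> A" for b
    proof -
      let ?c = "b * of_rat (\<phi> b)"
      obtain r where r: "g - [:of_rat (\<phi> b):] = [:- b, 1:] ^ Suc n * r" using g[OF b] by (rule dvdE)
      \<comment> \<open>Modulo X - b the polynomial X g is the constant b \<phi>(b). One factor X -
        b is enough, as \<open>?N\<close> only has to be nilpotent; the exponent
        \<open>Suc n\<close> ensures that it is present.\<close>
      have "pCons 0 g - [:?c:] = [:0, 1:] * (g - [:of_rat (\<phi> b):]) + smult (of_rat (\<phi> b)) [:- b, 1:]"
        by (simp add: algebra_simps)
      also have "\<dots> = [:- b, 1:] * ([:0, 1:] * ([:- b, 1:] ^ n * r) + [:of_rat (\<phi> b):])"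
        unfolding r by (simp add: distrib_left mult.left_commute[of "[:0, 1:]"] mult.assoc
            del: mult_pCons_left)
      finally obtain q where q: "pCons 0 g - [:?c:] = [:- b, 1:] * q" by blast
      let ?N = "[:- b, 1:] * q * P b"
      have "pCons 0 g * P b = smult ?c (P b) + ?N"
      proof -
        have "pCons 0 g = [:?c:] + [:- b, 1:] * q" using q by (simp only: diff_eq_eq add.commute)
        then have "pCons 0 g * P b = [:?c:] * P b + ?N" by (simp only: distrib_right)
        then show ?thesis by simp
      qed
      then have eq: "opoly (pCons 0 g * P b) f = (\<lambda>x. ?c *s opoly (P b) f x + opoly ?N f x)"
        by (simp add: fun_eq_iff opoly_add[OF f(1)] opoly_smult[OF f(1)])
      have "trace_on M (opoly ?N f) = 0"
      proof (rule trace_on_nilpotent[OF M linp mem])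
        fix x assume x: "x \<in> M"
        have "(z * q * p) ^ Suc n = (z ^ Suc n * p) * (q ^ Suc n * p ^ n)" for z p
          by (simp add: power_mult_distrib mult_ac)
        then have "?N ^ Suc n = ([:- b, 1:] ^ Suc n * P b) * (q ^ Suc n * P b ^ n)" .
        then have "?m dvd ?N ^ Suc n" using P2[OF b] by (metis dvd_mult2)
        then show "(opoly ?N f ^^ Suc n) x = 0"
          using killd[OF _ x] by (simp only: opoly_power[OF f(1), symmetric])
      qed
      moreover have "trace_on M (opoly (pCons 0 g * P b) f) = trace_on M (\<lambda>x. ?c *s opoly (P b) f x) + trace_on M (opoly ?N f)"
        unfolding eq by (rule trace_on_add[OF M lin_scale_fun[OF linp] _ linp])
          (use mem subspace_scale[OF fin_span_subspace[OF M]] in blast)+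
      moreover have "trace_on M (\<lambda>x. ?c *s opoly (P b) f x) = ?c * of_nat (d b)"
        using trace_on_scale[where c = ?c, OF M linp[of "P b"] mem] trP[OF b] by simp
      ultimately show ?thesis by simp
    qed
    have "0 = trace_on M (opoly (pCons 0 g) f)" by (rule tr[symmetric, OF \<phi>_add g])
    also have "\<dots> = trace_on M (\<lambda>x. \<Sum>b\<in>A. 1 *s opoly (pCons 0 g * P b) f x)"
    proof (rule trace_on_cong[OF M])
      fix x assume x: "x \<in> M"
      have "opoly (pCons 0 g) f x = opoly (pCons 0 g) f (\<Sum>b\<in>A. opoly (P b) f x)" by (simp only: sumP[OF x])
      then show "opoly (pCons 0 g) f x = (\<Sum>b\<in>A. 1 *s opoly (pCons 0 g * P b) f x)"
        by (simp add: lin_sum[OF linp] opoly_mult[OF f(1)] del: mult_pCons_left)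
    qed
    also have "\<dots> = (\<Sum>b\<in>A. 1 * trace_on M (opoly (pCons 0 g * P b) f))"
      by (rule trace_on_lincomb[OF M linp mem A])
    also have "\<dots> = (\<Sum>b\<in>A. b * of_rat (\<phi> b) * of_nat (d b))" by (simp add: part del: mult_pCons_left)
    finally have "0 = \<phi> (\<Sum>b\<in>A. b * of_rat (\<phi> b) * of_nat (d b))" using \<phi>0 by simp
    also have "\<dots> = (\<Sum>b\<in>A. \<phi> b * \<phi> b * of_nat (d b))"
      unfolding \<phi>_sum
    proof (rule sum.cong[OF refl])
      fix b
      have "b * of_rat (\<phi> b) * of_nat (d b) = of_rat (\<phi> b * of_nat (d b)) * b" by (simp add: of_rat_mult)
      then show "\<phi> (b * of_rat (\<phi> b) * of_nat (d b)) = \<phi> b * \<phi> b * of_nat (d b)" by (simp only: \<phi>_scale) simp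
    qed
    finally have "(\<Sum>b\<in>A. \<phi> b * \<phi> b * of_nat (d b)) = 0" by simp
    \<comment> \<open>Rational values of \<phi> make the terms nonnegative, so each of them is
      0.\<close>
    then have "\<phi> a * \<phi> a * of_nat (d a) = 0"
      using sum_nonneg_eq_0_iff[OF A, of "\<lambda>b. \<phi> b * \<phi> b * of_nat (d b)"] a(1) by simp
    then have "d a = 0" using \<phi>1 by simp
    then have "some_basis (H a) = {}" using some_basis(1)[OF fH] by (simp add: d_def)
    then have "H a = {0}" using some_basis(3)[OF fH] span_empty by metis
    then show ?thesis using x unfolding H_def by blast
  qed
  have "(f ^^ Suc n) x = 0" if x: "x \<in> M" for x
  proof -
    have fn: "(f ^^ Suc n) y = opoly ([:- 0, 1:] ^ Suc n) f y" for y
      unfolding opoly_shift[OF f(1)] by simp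
    have "(f ^^ Suc n) x = opoly ([:- 0, 1:] ^ Suc n) f (\<Sum>a\<in>A. opoly (P a) f x)"
      unfolding fn by (simp only: sumP[OF x])
    also have "\<dots> = (\<Sum>a\<in>A. opoly ([:- 0, 1:] ^ Suc n) f (opoly (P a) f x))" by (rule lin_sum[OF linp])
    also have "\<dots> = 0"
    proof (rule sum.neutral, rule ballI)
      fix a assume a: "a \<in> A"
      show "opoly ([:- 0, 1:] ^ Suc n) f (opoly (P a) f x) = 0"
      proof (cases "a = 0")
        case True
        then show ?thesis using killd[OF P2[OF a] x] by (simp only: opoly_mult[OF f(1)])
      next
        case False
        then show ?thesis using d0[OF a False x] lin_0[OF linp] by simp
      qed
    qed
    finally show ?thesis .
  qed
  then show ?thesis by blast
qed

end

section \<open>A trace criterion for nilpotent derivations\<close>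

context fd_algebra
begin

definition derivation_op :: "('b \<Rightarrow> 'b) \<Rightarrow> bool" where
  "derivation_op D \<longleftrightarrow> lin D \<and> (\<forall>x y. D (x \<cdot> y) = D x \<cdot> y + x \<cdot> D y)"

lemma semi_mult: "h \<in> semi \<Longrightarrow> (\<lambda>x. h (x \<cdot> y)) \<in> semi" "h \<in> semi \<Longrightarrow> (\<lambda>y. h (x \<cdot> y)) \<in> semi"
  by (simp_all add: semi_def mult_simps)

lemma K_opoly_altdef:
  assumes "degree p \<le> n"
  shows "K.opoly p (pull D) h x = (\<Sum>i\<le>n. coeff p i * h ((D ^^ i) x))"
  unfolding K.opoly_altdef_le[OF pull_lin assms]
  by (simp add: sum_fun_apply scale_fun_apply pull_funpow pull_apply)

text \<open>Applying the derivation to a product is the sum of two commuting operators on forms in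
  two arguments. An additive function of the eigenvalues therefore gives a polynomial that respects
  this sum, that is, again a derivation; the statement is its dual form.\<close>

lemma opoly_derivation_closure:
  assumes D: "derivation_op D"
    and A: "finite A" "\<And>h. h \<in> semi \<Longrightarrow> K.opoly (\<Prod>a\<in>A. [:- a, 1:] ^ n) (pull D) h = 0"
    and p: "\<And>a. a \<in> A \<Longrightarrow> [:- a, 1:] ^ (n + n) dvd p - [:\<phi> a:]"
    and add: "\<And>a b. \<phi> (a + b) = \<phi> a + \<phi> b" and h: "h \<in> semi"
  shows "K.opoly p (pull D) h (x \<cdot> y)
    = K.opoly p (pull D) (\<lambda>x. h (x \<cdot> y)) x + K.opoly p (pull D) (\<lambda>y. h (x \<cdot> y)) y"
proof -
  have lD: "lin D" and der: "\<And>x y. D (x \<cdot> y) = D x \<cdot> y + x \<cdot> D y" using D by (auto simp: derivation_op_def)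
  define f1 :: "('b \<Rightarrow> 'b \<Rightarrow> 'a alg_closure) \<Rightarrow> 'b \<Rightarrow> 'b \<Rightarrow> 'a alg_closure" where "f1 = (\<lambda>\<beta> x y. \<beta> (D x) y)"
  define f2 :: "('b \<Rightarrow> 'b \<Rightarrow> 'a alg_closure) \<Rightarrow> 'b \<Rightarrow> 'b \<Rightarrow> 'a alg_closure" where "f2 = (\<lambda>\<beta> x y. \<beta> x (D y))"
  have f1: "K2.lin f1" and f2: "K2.lin f2"
    by (rule K2.linI; simp add: f1_def f2_def fun_eq_iff scale_fun_apply)+
  have f12: "K2.lin (\<lambda>\<beta>. f1 \<beta> + f2 \<beta>)" by (rule K2.lin_add_fun[OF f1 f2])
  define w where "w = (\<lambda>x y. h (x \<cdot> y))"
  have o1: "K2.opoly q f1 \<beta> x y = K.opoly q (pull D) (\<lambda>x. \<beta> x y) x" for q \<beta> x y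
  proof (induction q arbitrary: x y)
    case 0
    show ?case by (simp only: K2.opoly_0 K.opoly_0 zero_fun_apply)
  next
    case (pCons c q)
    have "K2.opoly (pCons c q) f1 \<beta> x y = (scale_fun (scale_fun (*)) c \<beta> + f1 (K2.opoly q f1 \<beta>)) x y"
      by (simp only: K2.opoly_pCons[OF f1])
    also have "\<dots> = c * \<beta> x y + f1 (K2.opoly q f1 \<beta>) x y" by (simp only: plus_fun_apply scale_fun_apply)
    also have "f1 (K2.opoly q f1 \<beta>) x y = K2.opoly q f1 \<beta> (D x) y" by (simp add: f1_def)
    also have "\<dots> = K.opoly q (pull D) (\<lambda>x. \<beta> x y) (D x)" by (rule pCons(2))
    also have "c * \<beta> x y + \<dots> = K.opoly (pCons c q) (pull D) (\<lambda>x. \<beta> x y) x"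
      by (simp only: K.opoly_pCons[OF pull_lin], simp only: plus_fun_apply scale_fun_apply pull_apply)
    finally show ?case .
  qed
  have o2: "K2.opoly q f2 \<beta> x y = K.opoly q (pull D) (\<beta> x) y" for q \<beta> x y
  proof (induction q arbitrary: x y)
    case 0
    show ?case by (simp only: K2.opoly_0 K.opoly_0 zero_fun_apply)
  next
    case (pCons c q)
    have "K2.opoly (pCons c q) f2 \<beta> x y = (scale_fun (scale_fun (*)) c \<beta> + f2 (K2.opoly q f2 \<beta>)) x y"
      by (simp only: K2.opoly_pCons[OF f2])
    also have "\<dots> = c * \<beta> x y + f2 (K2.opoly q f2 \<beta>) x y" by (simp only: plus_fun_apply scale_fun_apply)
    also have "f2 (K2.opoly q f2 \<beta>) x y = K2.opoly q f2 \<beta> x (D y)" by (simp add: f2_def)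
    also have "\<dots> = K.opoly q (pull D) (\<beta> x) (D y)" by (rule pCons(2))
    also have "c * \<beta> x y + \<dots> = K.opoly (pCons c q) (pull D) (\<beta> x) y"
      by (simp only: K.opoly_pCons[OF pull_lin], simp only: plus_fun_apply scale_fun_apply pull_apply)
    finally show ?case .
  qed
  have o12: "K2.opoly q (\<lambda>\<beta>. f1 \<beta> + f2 \<beta>) w x y = K.opoly q (pull D) h (x \<cdot> y)" for q x y
  proof (induction q arbitrary: x y)
    case 0
    show ?case by (simp only: K2.opoly_0 K.opoly_0 zero_fun_apply)
  next
    case (pCons c q)
    have "K.opoly q (pull D) h \<in> semi"
      by (intro K.opoly_mem[OF pull_lin semi_subspace] pull_semi lD h)
    note s = semi_simps(1)[OF this]
    have "(f1 (K2.opoly q (\<lambda>\<beta>. f1 \<beta> + f2 \<beta>) w) + f2 (K2.opoly q (\<lambda>\<beta>. f1 \<beta> + f2 \<beta>) w)) x y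
        = K.opoly q (pull D) h (D x \<cdot> y) + K.opoly q (pull D) h (x \<cdot> D y)"
    proof -
      have fa: "(f1 T + f2 T) x y = T (D x) y + T x (D y)" for T by (simp add: f1_def f2_def)
      show ?thesis by (subst fa) (simp only: pCons(2))
    qed
    then have "(f1 (K2.opoly q (\<lambda>\<beta>. f1 \<beta> + f2 \<beta>) w) + f2 (K2.opoly q (\<lambda>\<beta>. f1 \<beta> + f2 \<beta>) w)) x y
        = K.opoly q (pull D) h (D (x \<cdot> y))" by (simp only: der s)
    then show ?case unfolding K2.opoly_pCons[OF f12] K.opoly_pCons[OF pull_lin]
      by (simp only: plus_fun_apply[of "scale_fun _ _ _"] scale_fun_apply pull_apply w_def)
  qed
  have "K2.opoly p (\<lambda>\<beta>. f1 \<beta> + f2 \<beta>) w = K2.opoly p f1 w + K2.opoly p f2 w"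
  proof (rule K2.opoly_additive[OF f1 f2 _ A(1) _ _ _ p add])
    show "f1 (f2 \<beta>) = f2 (f1 \<beta>)" for \<beta> by (simp add: f1_def f2_def)
    show "K2.opoly (\<Prod>a\<in>A. [:- a, 1:] ^ n) f1 w = 0"
      by (intro ext) (simp only: o1 w_def A(2)[OF semi_mult(1)[OF h]] zero_fun_apply)
    show "K2.opoly (\<Prod>a\<in>A. [:- a, 1:] ^ n) f2 w = 0"
      by (intro ext) (simp only: o2 w_def A(2)[OF semi_mult(2)[OF h]] zero_fun_apply)
    show "K2.opoly (\<Prod>a\<in>A. [:- a, 1:] ^ n) (\<lambda>\<beta>. f1 \<beta> + f2 \<beta>) w = 0"
      by (intro ext) (simp only: o12 A(2)[OF h] zero_fun_apply)
  qed
  then have "K2.opoly p (\<lambda>\<beta>. f1 \<beta> + f2 \<beta>) w x y = K2.opoly p f1 w x y + K2.opoly p f2 w x y"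
    by (simp only: plus_fun_apply)
  then show ?thesis unfolding o12 o1 o2 by (simp only: w_def)
qed

text \<open>Only polynomials over the base field are tested. The polynomial \<open>g\<close> of
  Cartan's argument has coefficients in the closure, but being a derivation and the trace are both
  linear in the coefficients. A nonzero trace would be seen by some functional \<psi> to the base
  field, and \<psi> applied to \<open>g\<close> gives a tested polynomial.\<close>

lemma derivation_nilpotent:
  assumes D: "derivation_op D"
    and tr: "\<And>p. derivation_op (opoly p D) \<Longrightarrow> trace_on UNIV (\<lambda>x. D (opoly p D x)) = 0"
  shows "\<exists>k. \<forall>x. (D ^^ k) x = 0"
proof -
  have lD: "lin D" and der: "\<And>x y. D (x \<cdot> y) = D x \<cdot> y + x \<cdot> D y" using D by (auto simp: derivation_op_def)
  obtain m where m: "m \<noteq> 0" "\<And>x. opoly m D x = 0" using annihilator[OF fin_UNIV lD] by auto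
  have "map_poly to_ac m \<noteq> 0" using m(1) by (simp add: map_poly_eq_0_iff)
  then obtain A n where A: "finite A" and dv: "map_poly to_ac m dvd (\<Prod>a\<in>A. [:- a, 1:] ^ n)"
    by (rule split_power)
  have kill: "K.opoly (\<Prod>a\<in>A. [:- a, 1:] ^ k) (pull D) h = 0" if h: "h \<in> semi" and k: "n \<le> k" for h k
  proof (rule K.opoly_dvd_0[OF pull_lin])
    show "map_poly to_ac m dvd (\<Prod>a\<in>A. [:- a, 1:] ^ k)"
      by (rule dvd_trans[OF dv]) (intro prod_dvd_prod le_imp_power_dvd k)
    show "K.opoly (map_poly to_ac m) (pull D) h = 0"
      unfolding opoly_pull[OF lD h] by (simp add: fun_eq_iff pull_apply m(2) semi_simps[OF h])
  qed
  obtain B where B: "finite B" "independent B" "span B = UNIV" using fin_UNIV by (auto simp: fin_span_def)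
  \<comment> \<open>With this choice \<open>Suc (n' + n)\<close> equals \<open>n' + n'\<close>, so
    one exponent fits both the trace lemma and \<open>opoly_derivation_closure\<close>.\<close>
  define n' where "n' = Suc n"
  have "\<exists>k. \<forall>h\<in>semi. (pull D ^^ k) h = 0"
  proof (rule K.nilpotent_of_rational_traces[OF semi_fin_span pull_lin pull_semi[OF lD] A])
    show "K.opoly (\<Prod>a\<in>A. [:- a, 1:] ^ Suc (n' + n)) (pull D) h = 0" if "h \<in> semi" for h
      by (rule kill[OF that]) (simp add: n'_def)
    fix \<phi> :: "'a alg_closure \<Rightarrow> rat" and g
    assume \<phi>: "\<And>a b. \<phi> (a + b) = \<phi> a + \<phi> b"
      and g: "\<And>a. a \<in> A \<Longrightarrow> [:- a, 1:] ^ Suc (n' + n) dvd g - [:of_rat (\<phi> a):]"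
    define N where "N = degree g"
    have g': "[:- a, 1:] ^ (n' + n') dvd g - [:of_rat (\<phi> a):]" if "a \<in> A" for a
      using g[OF that] by (simp add: n'_def)
    have addg: "K.opoly g (pull D) h (x \<cdot> y)
        = K.opoly g (pull D) (\<lambda>x. h (x \<cdot> y)) x + K.opoly g (pull D) (\<lambda>y. h (x \<cdot> y)) y"
      if h: "h \<in> semi" for h x y
      by (rule opoly_derivation_closure[OF D A kill g' _ h])
        (simp_all add: n'_def \<phi> of_rat_add)
    show "K.trace_on semi (K.opoly (pCons 0 g) (pull D)) = 0"
    proof (rule ccontr)
      assume ne: "K.trace_on semi (K.opoly (pCons 0 g) (pull D)) \<noteq> 0"
      have vs: "vector_space (\<lambda>c (k :: 'a alg_closure). to_ac c * k)"
        by unfold_locales (simp_all add: algebra_simps)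
      obtain \<psi> where \<psi>_add: "\<And>x y. \<psi> (x + y) = \<psi> x + \<psi> y" and \<psi>_scale: "\<And>c x. \<psi> (to_ac c * x) = c * \<psi> x"
        and \<psi>1: "\<psi> (K.trace_on semi (K.opoly (pCons 0 g) (pull D))) = 1"
        by (rule ex_linear_functional[OF vs ne]) (rule that)
      have \<psi>_scale': "\<psi> (k * to_ac c) = \<psi> k * c" for k c
        using \<psi>_scale[of c k] by (simp only: mult.commute)
      have \<psi>0: "\<psi> 0 = 0" using \<psi>_scale[of 0 0] by simp
      have \<psi>_sum: "\<psi> (\<Sum>i\<in>I. h i) = (\<Sum>i\<in>I. \<psi> (h i))" for h :: "nat \<Rightarrow> 'a alg_closure" and I
        by (induction I rule: infinite_finite_induct) (simp_all add: \<psi>0 \<psi>_add)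
      define q where "q = map_poly \<psi> g"
      have cq: "coeff q i = \<psi> (coeff g i)" for i unfolding q_def by (rule coeff_map_poly[where f = \<psi>, OF \<psi>0])
      have dq: "degree q \<le> N" unfolding q_def N_def by (rule map_poly_degree_leq[where f = \<psi>])
      have "opoly q D (x \<cdot> y) = opoly q D x \<cdot> y + x \<cdot> opoly q D y" for x y
      proof -
        \<comment> \<open>The product rule is tested on each coordinate: there it is a linear
          relation between the coefficients with factors in the base field, and \<psi> preserves
          such relations.\<close>
        define z where "z = opoly q D (x \<cdot> y) - (opoly q D x \<cdot> y + x \<cdot> opoly q D y)"
        have "representation B z b = 0" for b
        proof -
          let ?r = "\<lambda>v. representation B v b"
          define h where "h = (\<lambda>v. to_ac (?r v))"
          have h: "h \<in> semi" unfolding h_def by (rule semi_coord[OF B(2,3)])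
          have rl: "?r (u + v) = ?r u + ?r v" "?r (u - v) = ?r u - ?r v" "?r (c *s u) = c * ?r u" for u v c
            by (simp_all add: representation_add[OF B(2)] representation_diff[OF B(2)]
                representation_scale[OF B(2)] B(3))
          have rs: "?r (\<Sum>i\<le>N. v i) = (\<Sum>i\<le>N. ?r (v i))" for v
            by (subst representation_sum[OF B(2)]) (simp_all add: B(3))
          let ?c = "\<lambda>i. ?r ((D ^^ i) (x \<cdot> y)) - (?r ((D ^^ i) x \<cdot> y) + ?r (x \<cdot> (D ^^ i) y))"
          have oq: "opoly q D v = (\<Sum>i\<le>N. \<psi> (coeff g i) *s (D ^^ i) v)" for v
            unfolding opoly_altdef_le[OF lD dq] cq ..
          have Lsum: "(\<Sum>i\<le>N. v i) \<cdot> y = (\<Sum>i\<le>N. v i \<cdot> y)" "x \<cdot> (\<Sum>i\<le>N. v i) = (\<Sum>i\<le>N. x \<cdot> v i)" for v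
            by (rule lin_sum[OF lin_R], rule lin_sum[OF lin_L])
          have "?r z = (\<Sum>i\<le>N. \<psi> (coeff g i) * ?c i)"
            unfolding z_def oq Lsum mult_simps rl rs
            by (simp only: right_diff_distrib distrib_left sum_subtractf sum.distrib)
          also have "\<dots> = \<psi> (\<Sum>i\<le>N. coeff g i * to_ac (?c i))"
            unfolding \<psi>_sum by (simp only: \<psi>_scale')
          also have "(\<Sum>i\<le>N. coeff g i * to_ac (?c i))
              = (\<Sum>i\<le>N. coeff g i * h ((D ^^ i) (x \<cdot> y)))
                - ((\<Sum>i\<le>N. coeff g i * h ((D ^^ i) x \<cdot> y)) + (\<Sum>i\<le>N. coeff g i * h (x \<cdot> (D ^^ i) y)))"
            by (simp only: h_def to_ac_diff to_ac_add right_diff_distrib distrib_left sum_subtractf sum.distrib)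
          also have "\<dots> = 0"
            using addg[OF h, of x y] unfolding K_opoly_altdef[OF order_refl] by (simp add: N_def)
          finally show ?thesis using \<psi>0 by simp
        qed
        moreover have "(\<Sum>b\<in>B. representation B z b *s b) = z"
          by (rule sum_representation_eq[OF B(2) _ B(1) order_refl]) (simp add: B(3))
        ultimately have "z = 0" by simp
        then show ?thesis by (simp add: z_def)
      qed
      then have "derivation_op (opoly q D)" by (simp add: derivation_op_def opoly_lin[OF lD])
      then have "trace_on UNIV (\<lambda>x. D (opoly q D x)) = 0" by (rule tr)
      moreover have "(\<lambda>x. D (opoly q D x)) = opoly (pCons 0 q) D" by (simp add: fun_eq_iff opoly_pCons[OF lD])
      ultimately have "trace_on UNIV (opoly (pCons 0 q) D) = 0" by simp
      moreover have "degree (pCons 0 q) \<le> Suc N" using dq degree_pCons_le[of 0 q] by linarith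
      ultimately have 0: "(\<Sum>i\<le>Suc N. coeff (pCons 0 q) i * trace_on UNIV (D ^^ i)) = 0"
        using trace_on_opoly_le[OF fin_UNIV lD, of "pCons 0 q" "Suc N"] by simp
      have dg: "degree (pCons 0 g) \<le> Suc N" using degree_pCons_le[of 0 g] N_def by simp
      have "K.trace_on semi (K.opoly (pCons 0 g) (pull D))
          = (\<Sum>i\<le>Suc N. coeff (pCons 0 g) i * K.trace_on semi (pull D ^^ i))"
        using K.trace_on_opoly_le[OF semi_fin_span pull_lin pull_semi[OF lD] dg] by simp
      also have "\<dots> = (\<Sum>i\<le>Suc N. coeff (pCons 0 g) i * to_ac (trace_on UNIV (D ^^ i)))"
        by (simp only: pull_funpow trace_on_pull[OF lin_funpow[OF lD]])
      finally have "\<psi> (K.trace_on semi (K.opoly (pCons 0 g) (pull D)))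
          = (\<Sum>i\<le>Suc N. \<psi> (coeff (pCons 0 g) i * to_ac (trace_on UNIV (D ^^ i))))" by (simp only: \<psi>_sum)
      also have "\<dots> = (\<Sum>i\<le>Suc N. coeff (pCons 0 q) i * trace_on UNIV (D ^^ i))"
      proof (rule sum.cong[OF refl])
        fix i
        have "coeff (pCons 0 q) i = \<psi> (coeff (pCons 0 g) i)" by (cases i) (simp_all add: cq \<psi>0)
        then show "\<psi> (coeff (pCons 0 g) i * to_ac (trace_on UNIV (D ^^ i))) = coeff (pCons 0 q) i * trace_on UNIV (D ^^ i)"
          using \<psi>_scale[of "trace_on UNIV (D ^^ i)" "coeff (pCons 0 g) i"] by (simp add: mult.commute)
      qed
      finally show False using 0 \<psi>1 by simp
    qed
  qed
  then obtain k where k: "\<And>h. h \<in> semi \<Longrightarrow> (pull D ^^ k) h = 0" by blast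
  have "(D ^^ k) x = 0" for x
  proof (rule semi_separates)
    fix h assume "h \<in> semi"
    then have "pull (D ^^ k) h x = 0" using k[of h] unfolding pull_funpow by simp
    then show "h ((D ^^ k) x) = 0" by (simp only: pull_apply)
  qed
  then show ?thesis by blast
qed

end

section \<open>Engel's theorem\<close>

definition app :: "('b \<Rightarrow> 'b) list \<Rightarrow> 'b \<Rightarrow> 'b" where
  "app fs x = foldr (\<lambda>f. f) fs x"

lemma app_Nil: "app [] x = x"
  and app_Cons: "app (f # fs) x = f (app fs x)"
  and app_append: "app (fs @ gs) x = app fs (app gs x)"
  by (simp_all add: app_def)

section \<open>Sets of operators with vanishing long products\<close>

context fd_algebra
begin

definition nil_set :: "('b \<Rightarrow> 'b) set \<Rightarrow> bool" where
  "nil_set S \<longleftrightarrow> (\<exists>n. \<forall>fs x. set fs \<subseteq> S \<longrightarrow> n \<le> length fs \<longrightarrow> app fs x = 0)"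

lemma app_lin: "(\<And>f. f \<in> S \<Longrightarrow> lin f) \<Longrightarrow> set fs \<subseteq> S \<Longrightarrow> lin (app fs)"
proof (induction fs)
  case Nil
  then show ?case by (auto intro: linI simp: app_Nil)
next
  case (Cons f fs)
  then have "lin (f \<circ> app fs)" by (intro lin_comp) auto
  then show ?case by (simp add: comp_def app_Cons[abs_def])
qed

lemma lin_span_E: "(\<And>f. f \<in> S \<Longrightarrow> lin f) \<Longrightarrow> f \<in> E.span S \<Longrightarrow> lin f"
proof -
  assume S: "\<And>f. f \<in> S \<Longrightarrow> lin f" and f: "f \<in> E.span S"
  have "E.span S \<subseteq> {f. lin f}"
    by (rule E.span_minimal[OF _ E.fin_span_subspace[OF fin_End]]) (use S in blast)
  then show "lin f" using f by blast
qed

text \<open>The filtration of the whole space by the images of the words with at least j letters from T is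
  preserved by s and raised by T, so that long words in T and s vanish.\<close>

lemma nil_set_insert:
  assumes T: "\<And>t. t \<in> T \<Longrightarrow> lin t" "nil_set T" and s: "lin s" "\<And>t. t \<in> T \<Longrightarrow> opcomm s t \<in> T"
    and n: "\<And>x. (s ^^ n) x = 0"
  shows "nil_set (insert s T)"
proof -
  obtain m where m: "\<And>fs x. set fs \<subseteq> T \<Longrightarrow> m \<le> length fs \<Longrightarrow> app fs x = 0"
    using T(2) unfolding nil_set_def by blast
  define F where "F j = span {app fs x | fs x. set fs \<subseteq> T \<and> j \<le> length fs}" for j
  have Fbase: "app fs x \<in> F j" if "set fs \<subseteq> T" "j \<le> length fs" for fs x j
    unfolding F_def by (rule span_base) (use that in blast)
  have tF: "t x \<in> F (Suc j)" if t: "t \<in> T" and x: "x \<in> F j" for t x j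
    unfolding F_def
  proof (rule lin_span_image[OF T(1)[OF t] _ subspace_span x[unfolded F_def]])
    fix y assume "y \<in> {app fs x | fs x. set fs \<subseteq> T \<and> j \<le> length fs}"
    then obtain fs z where "y = app fs z" "set fs \<subseteq> T" "j \<le> length fs" by blast
    then have "t y = app (t # fs) z" "set (t # fs) \<subseteq> T" "Suc j \<le> length (t # fs)"
      using t by (auto simp: app_Cons)
    then show "t y \<in> span {app fs x | fs x. set fs \<subseteq> T \<and> Suc j \<le> length fs}" by (intro span_base) blast
  qed
  have anti: "F j \<subseteq> F i" if "i \<le> j" for i j
    unfolding F_def by (rule span_mono) (use that in fastforce)
  have sapp: "s (app fs x) \<in> F (length fs)" if "set fs \<subseteq> T" for fs x
    using that
  proof (induction fs)
    case Nil
    have "app [] (s x) \<in> F 0" by (rule Fbase) auto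
    then show ?case by (simp add: app_Nil)
  next
    case (Cons t fs)
    then have t: "t \<in> T" and fs: "set fs \<subseteq> T" by auto
    have 1: "t (s (app fs x)) \<in> F (Suc (length fs))" by (rule tF[OF t Cons.IH[OF fs]])
    have "app (opcomm s t # fs) x \<in> F (Suc (length fs))" by (rule Fbase) (use s(2)[OF t] fs in auto)
    then have 2: "opcomm s t (app fs x) \<in> F (Suc (length fs))" by (simp add: app_Cons)
    have "s (app (t # fs) x) = t (s (app fs x)) + opcomm s t (app fs x)" by (simp add: app_Cons opcomm_def)
    then show ?case using span_add 1 2 unfolding F_def by simp
  qed
  have sF: "s x \<in> F j" if x: "x \<in> F j" for x j
    unfolding F_def
  proof (rule lin_span_image[OF s(1) _ subspace_span x[unfolded F_def]])
    fix y assume "y \<in> {app fs x | fs x. set fs \<subseteq> T \<and> j \<le> length fs}"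
    then obtain fs z where y: "y = app fs z" "set fs \<subseteq> T" "j \<le> length fs" by blast
    have "s y \<in> F j" unfolding y(1) using sapp[OF y(2)] anti[OF y(3)] by blast
    then show "s y \<in> span {app fs x | fs x. set fs \<subseteq> T \<and> j \<le> length fs}" by (simp only: F_def)
  qed
  have F0: "F j = UNIV" if "j = 0" for j
  proof -
    have "app [] x \<in> F j" for x by (rule Fbase) (use that in auto)
    then show ?thesis by (auto simp: app_Nil)
  qed
  have Fm: "F m \<subseteq> {0}"
    unfolding F_def by (rule span_minimal) (use m in auto)
  have keep: "app fs x \<in> F j" if "set fs \<subseteq> insert s T" "x \<in> F j" for fs x j
    using that
  proof (induction fs)
    case (Cons f fs)
    then have y: "app fs x \<in> F j" by simp
    show ?case
    proof (cases "f = s")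
      case True
      then show ?thesis using sF[OF y] by (simp add: app_Cons)
    next
      case False
      then have "f \<in> T" using Cons by auto
      then show ?thesis using tF[OF _ y, of f] anti[of j "Suc j"] by (auto simp: app_Cons)
    qed
  qed (simp add: app_Nil)
  \<comment> \<open>A block of \<open>n\<close> letters either is the \<open>n\<close>-th power of
    \<open>s\<close>, hence 0, or contains a letter from \<open>T\<close>, which raises the
    level.\<close>
  have up: "app fs x \<in> F (Suc j)" if "set fs \<subseteq> insert s T" "length fs = n" "x \<in> F j" for fs x j
  proof (cases "set fs \<subseteq> {s}")
    case True
    have "app fs x = (s ^^ length fs) x" if "set fs \<subseteq> {s}" for fs
      using that by (induction fs) (auto simp: app_Nil app_Cons)
    then have "app fs x = 0" using True that n by simp
    then show ?thesis by (simp add: F_def span_zero)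
  next
    case False
    then obtain t where "t \<in> set fs" "t \<in> T" using \<open>set fs \<subseteq> insert s T\<close> by auto
    then obtain gs hs where fs: "fs = gs @ t # hs" by (meson split_list)
    have sub: "set gs \<subseteq> insert s T" "set hs \<subseteq> insert s T" using that(1) fs by auto
    have "t (app hs x) \<in> F (Suc j)" by (rule tF[OF \<open>t \<in> T\<close> keep[OF sub(2) that(3)]])
    then show ?thesis using keep[OF sub(1)] by (simp add: fs app_append app_Cons)
  qed
  have pow: "app fs x \<in> F j" if "set fs \<subseteq> insert s T" "length fs = j * n" for fs x j
    using that
  proof (induction j arbitrary: fs)
    case 0
    then show ?case using F0 by simp
  next
    case (Suc j)
    let ?g = "take n fs" and ?h = "drop n fs"
    have len: "length ?g = n" "length ?h = j * n" using Suc.prems(2) by auto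
    have sub: "set ?g \<subseteq> insert s T" "set ?h \<subseteq> insert s T"
      using Suc.prems(1) set_take_subset[of n fs] set_drop_subset[of n fs] by blast+
    have "app ?g (app ?h x) \<in> F (Suc j)" by (rule up[OF sub(1) len(1) Suc.IH[OF sub(2) len(2)]])
    then show ?case by (simp add: app_append[symmetric])
  qed
  show ?thesis unfolding nil_set_def
  proof (intro exI[of _ "m * n"] allI impI)
    fix fs x assume fs: "set fs \<subseteq> insert s T" "m * n \<le> length fs"
    let ?g = "take (m * n) fs" and ?h = "drop (m * n) fs"
    have "set ?g \<subseteq> insert s T" using fs(1) set_take_subset[of "m * n" fs] by blast
    then have "app ?g (app ?h x) \<in> F m" by (rule pow) (use fs(2) in simp)
    then show "app fs x = 0" using Fm by (auto simp: app_append[symmetric])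
  qed
qed

lemma nil_set_subset: "nil_set S \<Longrightarrow> T \<subseteq> S \<Longrightarrow> nil_set T"
  unfolding nil_set_def by (meson subset_trans)

text \<open>The step up in the filtration by word length is a linear condition on the operator, so
  it extends from \<open>S\<close> to its span.\<close>

lemma nil_set_span:
  assumes S: "\<And>f. f \<in> S \<Longrightarrow> lin f" and nil: "nil_set S"
  shows "nil_set (E.span S)"
proof -
  obtain n where n: "\<And>fs x. set fs \<subseteq> S \<Longrightarrow> n \<le> length fs \<Longrightarrow> app fs x = 0"
    using nil unfolding nil_set_def by blast
  define F where "F j = span {app fs x | fs x. set fs \<subseteq> S \<and> j \<le> length fs}" for j
  have step: "f x \<in> F (Suc j)" if f: "f \<in> E.span S" and x: "x \<in> F j" for f x j
    using f
  proof (induction rule: E.span_induct_alt)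
    case base
    show ?case by (simp add: F_def span_zero)
  next
    case (step c g f)
    have "g x \<in> F (Suc j)" unfolding F_def
    proof (rule lin_span_image[OF S[OF step(1)] _ subspace_span x[unfolded F_def]])
      fix y assume "y \<in> {app fs x | fs x. set fs \<subseteq> S \<and> j \<le> length fs}"
      then obtain fs z where "y = app fs z" "set fs \<subseteq> S" "j \<le> length fs" by blast
      then have "g y = app (g # fs) z" "set (g # fs) \<subseteq> S" "Suc j \<le> length (g # fs)"
        using step(1) by (auto simp: app_Cons)
      then show "g y \<in> span {app fs x | fs x. set fs \<subseteq> S \<and> Suc j \<le> length fs}" by (intro span_base) blast
    qed
    then show ?case using step(2) unfolding F_def by (simp add: span_add span_scale scale_fun_apply)
  qed
  have "app fs x \<in> F (length fs)" if "set fs \<subseteq> E.span S" for fs x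
    using that
  proof (induction fs)
    case Nil
    have "app [] x \<in> F 0" unfolding F_def by (rule span_base) (auto intro!: exI[of _ "[]"])
    then show ?case by simp
  next
    case (Cons f fs)
    then show ?case using step[of f] by (simp add: app_Cons)
  qed
  moreover have "F j \<subseteq> {0}" if "n \<le> j" for j
    unfolding F_def by (rule span_minimal) (use n that in auto)
  ultimately show ?thesis unfolding nil_set_def by (metis singletonD subsetD)
qed

lemma opcomm_span:
  assumes S: "\<And>f. f \<in> S \<Longrightarrow> lin f" and cl: "\<And>f g. f \<in> S \<Longrightarrow> g \<in> S \<Longrightarrow> opcomm f g \<in> E.span S"
    and f: "f \<in> E.span S" and g: "g \<in> E.span S"
  shows "opcomm f g \<in> E.span S"
proof -
  have 1: "opcomm f g \<in> E.span S" if f: "f \<in> E.span S" and g: "g \<in> S" for f g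
  proof (rule E.lin_span_image[of "\<lambda>f. opcomm f g", OF _ cl[OF _ g] E.subspace_span f])
    show "E.lin (\<lambda>f. opcomm f g)"
      by (rule E.linI)
        (simp_all add: fun_eq_iff opcomm_def scale_fun_apply lin_add[OF S[OF g]] lin_scale[OF S[OF g]]
          scale_right_diff_distrib)
  qed
  have lf: "lin f" using lin_span_E[OF S f] by blast
  show ?thesis
  proof (rule E.lin_span_image[of "\<lambda>g. opcomm f g", OF _ 1[OF f] E.subspace_span g])
    show "E.lin (\<lambda>g. opcomm f g)"
      by (rule E.linI)
        (simp_all add: fun_eq_iff opcomm_def scale_fun_apply lin_add[OF lf] lin_scale[OF lf]
          scale_right_diff_distrib)
  qed
qed

text \<open>\<open>S\<close> is closed under commutators but need not be a subspace. A
  commutator-closed nil subset of maximal dimension is enlarged by an element that it normalises,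
  unless it is all of \<open>S\<close>.\<close>

lemma engel_jacobson:
  assumes lin: "\<And>f. f \<in> S \<Longrightarrow> lin f" and cl: "\<And>f g. f \<in> S \<Longrightarrow> g \<in> S \<Longrightarrow> opcomm f g \<in> S"
    and nil: "\<And>f. f \<in> S \<Longrightarrow> \<exists>n. \<forall>x. (f ^^ n) x = 0"
  shows "nil_set S"
proof -
  obtain C where C: "finite C" "E.independent C" "E.span C = {f. lin f}"
    using fin_End by (auto simp: E.fin_span_def)
  \<comment> \<open>Saturation, that is, containing \<open>S \<inter> E.span T\<close>, turns an
    element of \<open>S\<close> outside \<open>T\<close> into one outside its span, so that
    enlarging \<open>T\<close> raises the dimension.\<close>
  let ?ok = "\<lambda>T. T \<subseteq> S \<and> S \<inter> E.span T \<subseteq> T \<and> nil_set T \<and> (\<forall>f\<in>T. \<forall>g\<in>T. opcomm f g \<in> T)"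
  define P where "P = (\<lambda>n. \<exists>T B. ?ok T \<and> B \<subseteq> T \<and> E.independent B \<and> T \<subseteq> E.span B \<and> card B = n)"
  have bound: "finite B \<and> card B \<le> card C" if "B \<subseteq> S" "E.independent B" for B
    by (rule E.independent_span_bound[OF C(1) that(2)]) (use that lin C(3) in blast)
  \<comment> \<open>The start is \<open>S \<inter> {0}\<close>: zero need not belong to
    \<open>S\<close>, but must be included by saturation if it does.\<close>
  have P0: "P 0"
    unfolding P_def
  proof (intro exI conjI)
    show "S \<inter> {0} \<subseteq> S" by blast
    show "S \<inter> E.span (S \<inter> {0}) \<subseteq> S \<inter> {0}"
      using E.span_minimal[of "S \<inter> {0}" "{0}"] by auto
    show "nil_set (S \<inter> {0})"
      unfolding nil_set_def
    proof (intro exI[of _ 1] allI impI)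
      fix fs and x :: 'b assume fs: "set fs \<subseteq> S \<inter> {0}" "1 \<le> length fs"
      then obtain f gs where "fs = f # gs" by (cases fs) auto
      then show "app fs x = 0" using fs by (auto simp: app_Cons)
    qed
    show "\<forall>f\<in>S \<inter> {0}. \<forall>g\<in>S \<inter> {0}. opcomm f g \<in> S \<inter> {0}"
    proof (intro ballI)
      fix f g assume fg: "f \<in> S \<inter> {0}" "g \<in> S \<inter> {0}"
      have "opcomm f g = f"
      proof
        have "f = 0" "g = 0" using fg by blast+
        then show "opcomm f g x = f x" for x unfolding opcomm_def by simp
      qed
      then show "opcomm f g \<in> S \<inter> {0}" using fg(1) by (simp only:)
    qed
    show "{} \<subseteq> S \<inter> {0}" "E.independent {}" "S \<inter> {0} \<subseteq> E.span {}" "card {} = (0::nat)"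
      by (auto simp: E.independent_empty)
  qed
  have le: "\<forall>n. P n \<longrightarrow> n \<le> card C"
  proof (intro allI impI)
    fix n assume "P n"
    then obtain T B where "T \<subseteq> S" "B \<subseteq> T" "E.independent B" "card B = n" unfolding P_def by blast
    then show "n \<le> card C" using bound[of B] by auto
  qed
  define N where "N = Greatest P"
  have N: "P N" unfolding N_def by (rule GreatestI_nat[of P 0 "card C"]) (use P0 le in auto)
  have max: "n \<le> N" if "P n" for n
    unfolding N_def by (rule Greatest_le_nat[of P n "card C"]) (use that le in auto)
  obtain T B where TS: "T \<subseteq> S" and T: "S \<inter> E.span T \<subseteq> T" "nil_set T" "\<forall>f\<in>T. \<forall>g\<in>T. opcomm f g \<in> T" and B: "B \<subseteq> T" "E.independent B" "T \<subseteq> E.span B" "card B = N"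
    using N unfolding P_def by blast
  have linT: "lin t" if "t \<in> T" for t using lin TS that by blast
  have "S \<subseteq> T"
  proof (rule ccontr)
    assume nST: "\<not> S \<subseteq> T"
    obtain m where m: "\<And>fs x. set fs \<subseteq> T \<Longrightarrow> m \<le> length fs \<Longrightarrow> app fs x = 0"
      using T(2) unfolding nil_set_def by blast
    \<comment> \<open>Measures how many letters of \<open>T\<close> around \<open>f\<close> suffice
      to kill it. Twice the nil index of \<open>T\<close> always does, one side then being long
      enough; an element of \<open>S - T\<close> with the least such number is chosen.\<close>
    let ?N = "\<lambda>k f. \<forall>fs gs x. set fs \<subseteq> T \<longrightarrow> set gs \<subseteq> T \<longrightarrow> length fs + length gs = k \<longrightarrow> app fs (f (app gs x)) = 0"
    have app0: "app fs 0 = 0" if "set fs \<subseteq> T" for fs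
      using lin_0[OF app_lin[OF linT that]] .
    have "?N (m + m) f" if "f \<in> S" for f
    proof (intro allI impI)
      fix fs gs x assume fg: "set fs \<subseteq> T" "set gs \<subseteq> T" "length fs + length gs = m + m"
      show "app fs (f (app gs x)) = 0"
      proof (cases "m \<le> length fs")
        case True
        then show ?thesis using m fg by blast
      next
        case False
        then have "app gs x = 0" using m fg by auto
        then show ?thesis using lin_0[OF lin[OF that]] app0[OF fg(1)] by simp
      qed
    qed
    note N2 = this
    define R where "R = (\<lambda>k. \<exists>f\<in>S - T. ?N k f)"
    define k where "k = (LEAST k. R k)"
    obtain f0 where f0: "f0 \<in> S" "f0 \<notin> T" using nST by blast
    have "R (m + m)" unfolding R_def by (rule bexI[of _ f0]) (use N2[OF f0(1)] f0 in auto)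
    then have "R k" unfolding k_def by (rule LeastI)
    then obtain s where s: "s \<in> S" "s \<notin> T" and Ns: "?N k s" unfolding R_def by (elim bexE DiffE)
    have kmin: "\<not> R j" if "j < k" for j using not_less_Least[of j R] that unfolding k_def by simp
    \<comment> \<open>Otherwise this commutator is an element of \<open>S - T\<close> needing fewer
      letters, as \<open>t\<close> has joined the surrounding ones. If the number is 0, then
      \<open>s\<close> = 0, against saturation.\<close>
    have st: "opcomm t s \<in> T" if t: "t \<in> T" for t
    proof (rule ccontr)
      assume no: "opcomm t s \<notin> T"
      have "opcomm t s \<in> S - T" using cl TS t s no by blast
      show False
      proof (cases k)
        case 0
        have "s x = 0" for x using Ns[rule_format, of "[]" "[]" x] 0 by (simp add: app_Nil)
        then have "s = 0" by (simp add: fun_eq_iff)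
        then have "s \<in> E.span T" by (simp add: E.span_zero)
        then show False using s T(1) by blast
      next
        case (Suc j)
        have "?N j (opcomm t s)"
        proof (intro allI impI)
          fix fs gs x assume fg: "set fs \<subseteq> T" "set gs \<subseteq> T" "length fs + length gs = j"
          have "app (fs @ [t]) (s (app gs x)) = 0" "app fs (s (app (t # gs) x)) = 0"
            by (rule Ns[rule_format]; use fg t Suc in simp)+
          then show "app fs (opcomm t s (app gs x)) = 0"
            using lin_diff[OF app_lin[OF linT fg(1)]]
            by (simp add: opcomm_def app_append app_Cons app_Nil)
        qed
        then have "R j" unfolding R_def using \<open>opcomm t s \<in> S - T\<close> by (rule bexI)
        then show False using kmin[of j] Suc by simp
      qed
    qed
    have neg: "opcomm g f = scale_fun scale (- 1) (opcomm f g)" for f g :: "'b \<Rightarrow> 'b"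
      by (simp add: fun_eq_iff opcomm_def scale_fun_apply)
    have st': "opcomm s t \<in> T" if "t \<in> T" for t
    proof -
      have "opcomm s t \<in> E.span T" unfolding neg[of s t] using st[OF that] by (intro E.span_scale E.span_base)
      moreover have "opcomm s t \<in> S" using cl s TS that by blast
      ultimately show ?thesis using T(1) by blast
    qed
    obtain n where n: "\<And>x. (s ^^ n) x = 0" using nil s by blast
    have nil1: "nil_set (insert s T)" by (rule nil_set_insert[OF linT T(2) lin[OF s(1)] st' n])
    \<comment> \<open>Restores saturation after \<open>s\<close> has been added; the nil property
      survives by \<open>nil_set_span\<close>.\<close>
    define T' where "T' = S \<inter> E.span (insert s T)"
    have sub: "insert s T \<subseteq> T'" unfolding T'_def using s TS E.span_superset by blast
    have sp: "E.span T' = E.span (insert s T)"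
    proof
      show "E.span T' \<subseteq> E.span (insert s T)" by (rule E.span_minimal) (simp_all add: T'_def)
      show "E.span (insert s T) \<subseteq> E.span T'" by (rule E.span_mono[OF sub])
    qed
    have lin1: "lin f" if "f \<in> insert s T" for f using that lin TS s by blast
    have ss: "opcomm s s = 0" by (simp add: opcomm_def fun_eq_iff)
    have cl1: "opcomm f g \<in> E.span (insert s T)" if fg: "f \<in> insert s T" "g \<in> insert s T" for f g
    proof -
      have "opcomm f g \<in> insert 0 T" using fg st st' T(3) ss by auto
      then show ?thesis
      proof (rule insertE)
        show ?thesis if "opcomm f g = 0" unfolding that by (rule E.span_zero)
        show ?thesis if "opcomm f g \<in> T" by (rule E.span_base) (use that in simp)
      qed
    qed
    have "P (Suc N)"
      unfolding P_def
    proof (intro exI conjI)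
      show "T' \<subseteq> S" by (simp add: T'_def)
      show "S \<inter> E.span T' \<subseteq> T'" unfolding sp by (simp add: T'_def)
      show "nil_set T'"
        by (rule nil_set_subset[OF nil_set_span[OF lin1 nil1]]) (auto simp: T'_def)
      show "\<forall>f\<in>T'. \<forall>g\<in>T'. opcomm f g \<in> T'"
      proof (intro ballI)
        fix f g assume f: "f \<in> T'" and g: "g \<in> T'"
        have "opcomm f g \<in> S" by (rule cl) (use f g in \<open>simp_all add: T'_def\<close>)
        moreover have "opcomm f g \<in> E.span (insert s T)"
          by (rule opcomm_span[OF lin1 cl1]) (use f g in \<open>simp_all add: T'_def\<close>)
        ultimately show "opcomm f g \<in> T'" by (simp add: T'_def)
      qed
      have sB: "s \<notin> E.span B" using E.span_mono[OF B(1)] s T(1) by blast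
      then show "E.independent (insert s B)" by (rule E.independent_insertI[OF _ B(2)])
      show "insert s B \<subseteq> T'" using sub B(1) by blast
      have "insert s T \<subseteq> E.span (insert s B)"
      proof (rule insert_subsetI)
        show "s \<in> E.span (insert s B)" by (rule E.span_base) simp
        show "T \<subseteq> E.span (insert s B)" by (rule subset_trans[OF B(3) E.span_mono]) blast
      qed
      then have "E.span (insert s T) \<subseteq> E.span (insert s B)" by (rule E.span_minimal) simp
      then show "T' \<subseteq> E.span (insert s B)" by (auto simp: T'_def)
      have "finite B" using bound[of B] B TS by blast
      moreover have "s \<notin> B" using sB E.span_base[of s B] by metis
      ultimately show "card (insert s B) = Suc N" using B(4) by simp
    qed
    from max[OF this] show False by simp
  qed
  then show ?thesis using T(2) nil_set_subset by blast
qed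

end

section \<open>Inner derivations and nilpotency of the action of V'\<close>

context comm_alt_algebra
begin

definition inner_der :: "('b \<Rightarrow> 'b) set" where
  "inner_der = E.span {triple_comm a b | a b. a \<in> V' \<and> b \<in> V'}"

lemma inner_der_props:
  assumes "D \<in> inner_der"
  shows "derivation_op D" "\<And>a. a \<in> V \<Longrightarrow> D a \<in> V'"
proof -
  have "derivation_op D \<and> (\<forall>a\<in>V. D a \<in> V')"
    using assms unfolding inner_der_def
  proof (induction rule: E.span_induct_alt)
    case base
    show ?case by (auto simp: derivation_op_def mult_simps subspace_0[OF V'_subspace] intro: linI)
  next
    case (step c T D)
    then obtain a b where T: "T = triple_comm a b" "a \<in> V" "b \<in> V" using V'_V by blast
    have "lin D" using step by (simp add: derivation_op_def)
    then have "lin (scale_fun scale c T + D)"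
      using lin_add_fun[OF lin_scale_fun[OF triple_lin[of a b], of c], of D]
      by (simp add: T plus_fun_def scale_fun_def)
    moreover have "D (x \<cdot> y) = D x \<cdot> y + x \<cdot> D y" for x y using step by (simp add: derivation_op_def)
    ultimately have "derivation_op (scale_fun scale c T + D)"
      by (simp add: derivation_op_def scale_fun_apply T derivation[OF T(2,3)] mult_simps scale_right_distrib)
    moreover have "(scale_fun scale c T + D) d \<in> V'" if "d \<in> V" for d
      using triple_V'[OF T(2,3) that] step that
      by (simp add: scale_fun_apply T subspace_add[OF V'_subspace] subspace_scale[OF V'_subspace])
    ultimately show ?case by blast
  qed
  then show "derivation_op D" "\<And>a. a \<in> V \<Longrightarrow> D a \<in> V'" by auto
qed

text \<open>Squares of nilpotent operators have trace 0; polarise.\<close>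

lemma trace_on_V'_zero:
  assumes a: "a \<in> V'" and b: "b \<in> V'"
  shows "trace_on UNIV (\<lambda>x. a \<cdot> (b \<cdot> x)) = 0"
proof -
  have sq: "trace_on UNIV (\<lambda>x. c \<cdot> (c \<cdot> x)) = 0" if c: "c \<in> V'" for c
  proof -
    obtain n where n: "\<And>x. (L c ^^ n) x = 0" using V'_nilpotent[OF c] by blast
    have "((L c \<circ> L c) ^^ n) x = 0" for x
      using funpow_comp_commute[of "L c" "L c" n x] n by simp
    then show ?thesis
      using trace_on_UNIV_nilpotent[OF lin_comp[OF lin_L lin_L], of n c c] by (simp add: comp_def)
  qed
  have "0 = trace_on UNIV (\<lambda>x. (a + b) \<cdot> ((a + b) \<cdot> x))" using sq subspace_add[OF V'_subspace a b] by simp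
  also have "\<dots> = trace_on UNIV (\<lambda>x. (a \<cdot> (a \<cdot> x) + a \<cdot> (b \<cdot> x)) + (b \<cdot> (a \<cdot> x) + b \<cdot> (b \<cdot> x)))"
    by (simp add: mult_simps algebra_simps)
  also have "\<dots> = (trace_on UNIV (\<lambda>x. a \<cdot> (a \<cdot> x)) + trace_on UNIV (\<lambda>x. a \<cdot> (b \<cdot> x)))
      + (trace_on UNIV (\<lambda>x. b \<cdot> (a \<cdot> x)) + trace_on UNIV (\<lambda>x. b \<cdot> (b \<cdot> x)))"
    by (simp add: trace_on_add[OF fin_UNIV] lin_LL lin_add_fun)
  also have "trace_on UNIV (\<lambda>x. b \<cdot> (a \<cdot> x)) = trace_on UNIV (\<lambda>x. a \<cdot> (b \<cdot> x))" by (rule trace_on_UNIV_comm[OF lin_L lin_L])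
  finally show ?thesis using sq[OF a] sq[OF b] by simp
qed

text \<open>By cyclicity the trace of [L a, L b] d equals that of L a [L b, d], and [L b, d] is -
  L(d b) for the derivation \<open>d\<close>; apply \<open>trace_on_V'_zero\<close>.\<close>

lemma inner_der_trace:
  assumes D: "D \<in> inner_der" and d: "derivation_op d" "\<And>a. a \<in> V' \<Longrightarrow> d a \<in> V'"
  shows "trace_on UNIV (\<lambda>x. D (d x)) = 0"
proof -
  have ld: "lin d" and der: "\<And>x y. d (x \<cdot> y) = d x \<cdot> y + x \<cdot> d y" using d(1) by (auto simp: derivation_op_def)
  have lcd: "lin (\<lambda>x. f (d x))" if "lin f" for f using lin_comp[OF that ld] by (simp add: comp_def)
  have "lin D \<and> trace_on UNIV (\<lambda>x. D (d x)) = 0"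
    using D unfolding inner_der_def
  proof (induction rule: E.span_induct_alt)
    case base
    have "lin (\<lambda>x. 0)" by (rule linI) simp_all
    then show ?case using trace_on_UNIV_nilpotent[of "\<lambda>x. 0" 1] by (simp add: zero_fun_def)
  next
    case (step c T D)
    then obtain a b where T: "T = triple_comm a b" "a \<in> V'" "b \<in> V'" by blast
    have lD: "lin D" using step by simp
    have l1: "lin (\<lambda>x. b \<cdot> d x)" "lin (\<lambda>x. a \<cdot> d x)" "lin (\<lambda>x. a \<cdot> (b \<cdot> d x))" "lin (\<lambda>x. b \<cdot> (a \<cdot> d x))"
      using lcd lin_L lin_LL by blast+
    have ldb: "lin (\<lambda>x. d (b \<cdot> x))" using lin_comp[OF ld lin_L] by (simp add: comp_def)
    have l2: "lin (\<lambda>x. a \<cdot> d (b \<cdot> x))" using lin_comp[OF lin_L ldb] by (simp add: comp_def)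
    have "trace_on UNIV (\<lambda>x. T (d x)) = trace_on UNIV (\<lambda>x. a \<cdot> (b \<cdot> d x) - b \<cdot> (a \<cdot> d x))"
      by (simp add: T triple_comm_def)
    also have "\<dots> = trace_on UNIV (\<lambda>x. a \<cdot> (b \<cdot> d x)) - trace_on UNIV (\<lambda>x. b \<cdot> (a \<cdot> d x))"
      by (rule trace_on_diff[OF fin_UNIV l1(3) _ l1(4)]) simp_all
    also have "trace_on UNIV (\<lambda>x. b \<cdot> (a \<cdot> d x)) = trace_on UNIV (\<lambda>x. a \<cdot> d (b \<cdot> x))"
      by (rule trace_on_UNIV_comm[OF lin_L l1(2)])
    also have "trace_on UNIV (\<lambda>x. a \<cdot> (b \<cdot> d x)) - \<dots> = trace_on UNIV (\<lambda>x. a \<cdot> (b \<cdot> d x) - a \<cdot> d (b \<cdot> x))"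
      by (rule trace_on_diff[OF fin_UNIV l1(3) _ l2, symmetric]) simp_all
    also have "(\<lambda>x. a \<cdot> (b \<cdot> d x) - a \<cdot> d (b \<cdot> x)) = (\<lambda>x. (- 1) *s (a \<cdot> (d b \<cdot> x)))"
      by (simp add: fun_eq_iff der mult_simps)
    also have "trace_on UNIV \<dots> = (- 1) * trace_on UNIV (\<lambda>x. a \<cdot> (d b \<cdot> x))"
      by (rule trace_on_scale[OF fin_UNIV lin_LL]) simp
    also have "\<dots> = 0" using trace_on_V'_zero[OF T(2) d(2)[OF T(3)]] by simp
    finally have T0: "trace_on UNIV (\<lambda>x. T (d x)) = 0" .
    have lT: "lin T" unfolding T(1) by (rule triple_lin)
    have "lin (scale_fun scale c T + D)"
      using lin_add_fun[OF lin_scale_fun[OF lT] lD] by (simp add: plus_fun_def scale_fun_def)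
    moreover have "trace_on UNIV (\<lambda>x. (scale_fun scale c T + D) (d x))
        = trace_on UNIV (\<lambda>x. c *s T (d x)) + trace_on UNIV (\<lambda>x. D (d x))"
      unfolding plus_fun_apply scale_fun_apply
      by (rule trace_on_add[OF fin_UNIV lin_scale_fun[OF lcd[OF lT]] _ lcd[OF lD]]) simp_all
    moreover have "trace_on UNIV (\<lambda>x. c *s T (d x)) = c * trace_on UNIV (\<lambda>x. T (d x))"
      by (rule trace_on_scale[OF fin_UNIV lcd[OF lT]]) simp
    ultimately have "trace_on UNIV (\<lambda>x. (scale_fun scale c T + D) (d x)) = 0" using step T0 by simp
    with \<open>lin (scale_fun scale c T + D)\<close> show ?case by (rule conjI)
  qed
  then show ?thesis by blast
qed

lemma inner_der_nilpotent:
  assumes D: "D \<in> inner_der"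
  shows "\<exists>n. \<forall>x. (D ^^ n) x = 0"
proof (rule derivation_nilpotent[OF inner_der_props(1)[OF D]])
  fix p assume p: "derivation_op (opoly p D)"
  have lD: "lin D" using inner_der_props(1)[OF D] by (simp add: derivation_op_def)
  show "trace_on UNIV (\<lambda>x. D (opoly p D x)) = 0"
  proof (rule inner_der_trace[OF D p])
    fix a assume a: "a \<in> V'"
    show "opoly p D a \<in> V'"
      by (rule opoly_mem[OF lD V'_subspace _ a]) (use inner_der_props(2)[OF D] V'_V in blast)
  qed
qed

lemma inner_der_commutator:
  assumes D: "D \<in> inner_der" and D': "D' \<in> inner_der"
  shows "opcomm D D' \<in> inner_der"
proof -
  have d: "derivation_op D" "\<And>a. a \<in> V \<Longrightarrow> D a \<in> V'" using inner_der_props[OF D] by auto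
  have lD: "lin D" and der: "\<And>x y. D (x \<cdot> y) = D x \<cdot> y + x \<cdot> D y" using d(1) by (auto simp: derivation_op_def)
  have K: "E.subspace inner_der" by (simp add: inner_der_def)
  show ?thesis
  proof (rule E.lin_span_image[of "opcomm D", OF _ _ K D'[unfolded inner_der_def]])
    show "E.lin (opcomm D)"
      by (rule E.linI)
        (simp_all add: fun_eq_iff opcomm_def scale_fun_apply lin_add[OF lD] lin_scale[OF lD] scale_right_diff_distrib)
    fix T assume "T \<in> {triple_comm a b | a b. a \<in> V' \<and> b \<in> V'}"
    then obtain a b where T: "T = triple_comm a b" "a \<in> V'" "b \<in> V'" by blast
    have "triple_comm (D a) b \<in> inner_der" "triple_comm a (D b) \<in> inner_der"
      unfolding inner_der_def by (rule E.span_base; use d(2) V'_V T in blast)+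
    then have "triple_comm (D a) b + triple_comm a (D b) \<in> inner_der" by (rule E.subspace_add[OF K])
    moreover have "opcomm D T = triple_comm (D a) b + triple_comm a (D b)"
      by (simp add: fun_eq_iff opcomm_def T triple_comm_def der lin_diff[OF lD] mult_simps)
    ultimately show "opcomm D T \<in> inner_der" by simp
  qed
qed

lemma nil_V': "nil_set (L ` V')"
proof -
  have "nil_set (L ` V' \<union> inner_der)"
  proof (rule engel_jacobson)
    show "lin f" if "f \<in> L ` V' \<union> inner_der" for f
      using that inner_der_props(1) lin_L by (auto simp: derivation_op_def)
    show "\<exists>n. \<forall>x. (f ^^ n) x = 0" if "f \<in> L ` V' \<union> inner_der" for f
      using that V'_nilpotent inner_der_nilpotent by blast
    have ab: "opcomm (L a) (L b) \<in> inner_der" if "a \<in> V'" "b \<in> V'" for a b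
    proof -
      have "opcomm (L a) (L b) = triple_comm a b" by (simp add: fun_eq_iff opcomm_def triple_comm_def)
      then show ?thesis unfolding inner_der_def using that by (intro E.span_base) blast
    qed
    have Da: "opcomm D (L a) \<in> L ` V'" "opcomm (L a) D \<in> L ` V'" if "D \<in> inner_der" "a \<in> V'" for D a
    proof -
      have "D a \<in> V'" using inner_der_props(2) V'_V that by blast
      moreover then have "- D a \<in> V'" by (rule subspace_neg[OF V'_subspace])
      moreover have "opcomm D (L a) = L (D a)" "opcomm (L a) D = L (- D a)"
        using inner_der_props(1)[OF that(1)] by (simp_all add: fun_eq_iff opcomm_def derivation_op_def mult_simps)
      ultimately show "opcomm D (L a) \<in> L ` V'" "opcomm (L a) D \<in> L ` V'" by simp_all
    qed
    show "opcomm f g \<in> L ` V' \<union> inner_der" if "f \<in> L ` V' \<union> inner_der" "g \<in> L ` V' \<union> inner_der" for f g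
      using that ab Da inner_der_commutator by blast
  qed
  then show ?thesis by (rule nil_set_subset) blast
qed

end

section \<open>The decomposition\<close>

context comm_alt_algebra
begin

definition U :: "nat \<Rightarrow> ('b \<Rightarrow> 'b) set" where
  "U n = E.span {app fs | fs. set fs \<subseteq> L ` V' \<and> n \<le> length fs}"

lemma U_subspace: "E.subspace (U n)"
  by (simp add: U_def)

lemma U_app: "set fs \<subseteq> L ` V' \<Longrightarrow> n \<le> length fs \<Longrightarrow> app fs \<in> U n"
  unfolding U_def by (rule E.span_base) blast

lemma U_mono: "m \<le> n \<Longrightarrow> U n \<subseteq> U m"
  unfolding U_def by (rule E.span_mono) fastforce

lemma U_comp:
  assumes T: "T \<in> U m" and T': "T' \<in> U n"
  shows "T \<circ> T' \<in> U (m + n)"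
proof (rule E.lin_span_image[OF E_lin_comp_right[of T'] _ U_subspace T[unfolded U_def]])
  fix f assume "f \<in> {app fs | fs. set fs \<subseteq> L ` V' \<and> m \<le> length fs}"
  then obtain fs where f: "f = app fs" "set fs \<subseteq> L ` V'" "m \<le> length fs" by blast
  have lf: "lin f" using app_lin[of "L ` V'" fs] lin_L f by blast
  show "f \<circ> T' \<in> U (m + n)"
  proof (rule E.lin_span_image[OF E_lin_comp_left[OF lf] _ U_subspace T'[unfolded U_def]])
    fix g assume "g \<in> {app fs | fs. set fs \<subseteq> L ` V' \<and> n \<le> length fs}"
    then obtain gs where g: "g = app gs" "set gs \<subseteq> L ` V'" "n \<le> length gs" by blast
    have "f \<circ> g = app (fs @ gs)" by (simp add: fun_eq_iff f g app_append)
    moreover have "app (fs @ gs) \<in> U (m + n)" by (rule U_app) (use f g in auto)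
    ultimately show "f \<circ> g \<in> U (m + n)" by simp
  qed
qed

lemma U_L: "a \<in> V' \<Longrightarrow> L a \<in> U 1"
proof -
  assume "a \<in> V'"
  then have "app [L a] \<in> U 1" by (intro U_app) auto
  moreover have "app [L a] = L a" by (simp add: fun_eq_iff app_Cons app_Nil)
  ultimately show "L a \<in> U 1" by simp
qed

lemma U_zero:
  obtains m where "m > 0" "\<And>n T. m \<le> n \<Longrightarrow> T \<in> U n \<Longrightarrow> T = 0"
proof -
  obtain m where m: "\<And>fs x. set fs \<subseteq> L ` V' \<Longrightarrow> m \<le> length fs \<Longrightarrow> app fs x = 0"
    using nil_V' unfolding nil_set_def by blast
  have "T = 0" if "Suc m \<le> n" "T \<in> U n" for n T
  proof -
    have "U n \<subseteq> {0}"
      unfolding U_def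
    proof (rule E.span_minimal)
      show "{app fs | fs. set fs \<subseteq> L ` V' \<and> n \<le> length fs} \<subseteq> {0}"
        using m that(1) by (auto simp: fun_eq_iff)
    qed simp
    then show ?thesis using that(2) by blast
  qed
  then show ?thesis using that[of "Suc m"] by simp
qed

lemma L_triple_op:
  assumes "a \<in> V" "b \<in> V" "c \<in> V"
  shows "L (triple_comm a b c)
    = (((L a \<circ> L b) \<circ> L c) - ((L b \<circ> L a) \<circ> L c)) - ((L c \<circ> (L a \<circ> L b)) - (L c \<circ> (L b \<circ> L a)))"
  using L_triple[OF assms] by (simp add: fun_eq_iff triple_comm_def mult_simps)

lemma U_triple:
  assumes "a \<in> V" "b \<in> V" "c \<in> V" "L a \<in> U i" "L b \<in> U j" "L c \<in> U k"
  shows "L (triple_comm a b c) \<in> U (i + j + k)"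
proof -
  have 1: "(L a \<circ> L b) \<circ> L c \<in> U (i + j + k)" by (intro U_comp assms)
  have "(L b \<circ> L a) \<circ> L c \<in> U (j + i + k)" by (intro U_comp assms)
  then have 2: "(L b \<circ> L a) \<circ> L c \<in> U (i + j + k)" by (simp only: add.commute[of j i])
  have "L c \<circ> (L a \<circ> L b) \<in> U (k + (i + j))" by (intro U_comp assms)
  then have 3: "L c \<circ> (L a \<circ> L b) \<in> U (i + j + k)" by (simp only: add.commute[of k])
  have "L c \<circ> (L b \<circ> L a) \<in> U (k + (j + i))" by (intro U_comp assms)
  then have 4: "L c \<circ> (L b \<circ> L a) \<in> U (i + j + k)" by (simp only: add.commute[of k] add.commute[of j i])
  show ?thesis unfolding L_triple_op[OF assms(1-3)]
    by (intro E.subspace_diff[OF U_subspace] 1 2 3 4)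
qed

text \<open>A letter may take as its weight any positive depth of its left multiplication in the
  chain \<open>U\<close>. This makes weights add up under the triple product by
  \<open>L_triple\<close>, although [a,b,c] is a single letter.\<close>

sublocale W1: letters scale mult e V "\<lambda>w b. 0 < w \<and> b \<in> V' \<and> L b \<in> U w"
proof
  fix u v w a b c
  assume a: "0 < u \<and> a \<in> V' \<and> L a \<in> U u" and b: "0 < v \<and> b \<in> V' \<and> L b \<in> U v"
    and c: "0 < w \<and> c \<in> V' \<and> L c \<in> U w"
  then show "0 < u + v + w \<and> triple_comm a b c \<in> V' \<and> L (triple_comm a b c) \<in> U (u + v + w)"
    using triple_V' U_triple V'_V by auto
qed (use V'_V in blast)

lemma V'_PG: "b \<in> V' \<Longrightarrow> b \<in> W1.PG 1"
proof -
  assume b: "b \<in> V'"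
  have "W1.wd (Suc 0) (0 + 1) (L b \<circ> L e)"
    by (intro word.intros e_Z) (use b U_L in auto)
  then have "L b \<circ> L e \<in> W1.SG 1" by (rule W1.SG_I) simp
  moreover have "L b \<circ> L e = L b" by (simp add: fun_eq_iff)
  ultimately show "b \<in> W1.PG 1" unfolding W1.PG_SG by simp
qed

lemma Z_PG: "z \<in> Z \<Longrightarrow> z \<in> W1.PG 0"
  unfolding W1.PG_SG by (rule W1.SG_I[OF word.base]) simp_all

lemma PG_mono: "m \<le> n \<Longrightarrow> W1.PG n \<subseteq> W1.PG m"
proof -
  assume "m \<le> n"
  then have "W1.SG n \<subseteq> W1.SG m" unfolding W1.SG_def by (intro E.span_mono) (auto intro: le_trans)
  then show ?thesis unfolding W1.PG_def by blast
qed

lemma PG_0: "W1.PG 0 = UNIV"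
proof (rule W1.PG_UNIV, rule subsetI)
  fix a assume "a \<in> V"
  then obtain u where u: "u \<in> Q" "a - u \<in> V'" by (rule V_split)
  have "u \<in> W1.PG 0" using u(1) Q_Z Z_PG by blast
  moreover have "a - u \<in> W1.PG 0" using V'_PG[OF u(2)] PG_mono[of 0 1] by blast
  ultimately have "u + (a - u) \<in> W1.PG 0" by (rule subspace_add[OF W1.PG_subspace])
  then show "a \<in> W1.PG 0" by simp
qed

text \<open>Only one central factor occurs in a word, at its right end; the letters before it
  contribute depth at least their total weight.\<close>

lemma word_factor: "W1.wd k w T \<Longrightarrow> \<exists>z\<in>Z. \<exists>T'\<in>U w. T = T' \<circ> L z"
proof (induction rule: word.induct)
  case (base z k)
  have "app [] \<in> U 0" by (rule U_app) auto
  moreover have "L z = app [] \<circ> L z" by (simp add: fun_eq_iff app_Nil)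
  ultimately show ?case using base by blast
next
  case (step k w T v b)
  then obtain z T' where z: "z \<in> Z" "T' \<in> U w" "T = T' \<circ> L z" by blast
  have "L b \<circ> T' \<in> U (v + w)" by (rule U_comp) (use step z in auto)
  moreover have "L b \<circ> T = (L b \<circ> T') \<circ> L z" by (simp only: z(3) comp_assoc)
  ultimately show ?case using z(1) by (metis add.commute)
qed

lemma PG_zero:
  obtains m where "m > 0" "W1.PG m = {0}"
proof -
  obtain m where m: "m > 0" "\<And>n T. m \<le> n \<Longrightarrow> T \<in> U n \<Longrightarrow> T = 0" by (rule U_zero) (rule that)
  have "T = 0" if w: "m \<le> w" "W1.wd k w T" for k w T
  proof -
    obtain z T' where z: "T' \<in> U w" "T = T' \<circ> L z" using word_factor[OF w(2)] by blast
    then have "T' = 0" using m(2) w(1) by blast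
    then show ?thesis by (simp add: z(2) fun_eq_iff)
  qed
  then have "W1.SG m \<subseteq> {0}"
    unfolding W1.SG_def by (intro E.span_minimal) (blast, simp)
  then have "W1.PG m \<subseteq> {0}" unfolding W1.PG_def by auto
  then show ?thesis using that[OF m(1)] subspace_0[OF W1.PG_subspace] by blast
qed

text \<open>Values of words of positive weight lie in \<open>W1.PG 1\<close>. A word of weight 0
  contains no letter, so its value is central, and its semisimple part is split off by
  \<open>V_split\<close>.\<close>

lemma Q_plus_R: "\<exists>q\<in>Q. \<exists>r\<in>W1.PG 1. x = q + r"
proof -
  let ?S = "{q + r | q r. q \<in> Q \<and> r \<in> W1.PG 1}"
  have S: "subspace ?S" by (rule subspace_sums[OF Q_subspace W1.PG_subspace])
  have "x \<in> W1.PG 0" by (simp add: PG_0)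
  then obtain T where T: "x = T e" "T \<in> W1.SG 0" unfolding W1.PG_def by blast
  have "T e \<in> ?S"
  proof (rule eval_span[OF S _ T(2)[unfolded W1.SG_def]])
    fix T assume "T \<in> {T. \<exists>k w. 0 \<le> w \<and> W1.wd k w T}"
    then obtain k w where w: "W1.wd k w T" by blast
    show "T e \<in> ?S"
    proof (cases "0 < w")
      case True
      then have "T \<in> W1.SG 1" by (intro W1.SG_I[OF w]) simp
      then have "T e \<in> W1.PG 1" unfolding W1.PG_def by blast
      then have "0 + T e \<in> ?S" using subspace_0[OF Q_subspace] by blast
      then show ?thesis by simp
    next
      case False
      from w have "\<exists>z\<in>Z. T = L z"
        by (cases rule: word.cases) (use False in auto)
      then obtain z where z: "z \<in> Z" "T = L z" by blast
      then obtain u where u: "u \<in> Q" "z - u \<in> V'" using V_split Z_V by blast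
      have "u + (z - u) \<in> ?S" using u V'_PG by blast
      then show ?thesis by (simp add: z)
    qed
  qed
  then show ?thesis using T(1) by blast
qed

lemma is_prod_PG: "is_prod mult (W1.PG 1) n x \<Longrightarrow> x \<in> W1.PG n"
  by (induction rule: is_prod.induct) (auto intro: W1.PG_mult)

lemma rpow_PG: "x \<in> W1.PG 1 \<Longrightarrow> rpow mult x n \<in> W1.PG (Suc n)"
proof (induction n)
  case (Suc n)
  then show ?case using W1.PG_mult[of "rpow mult x n" "Suc n" x 1] by simp
qed simp

theorem decomposition:
  "is_ideal scale mult (W1.PG 1)" "nilpotent_set mult (W1.PG 1)"
  "subalgebra scale mult Q" "Q \<subseteq> centre mult"
  "\<forall>q\<in>Q. nilpotent_elem mult q \<longrightarrow> q = 0"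
  "Q \<inter> W1.PG 1 = {0}" "{q + r | q r. q \<in> Q \<and> r \<in> W1.PG 1} = UNIV"
proof -
  obtain m where m: "m > 0" "W1.PG m = {0}" by (rule PG_zero)
  show "is_ideal scale mult (W1.PG 1)"
    unfolding is_ideal_def
    using W1.PG_mult[of _ 0 _ 1] W1.PG_mult[of _ 1 _ 0] PG_0 W1.PG_subspace by simp
  show "nilpotent_set mult (W1.PG 1)"
    unfolding nilpotent_set_def
  proof (intro exI[of _ m] conjI allI impI m(1))
    fix x assume "is_prod mult (W1.PG 1) m x"
    then have "x \<in> W1.PG m" by (rule is_prod_PG)
    then show "x = 0" by (simp add: m(2))
  qed
  show "subalgebra scale mult Q" unfolding Defs.subalgebra_def using Q_subspace Q_mult by blast
  show "Q \<subseteq> centre mult" by (rule Q_Z)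
  show "\<forall>q\<in>Q. nilpotent_elem mult q \<longrightarrow> q = 0" using Q_nilpotent by blast
  have "x = 0" if "x \<in> Q" "x \<in> W1.PG 1" for x
  proof -
    have "rpow mult x m \<in> W1.PG (Suc m)" by (rule rpow_PG[OF that(2)])
    then have "rpow mult x m = 0" using PG_mono[of m "Suc m"] m(2) by auto
    then have "nilpotent_elem mult x" unfolding nilpotent_elem_def by blast
    then show ?thesis by (rule Q_nilpotent[OF that(1)])
  qed
  then show "Q \<inter> W1.PG 1 = {0}" using subspace_0[OF Q_subspace] subspace_0[OF W1.PG_subspace] by blast
  show "{q + r | q r. q \<in> Q \<and> r \<in> W1.PG 1} = UNIV" using Q_plus_R by blast
qed

section \<open>The lower central series\<close>

lemma triple_comm_Z:
  assumes "z \<in> Z" "b \<in> V" "c \<in> V"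
  shows "triple_comm (a + z) b c = triple_comm a b c" "triple_comm b (a + z) c = triple_comm b a c"
  using Z_D(5)[OF assms(1), of b c] by (simp_all add: triple_comm_def mult_simps)

text \<open>Elements of \<open>V0\<close> lie in depth 1 only up to a central summand, which triple
  products do not see. Every triple product therefore gains depth; from the first step on it lies in
  the stated depth without correction. The set \<open>V0\<close> is kept apart from \<open>V\<close>
  because the latter has been enlarged by the centre.\<close>

lemma lts_lcs_bound:
  assumes V0: "V0 \<subseteq> V" "subspace V0" "\<And>a b c. a \<in> V0 \<Longrightarrow> b \<in> V0 \<Longrightarrow> c \<in> V0 \<Longrightarrow> triple mult a b c \<in> V0"
  shows "lts_lcs scale mult V0 n \<subseteq> V0 \<and> (\<forall>x\<in>lts_lcs scale mult V0 n. \<exists>z\<in>Z. x - z \<in> V \<and> L (x - z) \<in> U n)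
    \<and> lts_lcs scale mult V0 (Suc n) \<subseteq> {x. L x \<in> U (Suc n)}"
proof -
  let ?C = "\<lambda>n. lts_lcs scale mult V0 n \<subseteq> V0 \<and> (\<forall>x\<in>lts_lcs scale mult V0 n. \<exists>z\<in>Z. x - z \<in> V \<and> L (x - z) \<in> U n)"
  have tri: "triple mult a b c = triple_comm a b c" if "a \<in> V" "b \<in> V" for a b c
    using V_comm[OF that] by (simp add: triple_def triple_comm_def)
  have split: "\<exists>z\<in>Z. b - z \<in> V' \<and> L (b - z) \<in> U 1" if "b \<in> V" for b
    using V_split[OF that] U_L Q_Z by blast
  have sub: "subspace {x. L x \<in> U k}" for k
    by (rule subspaceI)
      (simp_all only: mem_Collect_eq L_lin_simps E.subspace_0[OF U_subspace] E.subspace_add[OF U_subspace]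
        E.subspace_scale[OF U_subspace])
  have gen: "triple mult a b c \<in> {x. L x \<in> U (Suc n)}"
    if a: "a \<in> V" and b: "b \<in> V" and c: "c \<in> V"
      and x: "za \<in> Z" "a - za \<in> V" "L (a - za) \<in> U i" and y: "zb \<in> Z" "b - zb \<in> V" "L (b - zb) \<in> U j"
      and z: "zc \<in> Z" "c - zc \<in> V" "L (c - zc) \<in> U k" and s: "Suc n \<le> i + j + k" for a b c za zb zc i j k n
  proof -
    have "triple_comm a b c = triple_comm (a - za) b c"
      using triple_comm_Z(1)[OF x(1) b c, of "a - za"] by simp
    also have "\<dots> = triple_comm (a - za) (b - zb) c"
      using triple_comm_Z(2)[OF y(1) x(2) c, of "b - zb"] by simp
    also have "\<dots> = triple_comm (a - za) (b - zb) (c - zc)"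
      using triple_Z[OF x(2) y(2) z(1)] lin_diff[OF triple_lin, of "a - za" "b - zb" c zc] by simp
    finally have "triple mult a b c = triple_comm (a - za) (b - zb) (c - zc)" using tri[OF a b] by simp
    moreover have "L (triple_comm (a - za) (b - zb) (c - zc)) \<in> U (i + j + k)"
      by (rule U_triple) (use x y z in auto)
    ultimately show ?thesis using U_mono[OF s] by auto
  qed
  have stp: "lts_lcs scale mult V0 (Suc n) \<subseteq> {x. L x \<in> U (Suc n)} \<inter> V0" if C: "?C n" for n
  proof -
    have s: "subspace ({x. L x \<in> U (Suc n)} \<inter> V0)" by (rule subspace_inter[OF sub V0(2)])
    show ?thesis unfolding lts_lcs.simps
    proof (rule span_minimal[OF _ s], rule subsetI)
      fix x assume "x \<in> {triple mult a b c | a b c. a \<in> lts_lcs scale mult V0 n \<and> b \<in> V0 \<and> c \<in> V0} \<union>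
        {triple mult a b c | a b c. a \<in> V0 \<and> b \<in> V0 \<and> c \<in> lts_lcs scale mult V0 n}"
      then consider a b c where "x = triple mult a b c" "a \<in> lts_lcs scale mult V0 n" "b \<in> V0" "c \<in> V0"
        | a b c where "x = triple mult a b c" "a \<in> V0" "b \<in> V0" "c \<in> lts_lcs scale mult V0 n" by blast
      then show "x \<in> {x. L x \<in> U (Suc n)} \<inter> V0"
      proof cases
        case 1
        have m: "a \<in> V0" "b \<in> V" "c \<in> V" "a \<in> V" using 1 C V0(1) by blast+
        obtain za where za: "za \<in> Z" "a - za \<in> V" "L (a - za) \<in> U n" using C 1(2) by blast
        obtain zb where zb: "zb \<in> Z" "b - zb \<in> V'" "L (b - zb) \<in> U 1" using split[OF m(2)] by blast
        obtain zc where zc: "zc \<in> Z" "c - zc \<in> V'" "L (c - zc) \<in> U 1" using split[OF m(3)] by blast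
        show ?thesis using gen[OF m(4,2,3) za zb(1) V'_V[OF zb(2)] zb(3) zc(1) V'_V[OF zc(2)] zc(3), of n]
            V0(3)[OF m(1) 1(3,4)] 1(1) by simp
      next
        case 2
        have m: "c \<in> V0" "a \<in> V" "b \<in> V" "c \<in> V" using 2 C V0(1) by blast+
        obtain zc where zc: "zc \<in> Z" "c - zc \<in> V" "L (c - zc) \<in> U n" using C 2(4) by blast
        obtain za where za: "za \<in> Z" "a - za \<in> V'" "L (a - za) \<in> U 1" using split[OF m(2)] by blast
        obtain zb where zb: "zb \<in> Z" "b - zb \<in> V'" "L (b - zb) \<in> U 1" using split[OF m(3)] by blast
        show ?thesis using gen[OF m(2,3,4) za(1) V'_V[OF za(2)] za(3) zb(1) V'_V[OF zb(2)] zb(3) zc, of n]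
            V0(3)[OF 2(2,3) m(1)] 2(1) by simp
      qed
    qed
  qed
  have "?C n" for n
  proof (induction n)
    case 0
    show ?case
    proof (intro conjI ballI)
      fix x assume "x \<in> lts_lcs scale mult V0 0"
      then have "x \<in> V" using V0(1) by auto
      then obtain z where "z \<in> Z" "x - z \<in> V'" "L (x - z) \<in> U 1" using split by blast
      then show "\<exists>z\<in>Z. x - z \<in> V \<and> L (x - z) \<in> U 0" using V'_V U_mono[of 0 1] by blast
    qed simp
  next
    case (Suc n)
    show ?case
    proof (intro conjI ballI)
      show "lts_lcs scale mult V0 (Suc n) \<subseteq> V0" using stp[OF Suc] by (rule subset_trans) (rule Int_lower2)
      fix x assume "x \<in> lts_lcs scale mult V0 (Suc n)"
      then have "x \<in> {x. L x \<in> U (Suc n)} \<inter> V0" by (rule subsetD[OF stp[OF Suc]])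
      then have "x \<in> V" "L x \<in> U (Suc n)" using V0(1) by auto
      then show "\<exists>z\<in>Z. x - z \<in> V \<and> L (x - z) \<in> U (Suc n)"
        using subspace_0[OF Z_subspace] by (intro bexI[of _ 0]) simp_all
    qed
  qed
  then show ?thesis using stp by blast
qed

lemma lts_nilpotent_sub:
  assumes V0: "V0 \<subseteq> V" "subspace V0" "\<And>a b c. a \<in> V0 \<Longrightarrow> b \<in> V0 \<Longrightarrow> c \<in> V0 \<Longrightarrow> triple mult a b c \<in> V0"
  shows "lts_nilpotent scale mult V0"
proof -
  obtain m where m: "m > 0" "\<And>n T. m \<le> n \<Longrightarrow> T \<in> U n \<Longrightarrow> T = 0" by (rule U_zero) (rule that)
  have "lts_lcs scale mult V0 (Suc m) \<subseteq> {0}"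
  proof
    fix x assume "x \<in> lts_lcs scale mult V0 (Suc m)"
    then have "L x \<in> U (Suc m)" using lts_lcs_bound[OF V0, of m] by blast
    then have "L x = L 0" using m(2)[of "Suc m" "L x"] L_lin_simps(4) by simp
    then show "x \<in> {0}" using L_inj by simp
  qed
  moreover have "0 \<in> lts_lcs scale mult V0 (Suc m)" by (simp add: span_zero)
  ultimately show ?thesis unfolding lts_nilpotent_def by blast
qed

end

theorem theorem1p2:
  fixes scale :: "'f::field_char_0 \<Rightarrow> 'v::ab_group_add \<Rightarrow> 'v"
    and mult :: "'v \<Rightarrow> 'v \<Rightarrow> 'v" and e :: 'v and V :: "'v set"
  assumes "nalg scale mult"
    and "fin_dim scale"
    and "is_unit_elem mult e"
    and "lts_subsystem scale mult V"
    and "\<forall>a\<in>V. \<forall>b\<in>V. mult a b = mult b a"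
    and "generates_unital scale mult e V"
  shows "lts_nilpotent scale mult V \<and>
    (\<exists>Q R. is_ideal scale mult R \<and> nilpotent_set mult R \<and>
       subalgebra scale mult Q \<and> Q \<subseteq> centre mult \<and>
       (\<forall>q\<in>Q. nilpotent_elem mult q \<longrightarrow> q = 0) \<and>
       Q \<inter> R = {0} \<and> {q + r | q r. q \<in> Q \<and> r \<in> R} = UNIV)"
proof -
  interpret vector_space scale using assms(1) by (simp add: nalg_def)
  interpret lin_space_0 scale by unfold_locales
  interpret fd_algebra scale mult e
  proof (rule fd_algebra.intro[OF lin_space_0_axioms], rule fd_algebra_axioms.intro)
    obtain B where "finite_dimensional_vector_space scale B" using assms(2) by (auto simp: fin_dim_def)
    then interpret fdv: finite_dimensional_vector_space scale B .
    show "fin_span UNIV"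
      unfolding fin_span_def using fdv.finite_Basis fdv.independent_Basis fdv.span_Basis by blast
  qed (use assms(1,3) in \<open>auto simp: nalg_def is_unit_elem_def\<close>)
  have V: "subspace V" "V \<subseteq> LN_alt mult" "\<And>a b c. a \<in> V \<Longrightarrow> b \<in> V \<Longrightarrow> c \<in> V \<Longrightarrow> triple mult a b c \<in> V"
    using assms(4) by (auto simp: lts_subsystem_def)
  have comm: "mult a b = mult b a" if "a \<in> V" "b \<in> V" for a b using assms(5) that by blast
  \<comment> \<open>The enlargement required by \<open>Z_V\<close>; nilpotency of the given
    \<open>V\<close> is recovered at the end by \<open>lts_nilpotent_sub\<close>.\<close>
  let ?W = "{v + z | v z. v \<in> V \<and> z \<in> centre mult}"
  have VW: "V \<subseteq> ?W"
  proof
    fix v assume "v \<in> V"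
    then have "v + 0 \<in> ?W" using subspace_0[OF Z_subspace] by blast
    then show "v \<in> ?W" by simp
  qed
  interpret comm_alt_algebra scale mult e ?W
  proof
    show "subspace ?W" by (rule subspace_sums[OF V(1) Z_subspace])
    show "centre mult \<subseteq> ?W"
    proof
      fix z assume "z \<in> centre mult"
      then have "0 + z \<in> ?W" using subspace_0[OF V(1)] by blast
      then show "z \<in> ?W" by simp
    qed
    fix a assume "a \<in> ?W"
    then obtain v z where a: "a = v + z" "v \<in> V" "z \<in> centre mult" by blast
    have arith: "p + s = r + t" if "p - r = - (s - t)" for p r s t :: 'v
      using that by (simp add: algebra_simps)
    have "associator mult v x y = - associator mult x v y" for x y using a(2) V(2) by (auto simp: LN_alt_def)
    then have alt: "mult (mult v x + mult x v) y = mult v (mult x y) + mult x (mult v y)" for x y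
      unfolding associator_def mult_simps by (rule arith)
    show "mult (mult a x + mult x a) y = mult a (mult x y) + mult x (mult a y)" for x y
    proof -
      have "mult (mult a x + mult x a) y
          = mult (mult v x + mult x v) y + (mult (mult z x) y + mult (mult x z) y)"
        by (simp add: a(1) mult_simps)
      also have "\<dots> = (mult v (mult x y) + mult x (mult v y)) + (mult z (mult x y) + mult x (mult z y))"
        unfolding alt Z_D(2)[OF a(3)] Z_D(3)[OF a(3)] ..
      finally show ?thesis by (simp add: a(1) mult_simps)
    qed
    fix b assume "b \<in> ?W"
    then obtain v' z' where b: "b = v' + z'" "v' \<in> V" "z' \<in> centre mult" by blast
    show "mult a b = mult b a"
      using comm[OF a(2) b(2)] Z_D(1)[OF a(3), of v'] Z_D(1)[OF b(3), of v] Z_D(1)[OF a(3), of z']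
      by (simp add: a(1) b(1) mult_simps)
    fix c assume "c \<in> ?W"
    then obtain v'' z'' where c: "c = v'' + z''" "v'' \<in> V" "z'' \<in> centre mult" by blast
    \<comment> \<open>Central summands drop out of the triple product, so that of \<open>?W\<close>
      takes its values in \<open>V\<close>.\<close>
    have z1: "triple_comm (v + z) y x = triple_comm v y x" for x y
      using Z_D(5)[OF a(3), of y x] by (simp add: triple_comm_def mult_simps)
    have z2: "triple_comm x (v' + z') y = triple_comm x v' y" for x y
      using Z_D(5)[OF b(3), of x y] by (simp add: triple_comm_def mult_simps)
    have z3: "triple_comm v v' (v'' + z'') = triple_comm v v' v''"
      using Z_D(1)[OF c(3), of v] Z_D(1)[OF c(3), of v'] Z_D(5)[OF c(3), of v v'] Z_D(5)[OF c(3), of v' v]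
        comm[OF a(2) b(2)]
      by (simp add: triple_comm_def mult_simps)
    have "triple_comm a b c = triple mult v v' v''"
      unfolding a(1) b(1) c(1) z1 z2 z3 using comm[OF a(2) b(2)] by (simp add: triple_comm_def triple_def)
    then show "triple_comm a b c \<in> ?W" using V(3)[OF a(2) b(2) c(2)] VW by auto
  next
    fix S assume S: "subspace S" "e \<in> S" "?W \<subseteq> S" "\<And>x y. x \<in> S \<Longrightarrow> y \<in> S \<Longrightarrow> mult x y \<in> S"
    have "Defs.subalgebra scale mult S" unfolding Defs.subalgebra_def using S(1,4) by simp
    moreover have "V \<subseteq> S" by (rule subset_trans[OF VW S(3)])
    ultimately show "S = UNIV" using assms(6) S(2) unfolding generates_unital_def by simp
  qed
  show ?thesis
    by (intro conjI exI[of _ Q] exI[of _ "W1.PG 1"] lts_nilpotent_sub[OF VW V(1)] V(3) decomposition)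
qed

end
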